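(* Let $0<\varepsilon<1$ and let $\pi$ be a private coin protocol with inputs $(X,Y)\sim\mathrm{P}_{XY}$, with a bounded number of rounds, and with $\mathtt{V}(\pi)>0$. Then, as $n\to\infty$, $$D_\varepsilon(\pi^n|\mathrm{P}_{XY}^n)=n\,\mathtt{IC}(\pi)+\sqrt{n\,\mathtt{V}(\pi)}\;Q^{-1}(\varepsilon)+o(\sqrt n),$$ where $Q(x)$ is the probability that a standard normal random variable exceeds $x$.
   Context: All logarithms are to base 2. $X$ and $Y$ are random variables with values in finite sets $\mathcal{X},\mathcal{Y}$ and fixed joint distribution $\mathrm{P}_{XY}$. Party 1 observes $X$ and Party 2 observes $Y$. Interactive protocol. An interactive protocol uses shared public randomness $U$ and private randomness $U_{\mathcal{X}}$ (Party 1) and $U_{\mathcal{Y}}$ (Party 2), where $U,U_{\mathcal{X}},U_{\mathcal{Y}}$ are mutually independent and jointly independent of the inputs. Party 1 sends messages in odd rounds, Party 2 in even rounds. In round $i$ the communicating party sends a bit string $\Pi_i\in\{0,1\}^*$ determined by the previous messages $\Pi^{i-1}=(\Pi_1,\dots,\Pi_{i-1})$ and that party's observations ($(X,U_{\mathcal{X}},U)$ for Party 1, $(Y,U_{\mathcal{Y}},U)$ for Party 2). Each possible value of $\Pi_i$ is associated with a next state: "continue" (the other party sends the next message) or "stop" (the protocol ends). The set $\mathcal{C}_i$ of possible values of $\Pi_i$ and the associated next states are determined by a common function, i.e., by a random variable $V$ with $H(V|X,U_{\mathcal{X}},U,\Pi^{i-1})=H(V|Y,U_{\mathcal{Y}},U,\Pi^{i-1})=0$.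 The transcript $\Pi$ is the sequence of all messages. The length $|\pi|$ of a protocol $\pi$ is the maximum number of bits communicated in any execution. A private coin protocol is one with $U$ constant. Bounded number of rounds means that the number of rounds is at most some constant $d<\infty$ with probability 1. A random variable $F$ is recoverable by $\pi$ for Party 1 (Party 2) if $F$ is a function of $(X,U,U_{\mathcal{X}},\Pi)$ (of $(Y,U,U_{\mathcal{Y}},\Pi)$). Simulation. For a private coin protocol $\pi$ with transcript $\Pi$ and $0\le\varepsilon<1$, a protocol $\pi_{\mathrm{sim}}$ (public and private randomness allowed) is an $\varepsilon$-simulation of $\pi$ if there are $\Pi_{\mathcal{X}}$ and $\Pi_{\mathcal{Y}}$, recoverable by $\pi_{\mathrm{sim}}$ for Party 1 and Party 2 respectively, with $d_{\mathrm{var}}(\mathrm{P}_{\Pi\Pi XY},\mathrm{P}_{\Pi_{\mathcal{X}}\Pi_{\mathcal{Y}}XY})\le\varepsilon$, where $d_{\mathrm{var}}(\mathrm{P},\mathrm{Q})=\frac12\sum_x|\mathrm{P}(x)-\mathrm{Q}(x)|$ and $\mathrm{P}_{\Pi\Pi XY}$ is the law of $(\Pi,\Pi,X,Y)$. $D_\varepsilon(\pi|\mathrm{P}_{XY})$ is the minimum length of an $\varepsilon$-simulation of $\pi$ when the inputs have distribution $\mathrm{P}_{XY}$. Product protocol. $\mathrm{P}_{XY}^n$ is the law of $n$ i.i.d. copies $(X_i,Y_i)_{i=1}^n$ of $(X,Y)$; Party 1 observes $X^n$, Party 2 observes $Y^n$. $\pi^n$ denotes running $\pi$ on each coordinate $(X_i,Y_i)$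 with independent private randomness, so its transcript $\Pi^n$ consists of $n$ transcripts and $(\Pi^n,X^n,Y^n)$ is $n$ i.i.d. copies of $(\Pi,X,Y)$. Information complexity. $\mathrm{ic}(\tau;x,y)=\log\frac{\mathrm{P}_{\Pi|XY}(\tau|x,y)}{\mathrm{P}_{\Pi|X}(\tau|x)}+\log\frac{\mathrm{P}_{\Pi|XY}(\tau|x,y)}{\mathrm{P}_{\Pi|Y}(\tau|y)}$; $\mathtt{IC}(\pi)=\mathbb{E}[\mathrm{ic}(\Pi;X,Y)]=I(\Pi\wedge X|Y)+I(\Pi\wedge Y|X)$ (conditional mutual informations); $\mathtt{V}(\pi)=\mathrm{Var}[\mathrm{ic}(\Pi;X,Y)]$.
   Formalization: The minimum D_ε ranges over simulating protocols whose message sets C_i are prefix-free (otherwise silent rounds convey any number with one bit, so D_ε ≤ 2 and the claim fails) and whose public and private randomness is real-valued; the simulated π is not so restricted. *)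

theory Defs
  imports "HOL-Probability.Probability" "HOL-Library.Sublist" "HOL-Library.Landau_Symbols"
begin

section \<open>Interactive protocols\<close>

type_synonym bits = "bool list"

datatype next_state = Continue | Stop

text \<open>
  A codebook is the pair consisting of the set of possible values of a message (its domain) and the
  next state attached to each of them.
\<close>

type_synonym codebook = "bits \<rightharpoonup> next_state"

text \<open>
  \<open>pub\<close>, \<open>coin1\<close>, \<open>coin2\<close> are the laws of the public randomness and of the private randomness of
  Party 1 and Party 2. The list of earlier messages is the last argument of the remaining fields.
  \<open>book1\<close> and \<open>book2\<close> compute the codebook of the coming round, whoever sends in it, from what
  Party 1, respectively Party 2, knows; they are required to agree below, and this is what makes the
  codebook a common function of the knowledge of the two parties (almost surely).
\<close>

record ('x, 'y, 'u, 'a, 'b) protocol =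
  pub :: "'u measure"
  coin1 :: "'a measure"
  coin2 :: "'b measure"
  msg1 :: "'x \<Rightarrow> 'u \<Rightarrow> 'a \<Rightarrow> bits list \<Rightarrow> bits"
  msg2 :: "'y \<Rightarrow> 'u \<Rightarrow> 'b \<Rightarrow> bits list \<Rightarrow> bits"
  book1 :: "'x \<Rightarrow> 'u \<Rightarrow> 'a \<Rightarrow> bits list \<Rightarrow> codebook"
  book2 :: "'y \<Rightarrow> 'u \<Rightarrow> 'b \<Rightarrow> bits list \<Rightarrow> codebook"

text \<open>Party 1 sends after an even number of messages, that is, in the odd rounds.\<close>

definition next_msg ::
    "('x, 'y, 'u, 'a, 'b) protocol \<Rightarrow> ('x \<times> 'y) \<times> 'u \<times> 'a \<times> 'b \<Rightarrow> bits list \<Rightarrow> bits" where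
  "next_msg \<pi> = (\<lambda>((x, y), u, a, b) t. if even (length t) then msg1 \<pi> x u a t else msg2 \<pi> y u b t)"

text \<open>The choice of \<open>book1\<close> here matters only on the null event on which the codebooks disagree.\<close>

definition next_book ::
    "('x, 'y, 'u, 'a, 'b) protocol \<Rightarrow> ('x \<times> 'y) \<times> 'u \<times> 'a \<times> 'b \<Rightarrow> bits list \<Rightarrow> codebook" where
  "next_book \<pi> = (\<lambda>((x, y), u, a, b) t. book1 \<pi> x u a t)"

text \<open>Messages of the first \<open>k\<close> rounds, and the state after them.\<close>

primrec run ::
    "('x, 'y, 'u, 'a, 'b) protocol \<Rightarrow> ('x \<times> 'y) \<times> 'u \<times> 'a \<times> 'b \<Rightarrow> nat \<Rightarrow> bits list \<times> next_state" where
  "run \<pi> \<omega> 0 = ([], Continue)"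
| "run \<pi> \<omega> (Suc k) =
     (let (t, s) = run \<pi> \<omega> k; m = next_msg \<pi> \<omega> t in
      if s = Stop then (t, Stop)
      else (t @ [m], if next_book \<pi> \<omega> t m = Some Continue then Continue else Stop))"

text \<open>The value in a non-terminating execution (a null event) is irrelevant.\<close>

definition transcript ::
    "('x, 'y, 'u, 'a, 'b) protocol \<Rightarrow> ('x \<times> 'y) \<times> 'u \<times> 'a \<times> 'b \<Rightarrow> bits list" where
  "transcript \<pi> \<omega> =
     (if \<exists>k. snd (run \<pi> \<omega> k) = Stop then fst (run \<pi> \<omega> (LEAST k. snd (run \<pi> \<omega> k) = Stop)) else [])"

text \<open>
  The inputs and the three sources of randomness; the product measure expresses their mutual
  independence.
\<close>

definition sample_space ::
    "('x \<times> 'y) pmf \<Rightarrow> ('x, 'y, 'u, 'a, 'b) protocol \<Rightarrow> (('x \<times> 'y) \<times> 'u \<times> 'a \<times> 'b) measure" where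
  "sample_space P \<pi> = measure_pmf P \<Otimes>\<^sub>M (pub \<pi> \<Otimes>\<^sub>M (coin1 \<pi> \<Otimes>\<^sub>M coin2 \<pi>))"

text \<open>
  Reached histories at which a further message is due.
\<close>

definition pending ::
    "('x, 'y, 'u, 'a, 'b) protocol \<Rightarrow> ('x \<times> 'y) \<times> 'u \<times> 'a \<times> 'b \<Rightarrow> bits list set" where
  "pending \<pi> \<omega> = {t. \<exists>k. run \<pi> \<omega> k = (t, Continue)}"

definition is_protocol :: "('x \<times> 'y) pmf \<Rightarrow> ('x, 'y, 'u, 'a, 'b) protocol \<Rightarrow> bool" where
  "is_protocol P \<pi> \<longleftrightarrow>
     prob_space (pub \<pi>) \<and> prob_space (coin1 \<pi>) \<and> prob_space (coin2 \<pi>) \<and>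
     (\<forall>x t. (\<lambda>(u, a). msg1 \<pi> x u a t) \<in> pub \<pi> \<Otimes>\<^sub>M coin1 \<pi> \<rightarrow>\<^sub>M count_space UNIV) \<and>
     (\<forall>y t. (\<lambda>(u, b). msg2 \<pi> y u b t) \<in> pub \<pi> \<Otimes>\<^sub>M coin2 \<pi> \<rightarrow>\<^sub>M count_space UNIV) \<and>
     (\<forall>x t m. (\<lambda>(u, a). book1 \<pi> x u a t m) \<in> pub \<pi> \<Otimes>\<^sub>M coin1 \<pi> \<rightarrow>\<^sub>M count_space UNIV) \<and>
     (\<forall>y t m. (\<lambda>(u, b). book2 \<pi> y u b t m) \<in> pub \<pi> \<Otimes>\<^sub>M coin2 \<pi> \<rightarrow>\<^sub>M count_space UNIV) \<and>
     (AE ((x, y), u, a, b) in sample_space P \<pi>. \<forall>t \<in> pending \<pi> ((x, y), u, a, b).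
        book1 \<pi> x u a t = book2 \<pi> y u b t) \<and>
     (AE \<omega> in sample_space P \<pi>. \<forall>t \<in> pending \<pi> \<omega>. next_msg \<pi> \<omega> t \<in> dom (next_book \<pi> \<omega> t)) \<and>
     (AE \<omega> in sample_space P \<pi>. \<exists>k. snd (run \<pi> \<omega> k) = Stop)"

definition private_coin :: "('x, 'y, 'u, 'a, 'b) protocol \<Rightarrow> bool" where
  "private_coin \<pi> \<longleftrightarrow> (\<exists>c \<in> space (pub \<pi>). AE u in pub \<pi>. u = c)"

definition bounded_rounds :: "('x \<times> 'y) pmf \<Rightarrow> ('x, 'y, 'u, 'a, 'b) protocol \<Rightarrow> bool" where
  "bounded_rounds P \<pi> \<longleftrightarrow> (\<exists>d. AE \<omega> in sample_space P \<pi>. snd (run \<pi> \<omega> d) = Stop)"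

text \<open>
  Number of bits sent in the worst case over all executions; only the bits of the messages are
  counted.
\<close>

definition protocol_length :: "('x \<times> 'y) pmf \<Rightarrow> ('x, 'y, 'u, 'a, 'b) protocol \<Rightarrow> enat" where
  "protocol_length P \<pi> =
     (SUP \<omega> \<in> set_pmf P \<times> space (pub \<pi>) \<times> space (coin1 \<pi>) \<times> space (coin2 \<pi>).
        SUP k. enat (\<Sum>m\<leftarrow>fst (run \<pi> \<omega> k). length m))"

text \<open>
  The end of each message can be read off its bits, given the codebook, which the receiver knows.
  Counting bits is meaningful only for such protocols: if the empty string and the string \<open>1\<close> were
  both possible values in every odd round, then the index of the round in which the string \<open>1\<close> is
  sent would convey an arbitrary natural number at the price of a single bit.
\<close>

definition self_delimiting :: "('x \<times> 'y) pmf \<Rightarrow> ('x, 'y, 'u, 'a, 'b) protocol \<Rightarrow> bool" where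
  "self_delimiting P \<pi> \<longleftrightarrow>
     (AE \<omega> in sample_space P \<pi>. \<forall>t \<in> pending \<pi> \<omega>.
        \<forall>m \<in> dom (next_book \<pi> \<omega> t). \<forall>m' \<in> dom (next_book \<pi> \<omega> t). \<not> strict_prefix m m')"


section \<open>Laws of transcripts\<close>

text \<open>The law of (\<open>\<Pi>\<close>, \<open>X\<close>, \<open>Y\<close>).\<close>

definition joint_law ::
    "('x \<times> 'y) pmf \<Rightarrow> ('x, 'y, 'u, 'a, 'b) protocol \<Rightarrow> (bits list \<times> 'x \<times> 'y) measure" where
  "joint_law P \<pi> =
     distr (sample_space P \<pi>) (count_space UNIV) (\<lambda>\<omega>. (transcript \<pi> \<omega>, fst (fst \<omega>), snd (fst \<omega>)))"

text \<open>Coordinatewise execution on \<open>n\<close> independent copies of inputs and randomness.\<close>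

definition joint_law_n ::
    "nat \<Rightarrow> ('x \<times> 'y) pmf \<Rightarrow> ('x, 'y, 'u, 'a, 'b) protocol
      \<Rightarrow> (bits list list \<times> 'x list \<times> 'y list) measure" where
  "joint_law_n n P \<pi> =
     distr (\<Pi>\<^sub>M i\<in>{..<n}. sample_space P \<pi>) (count_space UNIV)
       (\<lambda>\<omega>. (map (\<lambda>i. transcript \<pi> (\<omega> i)) [0..<n],
             map (\<lambda>i. fst (fst (\<omega> i))) [0..<n],
             map (\<lambda>i. snd (fst (\<omega> i))) [0..<n]))"

definition iid_inputs :: "nat \<Rightarrow> ('x \<times> 'y) pmf \<Rightarrow> ('x list \<times> 'y list) pmf" where
  "iid_inputs n P = map_pmf (\<lambda>zs. (map fst zs, map snd zs)) (replicate_pmf n P)"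


section \<open>Simulation\<close>

definition d_var :: "'z measure \<Rightarrow> 'z measure \<Rightarrow> real" where
  "d_var M N = 1 / 2 * (\<Sum>\<^sub>\<infinity>z. \<bar>measure M {z} - measure N {z}\<bar>)"

text \<open>
  \<open>L\<close> is the law of (\<open>\<Pi>\<close>, \<open>X\<close>, \<open>Y\<close>) for the protocol to be simulated, which enters the notion of a
  simulation only through this law. The functions \<open>f\<close> and \<open>g\<close> recover the two outputs.
\<close>

definition is_simulation ::
    "real \<Rightarrow> ('x \<times> 'y) pmf \<Rightarrow> ('t \<times> 'x \<times> 'y) measure \<Rightarrow> ('x, 'y, 'u, 'a, 'b) protocol \<Rightarrow> bool" where
  "is_simulation \<epsilon> P L \<sigma> \<longleftrightarrow>
     (\<exists>(f :: 'x \<Rightarrow> 'u \<Rightarrow> 'a \<Rightarrow> bits list \<Rightarrow> 't) (g :: 'y \<Rightarrow> 'u \<Rightarrow> 'b \<Rightarrow> bits list \<Rightarrow> 't).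
        (\<forall>x t. (\<lambda>(u, a). f x u a t) \<in> pub \<sigma> \<Otimes>\<^sub>M coin1 \<sigma> \<rightarrow>\<^sub>M count_space UNIV) \<and>
        (\<forall>y t. (\<lambda>(u, b). g y u b t) \<in> pub \<sigma> \<Otimes>\<^sub>M coin2 \<sigma> \<rightarrow>\<^sub>M count_space UNIV) \<and>
        d_var (distr L (count_space UNIV) (\<lambda>(t, x, y). (t, t, x, y)))
              (distr (sample_space P \<sigma>) (count_space UNIV)
                 (\<lambda>((x, y), u, a, b). let t = transcript \<sigma> ((x, y), u, a, b)
                                      in (f x u a t, g y u b t, x, y))) \<le> \<epsilon>)"

text \<open>
  HOL has no quantification over types inside a definition, so the randomness of a simulating
  protocol is taken to be real-valued, with an arbitrary Borel law for each of the three sources.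
  This covers all standard Borel spaces. The infimum of a nonempty set of extended naturals is
  attained.
\<close>

definition min_sim_length ::
    "real \<Rightarrow> ('x \<times> 'y) pmf \<Rightarrow> ('t \<times> 'x \<times> 'y) measure \<Rightarrow> enat" where
  "min_sim_length \<epsilon> P L =
     (INF \<sigma> \<in> {\<sigma> :: ('x, 'y, real, real, real) protocol.
               sets (pub \<sigma>) = sets borel \<and> sets (coin1 \<sigma>) = sets borel \<and>
               sets (coin2 \<sigma>) = sets borel \<and>
               is_protocol P \<sigma> \<and> self_delimiting P \<sigma> \<and> is_simulation \<epsilon> P L \<sigma>}.
        protocol_length P \<sigma>)"


section \<open>Information complexity\<close>

definition cprob :: "'z measure \<Rightarrow> 'z set \<Rightarrow> 'z set \<Rightarrow> real" where
  "cprob M A B = measure M (A \<inter> B) / measure M B"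

definition info_density :: "('t \<times> 'x \<times> 'y) measure \<Rightarrow> 't \<times> 'x \<times> 'y \<Rightarrow> real" where
  "info_density L = (\<lambda>(\<tau>, x, y).
     let T = {\<tau>} \<times> UNIV \<times> UNIV; X = UNIV \<times> {x} \<times> UNIV; Y = UNIV \<times> UNIV \<times> {y} in
     log 2 (cprob L T (X \<inter> Y) / cprob L T X) +
     log 2 (cprob L T (X \<inter> Y) / cprob L T Y))"

definition info_complexity :: "('x \<times> 'y) pmf \<Rightarrow> ('x, 'y, 'u, 'a, 'b) protocol \<Rightarrow> real" where
  "info_complexity P \<pi> = (\<integral>z. info_density (joint_law P \<pi>) z \<partial>joint_law P \<pi>)"

definition info_var :: "('x \<times> 'y) pmf \<Rightarrow> ('x, 'y, 'u, 'a, 'b) protocol \<Rightarrow> real" where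
  "info_var P \<pi> = (\<integral>z. (info_density (joint_law P \<pi>) z - info_complexity P \<pi>)\<^sup>2 \<partial>joint_law P \<pi>)"

definition Q_tail :: "real \<Rightarrow> real" where
  "Q_tail x = measure (density lborel std_normal_density) {x<..}"

end

theory Submission
  imports Defs "HOL-Real_Asymp.Real_Asymp"
begin

text \<open>
  Converse. Fix the public randomness. A transcript \<open>t\<close> together with a common output \<open>\<tau>\<close> has
  probability \<open>a x t \<tau> * b y t \<tau>\<close> given the inputs. By Kraft's inequality for the bits of the other
  party, outside an event of probability about \<open>2 powr - s\<close> the conditional means of \<open>a\<close> given \<open>y\<close>
  and of \<open>b\<close> given \<open>x\<close> have a product of at least \<open>2 powr - (l + 2 * s)\<close>, where \<open>l\<close> is the length.
  The arithmetic-geometric mean inequality survives averaging over the public randomness and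
  bounds \<open>P(\<tau>|xy)\<^sup>2\<close> by \<open>2 powr (l + O(s)) * P(\<tau>|x) * P(\<tau>|y)\<close> on the overlap of the true law and
  the simulated one. Hence the information density exceeds \<open>l + O(s)\<close> with probability at most
  \<open>\<epsilon> + O(2 powr - s)\<close>.

  Achievability. The rounds are simulated one after the other. The sender of a round takes the
  first of a public list of random darts below the graph of its conditional law of the history and
  sends a random hash of it in portions, until the receiver reports that it knows a dart with the
  hash below a suitable multiple of its own conditional law. This costs the logarithm of the ratio
  of the two laws up to lower order terms, and these logarithms sum up to the information density.
  A first portion that reaches almost the mean of the logarithm keeps the number of reports small.

  Both bounds lead to the tail of a sum of independent information densities, and the central
  limit theorem applies.
\<close>


section \<open>Prefix-free sets\<close>

text \<open>Neither party can compute the information density from its own view, and a simulator may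
  use public randomness; these two facts shape the proof. In the converse the product
  \<open>a * b\<close> exists only for fixed public randomness, whereas the marginals to compare
  with are averages over it. The arithmetic-geometric mean is therefore taken with a free weight:
  the bound is linear, and the weight is fixed only after integration. In the achievability part a
  sender does not know the receiver's law, so the length of the hash has to be found by feedback. A
  window of half-width \<open>n powr (5/8)\<close> is wider than fluctuations of order
  \<open>sqrt n\<close>; cut into portions of about \<open>n powr (1/4)\<close> bits it needs about
  \<open>n powr (3/8)\<close> reports, so the overhead is o(\<open>sqrt n\<close>) and the collision
  error still vanishes. The error of a round is kept multiplicative at each transcript, so that it
  passes through the rounds as a factor. Messages are arbitrary bit strings and the law of
  transcripts may have infinite support: finite truncations occur on both sides, and square
  integrability of the single rounds has to be derived.\<close>

definition prefix_free :: "'a list set \<Rightarrow> bool" where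
  "prefix_free S \<longleftrightarrow> (\<forall>m\<in>S. \<forall>m'\<in>S. \<not> strict_prefix m m')"

text \<open>Induction on the maximal length. The empty string is a prefix of everything, so it can
  only occur alone; otherwise the set splits by first bits, and removing that bit doubles all
  weights.\<close>

lemma kraft_inequality:
  fixes S :: "bool list set"
  assumes "finite S" "prefix_free S"
  shows "(\<Sum>m\<in>S. (1/2) ^ length m) \<le> (1::real)"
proof -
  have *: "(\<Sum>m\<in>S. (1/2) ^ length m) \<le> (1::real)"
    if "finite S" "prefix_free S" "\<forall>m\<in>S. length m \<le> n" for n and S :: "bool list set"
    using that
  proof (induction n arbitrary: S)
    case 0
    then have "S \<subseteq> {[]}" by auto
    then show ?case by (cases "S = {}") (auto simp: subset_singleton_iff)
  next
    case (Suc n)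
    show ?case
    proof (cases "[] \<in> S")
      case True
      have "m = []" if "m \<in> S" for m
        using Suc.prems(2) True that unfolding prefix_free_def strict_prefix_def by (metis Nil_prefix)
      then have "S = {[]}" using True by auto
      then show ?thesis by simp
    next
      case False
      define T where "T b = {m. b # m \<in> S}" for b
      have S: "S = (#) True ` T True \<union> (#) False ` T False"
        unfolding T_def using False by (auto simp: image_iff) (metis (full_types) neq_Nil_conv)
      have fin: "finite (T b)" for b
      proof -
        have "(#) b ` T b \<subseteq> S" by (auto simp: T_def)
        then show ?thesis using Suc.prems(1) by (meson finite_imageD finite_subset inj_onI list.inject)
      qed
      have IH: "(\<Sum>m\<in>T b. (1/2) ^ length m) \<le> (1::real)" for b
      proof (rule Suc.IH[OF fin])
        show "prefix_free (T b)"
          using Suc.prems(2) by (fastforce simp: prefix_free_def T_def strict_prefix_def)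
        show "\<forall>m\<in>T b. length m \<le> n"
          using Suc.prems(3) by (fastforce simp: T_def)
      qed
      have "(\<Sum>m\<in>S. (1/2) ^ length m) =
          (\<Sum>m\<in>(#) True ` T True. (1/2) ^ length m) + (\<Sum>m\<in>(#) False ` T False. (1/2::real) ^ length m)"
        unfolding S by (rule sum.union_disjoint) (use fin in auto)
      also have "\<dots> = (\<Sum>m\<in>T True. (1/2) ^ Suc (length m)) + (\<Sum>m\<in>T False. (1/2::real) ^ Suc (length m))"
        by (simp add: sum.reindex)
      also have "\<dots> = (1/2) * (\<Sum>m\<in>T True. (1/2) ^ length m) + (1/2) * (\<Sum>m\<in>T False. (1/2::real) ^ length m)"
        by (simp add: sum_distrib_left sum_divide_distrib)
      also have "\<dots> \<le> 1" using IH[of True] IH[of False] by simp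
      finally show ?thesis .
    qed
  qed
  have "\<forall>m\<in>S. length m \<le> Max (insert 0 (length ` S))"
    using assms(1) by auto
  then show ?thesis using *[OF assms] by blast
qed

section \<open>Executions of interactive protocols: rectangle structure and Markov property\<close>

section \<open>Reached histories as rectangles\<close>

text \<open>The Boolean selects the party: \<open>True\<close> is Party 1.\<close>

definition book_of :: "('x, 'y, 'u, 'a, 'b) protocol \<Rightarrow> bool \<Rightarrow> ('x \<times> 'y) \<times> 'u \<times> 'a \<times> 'b \<Rightarrow> bits list \<Rightarrow> codebook" where
  "book_of \<pi> p = (\<lambda>((x, y), u, a, b) t. if p then book1 \<pi> x u a t else book2 \<pi> y u b t)"

lemma next_book_eq: "next_book \<pi> \<omega> = book_of \<pi> True \<omega>"
  by (auto simp: next_book_def book_of_def fun_eq_iff split: prod.splits)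

definition agree :: "('x, 'y, 'u, 'a, 'b) protocol \<Rightarrow> ('x \<times> 'y) \<times> 'u \<times> 'a \<times> 'b \<Rightarrow> bool" where
  "agree \<pi> \<omega> \<longleftrightarrow> (\<forall>t\<in>pending \<pi> \<omega>. book_of \<pi> True \<omega> t = book_of \<pi> False \<omega> t)"

text \<open>The conditions on \<open>t\<close> that one party can check from its own view: its own
  messages and, in its own codebook, that no earlier message ends the execution. A history is
  reached when the conditions of both parties hold, which makes the event a rectangle in the two
  private coins.\<close>

definition follows :: "('x, 'y, 'u, 'a, 'b) protocol \<Rightarrow> bool \<Rightarrow> ('x \<times> 'y) \<times> 'u \<times> 'a \<times> 'b \<Rightarrow> bits list \<Rightarrow> bool" where
  "follows \<pi> p \<omega> t \<longleftrightarrow>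
     (\<forall>i<length t. (even i \<longleftrightarrow> p) \<longrightarrow> next_msg \<pi> \<omega> (take i t) = t ! i) \<and>
     (\<forall>i. Suc i < length t \<longrightarrow> book_of \<pi> p \<omega> (take i t) (t ! i) = Some Continue)"

definition ended :: "('x, 'y, 'u, 'a, 'b) protocol \<Rightarrow> bool \<Rightarrow> ('x \<times> 'y) \<times> 'u \<times> 'a \<times> 'b \<Rightarrow> bits list \<Rightarrow> bool" where
  "ended \<pi> p \<omega> t \<longleftrightarrow> t \<noteq> [] \<and> book_of \<pi> p \<omega> (butlast t) (last t) \<noteq> Some Continue"

definition path :: "('x, 'y, 'u, 'a, 'b) protocol \<Rightarrow> ('x \<times> 'y) \<times> 'u \<times> 'a \<times> 'b \<Rightarrow> bits list \<Rightarrow> bool" where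
  "path \<pi> \<omega> t \<longleftrightarrow> (\<forall>i<length t. next_msg \<pi> \<omega> (take i t) = t ! i) \<and>
     (\<forall>i. Suc i < length t \<longrightarrow> book_of \<pi> True \<omega> (take i t) (t ! i) = Some Continue)"

lemma path_Nil [simp]: "path \<pi> \<omega> []"
  by (simp add: path_def)

lemma path_snoc:
  "path \<pi> \<omega> (t @ [m]) \<longleftrightarrow> path \<pi> \<omega> t \<and> \<not> ended \<pi> True \<omega> t \<and> next_msg \<pi> \<omega> t = m"
proof (cases t rule: rev_cases)
  case Nil
  then show ?thesis by (simp add: path_def ended_def)
next
  case (snoc t' m')
  have "path \<pi> \<omega> (t @ [m]) \<longleftrightarrow>
      (\<forall>i<length t. next_msg \<pi> \<omega> (take i t) = t ! i) \<and> next_msg \<pi> \<omega> t = m \<and>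
     (\<forall>i<length t. book_of \<pi> True \<omega> (take i t) (t ! i) = Some Continue)"
    by (simp add: path_def All_less_Suc nth_append conj_ac)
  moreover have "(\<forall>i<length t. book_of \<pi> True \<omega> (take i t) (t ! i) = Some Continue) \<longleftrightarrow>
     (\<forall>i. Suc i<length t \<longrightarrow> book_of \<pi> True \<omega> (take i t) (t ! i) = Some Continue) \<and> \<not> ended \<pi> True \<omega> t"
    by (auto simp: snoc ended_def less_Suc_eq nth_append) (metis Suc_lessI)
  ultimately show ?thesis by (auto simp: path_def)
qed

text \<open>Replaces the recursion by a condition on the history alone. Read at step
  \<open>k\<close>, the induction hypothesis also says that at most one pair satisfies the
  condition; the direction from the condition to the run rests on this.\<close>

lemma run_eq_iff:
  "run \<pi> \<omega> k = (t, s) \<longleftrightarrow> path \<pi> \<omega> t \<and>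
     (if s = Stop then length t \<le> k \<and> ended \<pi> True \<omega> t else length t = k \<and> \<not> ended \<pi> True \<omega> t)"
proof (induction k arbitrary: t s)
  case 0
  then show ?case by (cases s) (auto simp: ended_def)
next
  case (Suc k)
  obtain t0 s0 where r: "run \<pi> \<omega> k = (t0, s0)" by fastforce
  have unique: "t1 = t0 \<and> s1 = s0" if "path \<pi> \<omega> t1 \<and>
     (if s1 = Stop then length t1 \<le> k \<and> ended \<pi> True \<omega> t1 else length t1 = k \<and> \<not> ended \<pi> True \<omega> t1)" for t1 s1
  proof -
    have "run \<pi> \<omega> k = (t1, s1)" using Suc.IH that by blast
    then show ?thesis using r by simp
  qed
  note IH = Suc.IH[of t0 s0, unfolded r, simplified]
  show ?case
  proof (cases "s0 = Stop")
    case True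
    then have stopped: "path \<pi> \<omega> t0" "length t0 \<le> k" "ended \<pi> True \<omega> t0"
      using IH by auto
    have "run \<pi> \<omega> (Suc k) = (t0, Stop)" using r True by simp
    moreover have claim: "t = t0 \<and> s = Stop" if *: "path \<pi> \<omega> t"
     "if s = Stop then length t \<le> Suc k \<and> ended \<pi> True \<omega> t else length t = Suc k \<and> \<not> ended \<pi> True \<omega> t"
    proof (cases "length t = Suc k")
      case False
      then have "s = Stop" "length t \<le> k \<and> ended \<pi> True \<omega> t" using *(2) by (auto split: if_splits)
      then show ?thesis using unique[of t Stop] *(1) by auto
    next
      case True
      then obtain t' m where t: "t = t' @ [m]" by (metis length_Suc_conv_rev)
      then have "path \<pi> \<omega> t'" "\<not> ended \<pi> True \<omega> t'" "length t' = k"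
        using *(1) True by (auto simp: path_snoc)
      then have "s0 = Continue" using unique[of t' Continue] by auto
      then show ?thesis using \<open>s0 = Stop\<close> by simp
    qed
    ultimately show ?thesis
      using stopped by (metis le_SucI prod.inject)
  next
    case False
    then have going: "path \<pi> \<omega> t0" "length t0 = k" "\<not> ended \<pi> True \<omega> t0" "s0 = Continue"
      using IH by (auto intro: next_state.exhaust)
    let ?m = "next_msg \<pi> \<omega> t0"
    have run: "run \<pi> \<omega> (Suc k) = (t0 @ [?m], if ended \<pi> True \<omega> (t0 @ [?m]) then Stop else Continue)"
      using r going by (simp add: next_book_eq ended_def)
    have p: "path \<pi> \<omega> (t0 @ [?m])" using going by (simp add: path_snoc)
    have "t = t0 @ [?m]" if *: "path \<pi> \<omega> t"
     "if s = Stop then length t \<le> Suc k \<and> ended \<pi> True \<omega> t else length t = Suc k \<and> \<not> ended \<pi> True \<omega> t"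
    proof (cases "length t = Suc k")
      case False
      then have "s = Stop" "length t \<le> k \<and> ended \<pi> True \<omega> t" using *(2) by (auto split: if_splits)
      then show ?thesis using unique[of t Stop] *(1) going by auto
    next
      case True
      then obtain t' m where t: "t = t' @ [m]" by (metis length_Suc_conv_rev)
      then have "path \<pi> \<omega> t'" "\<not> ended \<pi> True \<omega> t'" "length t' = k" "m = next_msg \<pi> \<omega> t'"
        using *(1) True by (auto simp: path_snoc)
      then have "t' = t0" using unique[of t' Continue] by auto
      then show ?thesis using t \<open>m = next_msg \<pi> \<omega> t'\<close> by simp
    qed
    then show ?thesis using run p going by (cases s) (auto split: if_splits)
  qed
qed

lemma path_take: "path \<pi> \<omega> t \<Longrightarrow> path \<pi> \<omega> (take i t)"
  by (auto simp: path_def min_def)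

lemma path_take_not_ended: "path \<pi> \<omega> t \<Longrightarrow> i < length t \<Longrightarrow> \<not> ended \<pi> True \<omega> (take i t)"
  using path_take[of \<pi> \<omega> t "Suc i"] by (simp add: take_Suc_conv_app_nth path_snoc)

lemma path_pending:
  assumes "path \<pi> \<omega> t" "i < length t" shows "take i t \<in> pending \<pi> \<omega>"
  using path_take[OF assms(1), of i] path_take_not_ended[OF assms] assms(2)
  unfolding pending_def by (auto simp: run_eq_iff)

lemma run_fst_take:
  assumes "path \<pi> \<omega> t" "ended \<pi> True \<omega> t"
  shows "fst (run \<pi> \<omega> k) = take k t"
proof (cases "k < length t")
  case True
  then have "run \<pi> \<omega> k = (take k t, Continue)"
    using path_take[OF assms(1)] path_take_not_ended[OF assms(1)] by (simp add: run_eq_iff)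
  then show ?thesis by simp
next
  case False
  then have "run \<pi> \<omega> k = (t, Stop)" using assms by (simp add: run_eq_iff)
  then show ?thesis using False by simp
qed

lemma path_ended_unique:
  assumes "path \<pi> \<omega> t" "ended \<pi> True \<omega> t" "path \<pi> \<omega> t'" "ended \<pi> True \<omega> t'"
  shows "t = t'"
proof -
  have "run \<pi> \<omega> (max (length t) (length t')) = (t, Stop)" "run \<pi> \<omega> (max (length t) (length t')) = (t', Stop)"
    using assms by (auto simp: run_eq_iff)
  then show ?thesis by simp
qed

lemma transcript_eqI:
  assumes "path \<pi> \<omega> t" "ended \<pi> True \<omega> t"
  shows "transcript \<pi> \<omega> = t"
proof -
  have "run \<pi> \<omega> (length t) = (t, Stop)" using assms by (simp add: run_eq_iff)
  then have ex: "\<exists>k. snd (run \<pi> \<omega> k) = Stop" by (metis snd_conv)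
  let ?k = "LEAST k. snd (run \<pi> \<omega> k) = Stop"
  have "snd (run \<pi> \<omega> ?k) = Stop" using LeastI_ex[OF ex] .
  then have "run \<pi> \<omega> ?k = (fst (run \<pi> \<omega> ?k), Stop)" by (metis prod.collapse)
  then have "path \<pi> \<omega> (fst (run \<pi> \<omega> ?k))" "ended \<pi> True \<omega> (fst (run \<pi> \<omega> ?k))"
    unfolding run_eq_iff by auto
  then have "fst (run \<pi> \<omega> ?k) = t" using path_ended_unique assms by blast
  then show ?thesis using ex by (simp add: transcript_def)
qed

lemma transcript_path:
  assumes "\<exists>k. snd (run \<pi> \<omega> k) = Stop"
  shows "path \<pi> \<omega> (transcript \<pi> \<omega>) \<and> ended \<pi> True \<omega> (transcript \<pi> \<omega>)"
proof -
  obtain k where "snd (run \<pi> \<omega> k) = Stop" using assms by blast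
  then have "run \<pi> \<omega> k = (fst (run \<pi> \<omega> k), Stop)" by (metis prod.collapse)
  then have "path \<pi> \<omega> (fst (run \<pi> \<omega> k)) \<and> ended \<pi> True \<omega> (fst (run \<pi> \<omega> k))"
    unfolding run_eq_iff by auto
  then show ?thesis using transcript_eqI by metis
qed

lemma run_fst_transcript:
  assumes "\<exists>k. snd (run \<pi> \<omega> k) = Stop"
  shows "fst (run \<pi> \<omega> k) = take k (transcript \<pi> \<omega>)"
  using run_fst_take transcript_path[OF assms] by blast

lemma agree_path:
  assumes "agree \<pi> \<omega>" "path \<pi> \<omega> t"
  shows "follows \<pi> p \<omega> t" "t \<noteq> [] \<Longrightarrow> ended \<pi> p \<omega> t = ended \<pi> True \<omega> t"
proof -
  have *: "book_of \<pi> p \<omega> (take i t) = book_of \<pi> True \<omega> (take i t)" if "i < length t" for i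
    using assms(1) path_pending[OF assms(2) that] unfolding agree_def by (cases p) auto
  then show "follows \<pi> p \<omega> t"
    using assms(2) by (auto simp: path_def follows_def)
  show "ended \<pi> p \<omega> t = ended \<pi> True \<omega> t" if "t \<noteq> []"
    using *[of "length t - 1"] that by (simp add: ended_def butlast_conv_take)
qed

lemma follows_snoc:
  "follows \<pi> p \<omega> (t @ [m]) \<longleftrightarrow> follows \<pi> p \<omega> t \<and> \<not> ended \<pi> p \<omega> t \<and>
     ((even (length t) \<longleftrightarrow> p) \<longrightarrow> next_msg \<pi> \<omega> t = m)"
proof (cases t rule: rev_cases)
  case Nil
  then show ?thesis by (simp add: follows_def ended_def)
next
  case (snoc t' m')
  have "follows \<pi> p \<omega> (t @ [m]) \<longleftrightarrow>
      (\<forall>i<length t. (even i \<longleftrightarrow> p) \<longrightarrow> next_msg \<pi> \<omega> (take i t) = t ! i) \<and>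
      ((even (length t) \<longleftrightarrow> p) \<longrightarrow> next_msg \<pi> \<omega> t = m) \<and>
     (\<forall>i<length t. book_of \<pi> p \<omega> (take i t) (t ! i) = Some Continue)"
    by (simp add: follows_def All_less_Suc nth_append conj_ac)
  moreover have "(\<forall>i<length t. book_of \<pi> p \<omega> (take i t) (t ! i) = Some Continue) \<longleftrightarrow>
     (\<forall>i. Suc i<length t \<longrightarrow> book_of \<pi> p \<omega> (take i t) (t ! i) = Some Continue) \<and> \<not> ended \<pi> p \<omega> t"
    by (auto simp: snoc ended_def less_Suc_eq nth_append) (metis Suc_lessI)
  ultimately show ?thesis by (auto simp: follows_def)
qed

lemma follows_path:
  assumes "agree \<pi> \<omega>" "follows \<pi> True \<omega> t" "follows \<pi> False \<omega> t"
  shows "path \<pi> \<omega> t"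
  using assms by (auto simp: path_def follows_def)

lemma path_iff_follows:
  assumes "agree \<pi> \<omega>"
  shows "path \<pi> \<omega> t \<longleftrightarrow> follows \<pi> p \<omega> t \<and> follows \<pi> (\<not> p) \<omega> t"
  using follows_path[OF assms] agree_path(1)[OF assms] by (cases p) auto

text \<open>One party's share of the event that \<open>t\<close> is the history after
  \<open>k\<close> rounds. A history shorter than \<open>k\<close> must be a stopped one.\<close>

definition reaches :: "('x, 'y, 'u, 'a, 'b) protocol \<Rightarrow> bool \<Rightarrow> nat \<Rightarrow> ('x \<times> 'y) \<times> 'u \<times> 'a \<times> 'b \<Rightarrow> bits list \<Rightarrow> bool" where
  "reaches \<pi> p k \<omega> t \<longleftrightarrow> length t \<le> k \<and> follows \<pi> p \<omega> t \<and> (length t < k \<longrightarrow> ended \<pi> p \<omega> t)"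

lemma run_eq_history_iff:
  "fst (run \<pi> \<omega> k) = t \<longleftrightarrow> path \<pi> \<omega> t \<and> length t \<le> k \<and> (length t < k \<longrightarrow> ended \<pi> True \<omega> t)"
proof -
  obtain t0 s0 where r: "run \<pi> \<omega> k = (t0, s0)" by fastforce
  then have "path \<pi> \<omega> t0" "length t0 \<le> k" "length t0 < k \<longrightarrow> ended \<pi> True \<omega> t0"
    by (auto simp: run_eq_iff split: if_splits)
  moreover have "run \<pi> \<omega> k = (t, if ended \<pi> True \<omega> t then Stop else Continue)"
    if "path \<pi> \<omega> t \<and> length t \<le> k \<and> (length t < k \<longrightarrow> ended \<pi> True \<omega> t)"
    using that by (auto simp: run_eq_iff)
  ultimately show ?thesis using r by (cases "fst (run \<pi> \<omega> k) = t") auto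
qed

text \<open>The codebooks agree along a path, so the termination condition can be charged to either
  party; the other one only has to follow.\<close>

lemma run_eq_reaches:
  assumes "agree \<pi> \<omega>"
  shows "fst (run \<pi> \<omega> k) = t \<longleftrightarrow> reaches \<pi> p k \<omega> t \<and> follows \<pi> (\<not> p) \<omega> t"
  using agree_path[OF assms, of t p] path_iff_follows[OF assms, of t p]
  unfolding run_eq_history_iff reaches_def by (cases "t = []") (auto simp: ended_def)

text \<open>
  The condition on the party that does not send in round \<open>k + 1\<close> is the same after round \<open>k\<close> and
  after round \<open>k + 1\<close>: this is the Markov property of interactive protocols.
\<close>

lemma run_Suc_eq_reaches:
  assumes ag: "agree \<pi> \<omega>" and p: "even k \<longleftrightarrow> p"
  shows "fst (run \<pi> \<omega> (Suc k)) = t \<longleftrightarrow> reaches \<pi> p (Suc k) \<omega> t \<and> follows \<pi> (\<not> p) \<omega> (take k t)"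
proof (cases "length t = Suc k")
  case False
  then show ?thesis using run_eq_reaches[OF ag, of "Suc k" t p] by (auto simp: reaches_def)
next
  case True
  then obtain t' m where t: "t = t' @ [m]" by (metis length_Suc_conv_rev)
  have len: "length t' = k" using True t by simp
  have tk: "take k t = t'" using t len by simp
  \<comment> \<open>The last message is sent by party \<open>p\<close>. The other party constrains
    neither its content nor, because the codebooks agree, the fact that a message is due.\<close>
  have "path \<pi> \<omega> t \<longleftrightarrow> follows \<pi> p \<omega> t \<and> follows \<pi> (\<not> p) \<omega> t'"
  proof
    assume "path \<pi> \<omega> t"
    then show "follows \<pi> p \<omega> t \<and> follows \<pi> (\<not> p) \<omega> t'"
      using agree_path(1)[OF ag] by (auto simp: t path_snoc)
  next
    assume *: "follows \<pi> p \<omega> t \<and> follows \<pi> (\<not> p) \<omega> t'"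
    then have pt: "path \<pi> \<omega> t'" "\<not> ended \<pi> p \<omega> t'" "next_msg \<pi> \<omega> t' = m"
      using path_iff_follows[OF ag, of t' p] p len by (auto simp: t follows_snoc)
    then show "path \<pi> \<omega> t"
      using agree_path(2)[OF ag pt(1), of p] unfolding t path_snoc by (cases "t' = []") (auto simp: ended_def)
  qed
  then show ?thesis using True unfolding run_eq_history_iff reaches_def tk by auto
qed

section \<open>Probabilities of reached histories\<close>

text \<open>On a countable type the points of mass zero form a null set, which is what distinguishes
  a pmf. All laws of transcripts and outputs are handled as pmfs through this lemma.\<close>

lemma distr_countable_pmf:
  fixes X :: "'a \<Rightarrow> 'b :: countable"
  assumes "prob_space M" "X \<in> M \<rightarrow>\<^sub>M count_space UNIV"
  obtains p where "distr M (count_space UNIV) X = measure_pmf p"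
proof -
  interpret D: prob_space "distr M (count_space UNIV) X"
    using assms by (rule prob_space.prob_space_distr)
  have "AE x in distr M (count_space UNIV) X. measure (distr M (count_space UNIV) X) {x} \<noteq> 0"
  proof (rule AE_I')
    let ?D = "distr M (count_space UNIV) X"
    let ?N = "\<Union>x\<in>{x. measure ?D {x} = 0}. {x}"
    show "?N \<in> null_sets ?D"
      by (rule null_sets_UN') (auto simp: null_sets_def D.emeasure_eq_measure)
    show "{x\<in>space ?D. \<not> measure ?D {x} \<noteq> 0} \<subseteq> ?N" by auto
  qed
  then have "distr M (count_space UNIV) X \<in> {M. prob_space M \<and> sets M = UNIV \<and> (AE x in M. measure M {x} \<noteq> 0)}"
    using D.prob_space_axioms by simp
  from Abs_pmf_inverse[OF this] show ?thesis by (rule that[OF sym])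
qed

lemma follows_cong:
  "follows \<pi> True ((x, y), u, a, b) t = follows \<pi> True ((x, y'), u, a, b') t"
  "follows \<pi> False ((x, y), u, a, b) t = follows \<pi> False ((x', y), u, a', b) t"
  by (auto simp: follows_def next_msg_def book_of_def)

lemma ended_cong:
  "ended \<pi> True ((x, y), u, a, b) t = ended \<pi> True ((x, y'), u, a, b') t"
  "ended \<pi> False ((x, y), u, a, b) t = ended \<pi> False ((x', y), u, a', b) t"
  by (auto simp: ended_def book_of_def)

text \<open>Inputs are countable rather than finite because the simulating protocol receives lists
  of inputs.\<close>

locale protocol_space =
  fixes P :: "('x::countable \<times> 'y::countable) pmf" and \<pi> :: "('x, 'y, 'u, 'a, 'b) protocol"
  assumes is_protocol: "is_protocol P \<pi>"
begin

abbreviation "\<Omega> \<equiv> sample_space P \<pi>"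

sublocale pub: prob_space "pub \<pi>" using is_protocol by (simp add: is_protocol_def)
sublocale coin1: prob_space "coin1 \<pi>" using is_protocol by (simp add: is_protocol_def)
sublocale coin2: prob_space "coin2 \<pi>" using is_protocol by (simp add: is_protocol_def)
sublocale coins: pair_prob_space "coin1 \<pi>" "coin2 \<pi>" ..
sublocale rand: pair_prob_space "pub \<pi>" "coin1 \<pi> \<Otimes>\<^sub>M coin2 \<pi>" ..
sublocale pair_prob_space "measure_pmf P" "pub \<pi> \<Otimes>\<^sub>M (coin1 \<pi> \<Otimes>\<^sub>M coin2 \<pi>)" ..
sublocale sample: prob_space \<Omega>
  unfolding sample_space_def by (rule P.prob_space_axioms)

lemma
  shows msg1_measurable: "(\<lambda>(u, a). msg1 \<pi> x u a t) \<in> pub \<pi> \<Otimes>\<^sub>M coin1 \<pi> \<rightarrow>\<^sub>M count_space UNIV"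
    and msg2_measurable: "(\<lambda>(u, b). msg2 \<pi> y u b t) \<in> pub \<pi> \<Otimes>\<^sub>M coin2 \<pi> \<rightarrow>\<^sub>M count_space UNIV"
    and book1_measurable: "(\<lambda>(u, a). book1 \<pi> x u a t m) \<in> pub \<pi> \<Otimes>\<^sub>M coin1 \<pi> \<rightarrow>\<^sub>M count_space UNIV"
    and book2_measurable: "(\<lambda>(u, b). book2 \<pi> y u b t m) \<in> pub \<pi> \<Otimes>\<^sub>M coin2 \<pi> \<rightarrow>\<^sub>M count_space UNIV"
  using is_protocol by (simp_all add: is_protocol_def)

lemma fst_measurable: "fst \<in> \<Omega> \<rightarrow>\<^sub>M count_space UNIV"
  unfolding sample_space_def by (rule measurable_compose[OF measurable_fst]) simp

lemma view1_measurable: "(\<lambda>\<omega>. (fst (snd \<omega>), fst (snd (snd \<omega>)))) \<in> \<Omega> \<rightarrow>\<^sub>M pub \<pi> \<Otimes>\<^sub>M coin1 \<pi>"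
  and view2_measurable: "(\<lambda>\<omega>. (fst (snd \<omega>), snd (snd (snd \<omega>)))) \<in> \<Omega> \<rightarrow>\<^sub>M pub \<pi> \<Otimes>\<^sub>M coin2 \<pi>"
  unfolding sample_space_def by measurable

text \<open>Measurability is granted only for each fixed input; as the inputs are countable, the
  pieces can be glued together.\<close>

lemma measurable_view1:
  assumes "\<And>x. (\<lambda>(u, a). f x u a) \<in> pub \<pi> \<Otimes>\<^sub>M coin1 \<pi> \<rightarrow>\<^sub>M count_space UNIV"
  shows "(\<lambda>\<omega>. f (fst (fst \<omega>)) (fst (snd \<omega>)) (fst (snd (snd \<omega>)))) \<in> \<Omega> \<rightarrow>\<^sub>M count_space UNIV"
proof (rule measurable_compose_countable[where g = "\<lambda>\<omega>. fst (fst \<omega>)"])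
  show "(\<lambda>\<omega>. fst (fst \<omega>)) \<in> \<Omega> \<rightarrow>\<^sub>M count_space UNIV"
    by (rule measurable_compose[OF fst_measurable]) simp
  show "(\<lambda>\<omega>. f x (fst (snd \<omega>)) (fst (snd (snd \<omega>)))) \<in> \<Omega> \<rightarrow>\<^sub>M count_space UNIV" for x
    using measurable_compose[OF view1_measurable assms[of x]] by simp
qed

lemma measurable_view2:
  assumes "\<And>y. (\<lambda>(u, b). f y u b) \<in> pub \<pi> \<Otimes>\<^sub>M coin2 \<pi> \<rightarrow>\<^sub>M count_space UNIV"
  shows "(\<lambda>\<omega>. f (snd (fst \<omega>)) (fst (snd \<omega>)) (snd (snd (snd \<omega>)))) \<in> \<Omega> \<rightarrow>\<^sub>M count_space UNIV"
proof (rule measurable_compose_countable[where g = "\<lambda>\<omega>. snd (fst \<omega>)"])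
  show "(\<lambda>\<omega>. snd (fst \<omega>)) \<in> \<Omega> \<rightarrow>\<^sub>M count_space UNIV"
    by (rule measurable_compose[OF fst_measurable]) simp
  show "(\<lambda>\<omega>. f y (fst (snd \<omega>)) (snd (snd (snd \<omega>)))) \<in> \<Omega> \<rightarrow>\<^sub>M count_space UNIV" for y
    using measurable_compose[OF view2_measurable assms[of y]] by simp
qed

lemma next_msg_measurable: "(\<lambda>\<omega>. next_msg \<pi> \<omega> t) \<in> \<Omega> \<rightarrow>\<^sub>M count_space UNIV"
  using measurable_view1[of "\<lambda>x u a. msg1 \<pi> x u a t", OF msg1_measurable]
    measurable_view2[of "\<lambda>x u a. msg2 \<pi> x u a t", OF msg2_measurable]
  by (cases "even (length t)") (simp_all add: next_msg_def case_prod_beta)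

lemma book_of_measurable: "(\<lambda>\<omega>. book_of \<pi> p \<omega> t m) \<in> \<Omega> \<rightarrow>\<^sub>M count_space UNIV"
  using measurable_view1[of "\<lambda>x u a. book1 \<pi> x u a t m", OF book1_measurable]
    measurable_view2[of "\<lambda>x u a. book2 \<pi> x u a t m", OF book2_measurable]
  by (cases p) (simp_all add: book_of_def case_prod_beta)

lemma pred_eq_const:
  assumes "f \<in> M \<rightarrow>\<^sub>M count_space UNIV"
  shows "Measurable.pred M (\<lambda>x. f x = c)"
  using measurable_compose[OF assms, of "\<lambda>z. z = c"] by simp

lemma path_pred: "Measurable.pred \<Omega> (\<lambda>\<omega>. path \<pi> \<omega> t)"
  unfolding path_def
  by (intro pred_intros_logic pred_intros_countable pred_eq_const next_msg_measurable book_of_measurable) simp_all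

lemma ended_pred: "Measurable.pred \<Omega> (\<lambda>\<omega>. ended \<pi> p \<omega> t)"
  unfolding ended_def
  by (intro pred_intros_logic pred_intros_countable pred_eq_const next_msg_measurable book_of_measurable) simp_all

lemma follows_True_view: "Measurable.pred (pub \<pi> \<Otimes>\<^sub>M coin1 \<pi>) (\<lambda>(u, a). follows \<pi> True ((x, y), u, a, b) t)"
proof -
  have "(\<lambda>(u, a). follows \<pi> True ((x, y), u, a, b) t) =
    (\<lambda>z. (\<forall>i<length t. even i \<longrightarrow> msg1 \<pi> x (fst z) (snd z) (take i t) = t ! i) \<and>
     (\<forall>i. Suc i < length t \<longrightarrow> book1 \<pi> x (fst z) (snd z) (take i t) (t ! i) = Some Continue))"
    by (auto simp: follows_def next_msg_def book_of_def fun_eq_iff)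
  then show ?thesis
    by (simp only:, intro pred_intros_logic pred_intros_countable pred_eq_const
      msg1_measurable[unfolded case_prod_beta] book1_measurable[unfolded case_prod_beta]) simp_all
qed

lemma follows_False_view: "Measurable.pred (pub \<pi> \<Otimes>\<^sub>M coin2 \<pi>) (\<lambda>(u, b). follows \<pi> False ((x, y), u, a, b) t)"
proof -
  have "(\<lambda>(u, b). follows \<pi> False ((x, y), u, a, b) t) =
    (\<lambda>z. (\<forall>i<length t. odd i \<longrightarrow> msg2 \<pi> y (fst z) (snd z) (take i t) = t ! i) \<and>
     (\<forall>i. Suc i < length t \<longrightarrow> book2 \<pi> y (fst z) (snd z) (take i t) (t ! i) = Some Continue))"
    by (auto simp: follows_def next_msg_def book_of_def fun_eq_iff)
  then show ?thesis
    by (simp only:, intro pred_intros_logic pred_intros_countable pred_eq_const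
      msg2_measurable[unfolded case_prod_beta] book2_measurable[unfolded case_prod_beta]) simp_all
qed

lemma ended_True_view: "Measurable.pred (pub \<pi> \<Otimes>\<^sub>M coin1 \<pi>) (\<lambda>(u, a). ended \<pi> True ((x, y), u, a, b) t)"
proof -
  have "(\<lambda>(u, a). ended \<pi> True ((x, y), u, a, b) t) =
    (\<lambda>z. t \<noteq> [] \<and> \<not> (book1 \<pi> x (fst z) (snd z) (butlast t) (last t) = Some Continue))"
    by (auto simp: ended_def book_of_def fun_eq_iff)
  then show ?thesis
    by (simp only:, intro pred_intros_logic pred_eq_const book1_measurable[unfolded case_prod_beta]) simp_all
qed

lemma ended_False_view: "Measurable.pred (pub \<pi> \<Otimes>\<^sub>M coin2 \<pi>) (\<lambda>(u, b). ended \<pi> False ((x, y), u, a, b) t)"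
proof -
  have "(\<lambda>(u, b). ended \<pi> False ((x, y), u, a, b) t) =
    (\<lambda>z. t \<noteq> [] \<and> \<not> (book2 \<pi> y (fst z) (snd z) (butlast t) (last t) = Some Continue))"
    by (auto simp: ended_def book_of_def fun_eq_iff)
  then show ?thesis
    by (simp only:, intro pred_intros_logic pred_eq_const book2_measurable[unfolded case_prod_beta]) simp_all
qed

lemma run_fst_measurable: "(\<lambda>\<omega>. fst (run \<pi> \<omega> k)) \<in> \<Omega> \<rightarrow>\<^sub>M count_space UNIV"
proof (rule measurable_count_space_eq2_countable[THEN iffD2], intro conjI ballI funcsetI)
  fix t
  have "(\<lambda>\<omega>. fst (run \<pi> \<omega> k)) -` {t} \<inter> space \<Omega> = {\<omega>\<in>space \<Omega>. path \<pi> \<omega> t \<and> length t \<le> k \<and> (length t < k \<longrightarrow> ended \<pi> True \<omega> t)}"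
    using run_eq_history_iff by blast
  also have "\<dots> \<in> sets \<Omega>"
    by (intro predE pred_intros_logic path_pred ended_pred) simp_all
  finally show "(\<lambda>\<omega>. fst (run \<pi> \<omega> k)) -` {t} \<inter> space \<Omega> \<in> sets \<Omega>" .
qed auto

lemma transcript_eq_iff:
  "transcript \<pi> \<omega> = t \<longleftrightarrow> path \<pi> \<omega> t \<and> ended \<pi> True \<omega> t \<or> t = [] \<and> (\<forall>t'. \<not> (path \<pi> \<omega> t' \<and> ended \<pi> True \<omega> t'))"
proof (cases "\<exists>k. snd (run \<pi> \<omega> k) = Stop")
  case True
  then show ?thesis using transcript_path transcript_eqI by metis
next
  case False
  then have "\<not> (path \<pi> \<omega> t' \<and> ended \<pi> True \<omega> t')" for t'
    using run_eq_iff[of \<pi> \<omega> "length t'" t' Stop] by (metis order_refl snd_conv)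
  moreover have "transcript \<pi> \<omega> = []" using False by (simp add: transcript_def)
  ultimately show ?thesis by auto
qed

lemma transcript_measurable: "transcript \<pi> \<in> \<Omega> \<rightarrow>\<^sub>M count_space UNIV"
proof (rule measurable_count_space_eq2_countable[THEN iffD2], intro conjI ballI funcsetI)
  fix t
  have "transcript \<pi> -` {t} \<inter> space \<Omega> = {\<omega>\<in>space \<Omega>. path \<pi> \<omega> t \<and> ended \<pi> True \<omega> t \<or> t = [] \<and> (\<forall>t'. \<not> (path \<pi> \<omega> t' \<and> ended \<pi> True \<omega> t'))}"
    using transcript_eq_iff by blast
  also have "\<dots> \<in> sets \<Omega>"
    by (intro predE pred_intros_logic pred_intros_countable path_pred ended_pred) simp_all
  finally show "transcript \<pi> -` {t} \<inter> space \<Omega> \<in> sets \<Omega>" .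
qed auto

lemma AE_agree: "AE \<omega> in \<Omega>. agree \<pi> \<omega>"
  using is_protocol unfolding is_protocol_def agree_def book_of_def by (simp add: case_prod_beta)

lemma AE_stop: "AE \<omega> in \<Omega>. \<exists>k. snd (run \<pi> \<omega> k) = Stop"
  and AE_dom: "AE \<omega> in \<Omega>. \<forall>t\<in>pending \<pi> \<omega>. next_msg \<pi> \<omega> t \<in> dom (next_book \<pi> \<omega> t)"
  using is_protocol unfolding is_protocol_def by blast+

text \<open>Given \<open>u\<close> the two private coins are independent, so the section of the
  event at \<open>u\<close> is a product set; Tonelli's theorem does the rest.\<close>

lemma prob_rectangle:
  assumes A: "Measurable.pred (pub \<pi> \<Otimes>\<^sub>M coin1 \<pi>) (\<lambda>(u, a). A u a)"
    and B: "Measurable.pred (pub \<pi> \<Otimes>\<^sub>M coin2 \<pi>) (\<lambda>(u, b). B u b)"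
  shows "measure \<Omega> {\<omega>\<in>space \<Omega>. fst \<omega> = (x, y) \<and> A (fst (snd \<omega>)) (fst (snd (snd \<omega>))) \<and> B (fst (snd \<omega>)) (snd (snd (snd \<omega>)))} =
      pmf P (x, y) * (\<integral>u. measure (coin1 \<pi>) {a\<in>space (coin1 \<pi>). A u a} * measure (coin2 \<pi>) {b\<in>space (coin2 \<pi>). B u b} \<partial>pub \<pi>)"
    (is "measure \<Omega> ?S = _ * (\<integral>u. ?\<alpha> u * ?\<beta> u \<partial>_)")
    and "(\<lambda>u. measure (coin1 \<pi>) {a\<in>space (coin1 \<pi>). A u a}) \<in> borel_measurable (pub \<pi>)"
    and "(\<lambda>u. measure (coin2 \<pi>) {b\<in>space (coin2 \<pi>). B u b}) \<in> borel_measurable (pub \<pi>)"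
proof -
  let ?N = "pub \<pi> \<Otimes>\<^sub>M (coin1 \<pi> \<Otimes>\<^sub>M coin2 \<pi>)"
  let ?E = "{z\<in>space ?N. A (fst z) (fst (snd z)) \<and> B (fst z) (snd (snd z))}"
  have A': "{z \<in> space (pub \<pi> \<Otimes>\<^sub>M coin1 \<pi>). A (fst z) (snd z)} \<in> sets (pub \<pi> \<Otimes>\<^sub>M coin1 \<pi>)"
    using A by (simp add: pred_def case_prod_beta)
  have B': "{z \<in> space (pub \<pi> \<Otimes>\<^sub>M coin2 \<pi>). B (fst z) (snd z)} \<in> sets (pub \<pi> \<Otimes>\<^sub>M coin2 \<pi>)"
    using B by (simp add: pred_def case_prod_beta)
  have sA: "{a\<in>space (coin1 \<pi>). A u a} \<in> sets (coin1 \<pi>)"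
    and eA: "Pair u -` {z \<in> space (pub \<pi> \<Otimes>\<^sub>M coin1 \<pi>). A (fst z) (snd z)} = {a\<in>space (coin1 \<pi>). A u a}"
    if "u \<in> space (pub \<pi>)" for u
  proof -
    show "Pair u -` {z \<in> space (pub \<pi> \<Otimes>\<^sub>M coin1 \<pi>). A (fst z) (snd z)} = {a\<in>space (coin1 \<pi>). A u a}"
      using that by (auto simp: space_pair_measure)
    then show "{a\<in>space (coin1 \<pi>). A u a} \<in> sets (coin1 \<pi>)"
      using sets_Pair1[OF A', of u] by simp
  qed
  have sB: "{b\<in>space (coin2 \<pi>). B u b} \<in> sets (coin2 \<pi>)"
    and eB: "Pair u -` {z \<in> space (pub \<pi> \<Otimes>\<^sub>M coin2 \<pi>). B (fst z) (snd z)} = {b\<in>space (coin2 \<pi>). B u b}"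
    if "u \<in> space (pub \<pi>)" for u
  proof -
    show "Pair u -` {z \<in> space (pub \<pi> \<Otimes>\<^sub>M coin2 \<pi>). B (fst z) (snd z)} = {b\<in>space (coin2 \<pi>). B u b}"
      using that by (auto simp: space_pair_measure)
    then show "{b\<in>space (coin2 \<pi>). B u b} \<in> sets (coin2 \<pi>)"
      using sets_Pair1[OF B', of u] by simp
  qed
  have "(\<lambda>u. enn2real (emeasure (coin1 \<pi>) (Pair u -` {z \<in> space (pub \<pi> \<Otimes>\<^sub>M coin1 \<pi>). A (fst z) (snd z)}))) \<in> borel_measurable (pub \<pi>)"
    by (intro borel_measurable_enn2real coin1.measurable_emeasure_Pair A')
  then show ma: "?\<alpha> \<in> borel_measurable (pub \<pi>)"
    by (rule measurable_cong[THEN iffD1, rotated]) (simp only: eA measure_def)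
  have "(\<lambda>u. enn2real (emeasure (coin2 \<pi>) (Pair u -` {z \<in> space (pub \<pi> \<Otimes>\<^sub>M coin2 \<pi>). B (fst z) (snd z)}))) \<in> borel_measurable (pub \<pi>)"
    by (intro borel_measurable_enn2real coin2.measurable_emeasure_Pair B')
  then show mb: "?\<beta> \<in> borel_measurable (pub \<pi>)"
    by (rule measurable_cong[THEN iffD1, rotated]) (simp only: eB measure_def)
  have "(\<lambda>z. (fst z, fst (snd z))) \<in> ?N \<rightarrow>\<^sub>M pub \<pi> \<Otimes>\<^sub>M coin1 \<pi>"
      "(\<lambda>z. (fst z, snd (snd z))) \<in> ?N \<rightarrow>\<^sub>M pub \<pi> \<Otimes>\<^sub>M coin2 \<pi>"
    by measurable
  from measurable_compose[OF this(1) A] measurable_compose[OF this(2) B]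
  have E: "?E \<in> sets ?N"
    by (intro predE pred_intros_logic) auto
  have secE: "emeasure (coin1 \<pi> \<Otimes>\<^sub>M coin2 \<pi>) (Pair u -` ?E) = ennreal (?\<alpha> u * ?\<beta> u)"
    if u: "u \<in> space (pub \<pi>)" for u
  proof -
    have "Pair u -` ?E = {a\<in>space (coin1 \<pi>). A u a} \<times> {b\<in>space (coin2 \<pi>). B u b}"
      using u by (auto simp: space_pair_measure)
    then show ?thesis
      using sA[OF u] sB[OF u]
      by (simp add: coin2.emeasure_pair_measure_Times coin1.emeasure_eq_measure coin2.emeasure_eq_measure ennreal_mult'')
  qed
  have "?S = {(x, y)} \<times> ?E"
    by (auto simp: sample_space_def space_pair_measure)
  then have "emeasure \<Omega> ?S = emeasure P {(x, y)} * emeasure ?N ?E"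
    using E by (simp add: sample_space_def rand.emeasure_pair_measure_Times emeasure_pair_measure_Times)
  also have "emeasure ?N ?E = (\<integral>\<^sup>+u. ennreal (?\<alpha> u * ?\<beta> u) \<partial>pub \<pi>)"
    using coins.emeasure_pair_measure_alt[OF E] secE by (simp cong: nn_integral_cong)
  also have "\<dots> = ennreal (\<integral>u. ?\<alpha> u * ?\<beta> u \<partial>pub \<pi>)"
    by (intro nn_integral_eq_integral pub.integrable_const_bound[where B=1])
       (use ma mb in \<open>auto intro!: mult_le_one\<close>)
  finally have "emeasure \<Omega> ?S = ennreal (pmf P (x, y) * (\<integral>u. ?\<alpha> u * ?\<beta> u \<partial>pub \<pi>))"
    by (simp add: emeasure_pmf_single ennreal_mult'')
  then show "measure \<Omega> ?S = pmf P (x, y) * (\<integral>u. ?\<alpha> u * ?\<beta> u \<partial>pub \<pi>)"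
    by (simp add: measure_def integral_nonneg_AE)
qed

lemma prob_cong_rectangle:
  assumes "Measurable.pred \<Omega> Q"
    and A: "Measurable.pred (pub \<pi> \<Otimes>\<^sub>M coin1 \<pi>) (\<lambda>(u, a). A u a)"
    and B: "Measurable.pred (pub \<pi> \<Otimes>\<^sub>M coin2 \<pi>) (\<lambda>(u, b). B u b)"
    and eq: "AE \<omega> in \<Omega>. fst \<omega> = (x, y) \<longrightarrow> Q \<omega> = (A (fst (snd \<omega>)) (fst (snd (snd \<omega>))) \<and> B (fst (snd \<omega>)) (snd (snd (snd \<omega>))))"
  shows "measure \<Omega> {\<omega>\<in>space \<Omega>. Q \<omega> \<and> fst \<omega> = (x, y)} =
      pmf P (x, y) * (\<integral>u. measure (coin1 \<pi>) {a\<in>space (coin1 \<pi>). A u a} * measure (coin2 \<pi>) {b\<in>space (coin2 \<pi>). B u b} \<partial>pub \<pi>)"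
proof -
  note f = pred_eq_const[OF fst_measurable, of "(x, y)"]
  note A' = measurable_compose[OF view1_measurable A, simplified]
  note B' = measurable_compose[OF view2_measurable B, simplified]
  have "measure \<Omega> {\<omega>\<in>space \<Omega>. Q \<omega> \<and> fst \<omega> = (x, y)} =
     measure \<Omega> {\<omega>\<in>space \<Omega>. fst \<omega> = (x, y) \<and> A (fst (snd \<omega>)) (fst (snd (snd \<omega>))) \<and> B (fst (snd \<omega>)) (snd (snd (snd \<omega>)))}"
  proof (rule sample.finite_measure_eq_AE)
    show "AE \<omega> in \<Omega>. (\<omega> \<in> {\<omega>\<in>space \<Omega>. Q \<omega> \<and> fst \<omega> = (x, y)}) = (\<omega> \<in> {\<omega>\<in>space \<Omega>. fst \<omega> = (x, y) \<and> A (fst (snd \<omega>)) (fst (snd (snd \<omega>))) \<and> B (fst (snd \<omega>)) (snd (snd (snd \<omega>)))})"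
      using eq by eventually_elim auto
  qed (use assms(1) f A' B' in \<open>auto intro!: predE pred_intros_logic\<close>)
  then show ?thesis using prob_rectangle(1)[OF A B] by simp
qed

lemma integral_AE_const:
  assumes "AE u in pub \<pi>. u = c" "f \<in> borel_measurable (pub \<pi>)"
  shows "(\<integral>u. f u \<partial>pub \<pi>) = (f c :: real)"
proof -
  have "(\<integral>u. f u \<partial>pub \<pi>) = (\<integral>u. f c \<partial>pub \<pi>)"
    using assms by (intro integral_cong_AE) (auto elim: eventually_mono)
  then show ?thesis by (simp add: pub.prob_space)
qed

lemma reaches_True_view:
  "Measurable.pred (pub \<pi> \<Otimes>\<^sub>M coin1 \<pi>) (\<lambda>(u, a). reaches \<pi> True k ((x, y), u, a, b) t)"
  unfolding reaches_def case_prod_beta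
  by (intro pred_intros_logic follows_True_view[unfolded case_prod_beta] ended_True_view[unfolded case_prod_beta]) simp_all

lemma reaches_False_view:
  "Measurable.pred (pub \<pi> \<Otimes>\<^sub>M coin2 \<pi>) (\<lambda>(u, b). reaches \<pi> False k ((x, y), u, a, b) t)"
  unfolding reaches_def case_prod_beta
  by (intro pred_intros_logic follows_False_view[unfolded case_prod_beta] ended_False_view[unfolded case_prod_beta]) simp_all

definition history_prob :: "nat \<Rightarrow> bits list \<Rightarrow> 'x \<Rightarrow> 'y \<Rightarrow> real" where
  "history_prob k t x y = measure \<Omega> {\<omega>\<in>space \<Omega>. fst (run \<pi> \<omega> k) = t \<and> fst \<omega> = (x, y)}"

lemma history_prob_nonneg: "0 \<le> history_prob k t x y"
  by (simp add: history_prob_def)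

text \<open>Covers the case in \<open>history_prob_markov\<close> in which the denominator of the
  kernel vanishes.\<close>

lemma history_prob_Suc_le: "history_prob (Suc k) t x y \<le> history_prob k (take k t) x y"
  unfolding history_prob_def
proof (rule sample.finite_measure_mono)
  have "fst (run \<pi> \<omega> k) = take k (fst (run \<pi> \<omega> (Suc k)))" for \<omega>
  proof -
    obtain t s where r: "run \<pi> \<omega> k = (t, s)" by fastforce
    then have "length t \<le> k" "s \<noteq> Stop \<Longrightarrow> length t = k" by (auto simp: run_eq_iff split: if_splits)
    then show ?thesis using r by (cases "s = Stop") (auto simp: Let_def)
  qed
  then show "{\<omega> \<in> space \<Omega>. fst (run \<pi> \<omega> (Suc k)) = t \<and> fst \<omega> = (x, y)} \<subseteq> {\<omega> \<in> space \<Omega>. fst (run \<pi> \<omega> k) = take k t \<and> fst \<omega> = (x, y)}"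
    by auto
  show "{\<omega> \<in> space \<Omega>. fst (run \<pi> \<omega> k) = take k t \<and> fst \<omega> = (x, y)} \<in> sets \<Omega>"
    by (intro predE pred_intros_logic pred_eq_const run_fst_measurable fst_measurable)
qed

text \<open>For a constant public coin the integral over \<open>u\<close> disappears, and a history
  has probability \<open>pmf P (x, y)\<close> times one factor for each party. A further message
  changes only the factor of its sender, so the quotient of new and old factor depends on the
  sender's input alone.\<close>

lemma history_prob_markov:
  assumes c: "AE u in pub \<pi>. u = c"
  shows "\<exists>\<kappa>. \<forall>x y t. history_prob (Suc k) t x y = (if even k then \<kappa> (Inl x) t else \<kappa> (Inr y) t) * history_prob k (take k t) x y"
proof -
  note ru = pred_eq_const[OF run_fst_measurable]
  \<comment> \<open>The view of the other party is filled in with \<open>undefined\<close>; by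
    \<open>follows_cong\<close> and \<open>ended_cong\<close> the events do not depend on
    it.\<close>
  define \<alpha> where "\<alpha> j x t = measure (coin1 \<pi>) {a\<in>space (coin1 \<pi>). reaches \<pi> True j ((x, undefined), c, a, undefined) t}" for j x t
  define \<beta> where "\<beta> j y t = measure (coin2 \<pi>) {b\<in>space (coin2 \<pi>). reaches \<pi> False j ((undefined, y), c, undefined, b) t}" for j y t
  define \<alpha>' where "\<alpha>' x t = measure (coin1 \<pi>) {a\<in>space (coin1 \<pi>). follows \<pi> True ((x, undefined), c, a, undefined) t}" for x t
  define \<beta>' where "\<beta>' y t = measure (coin2 \<pi>) {b\<in>space (coin2 \<pi>). follows \<pi> False ((undefined, y), c, undefined, b) t}" for y t
  have T: "measure \<Omega> {\<omega>\<in>space \<Omega>. fst (run \<pi> \<omega> j) = t \<and> fst \<omega> = (x, y)} = pmf P (x, y) * (\<alpha> j x t * \<beta>' y t')"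
    if *: "\<And>\<omega>. agree \<pi> \<omega> \<Longrightarrow> fst (run \<pi> \<omega> j) = t \<longleftrightarrow> reaches \<pi> True j \<omega> t \<and> follows \<pi> False \<omega> t'" for j t t' x y
  proof -
    have "measure \<Omega> {\<omega>\<in>space \<Omega>. fst (run \<pi> \<omega> j) = t \<and> fst \<omega> = (x, y)} = pmf P (x, y) *
       (\<integral>u. measure (coin1 \<pi>) {a\<in>space (coin1 \<pi>). reaches \<pi> True j ((x, undefined), u, a, undefined) t} *
       measure (coin2 \<pi>) {b\<in>space (coin2 \<pi>). follows \<pi> False ((undefined, y), u, undefined, b) t'} \<partial>pub \<pi>)"
    proof (rule prob_cong_rectangle[OF ru reaches_True_view follows_False_view])
      show "AE \<omega> in \<Omega>. fst \<omega> = (x, y) \<longrightarrow> (fst (run \<pi> \<omega> j) = t) = (reaches \<pi> True j ((x, undefined), fst (snd \<omega>), fst (snd (snd \<omega>)), undefined) t \<and> follows \<pi> False ((undefined, y), fst (snd \<omega>), undefined, snd (snd (snd \<omega>))) t')"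
        using AE_agree
      proof eventually_elim
        case (elim \<omega>)
        then show ?case
          using *[OF elim] follows_cong ended_cong(1) unfolding reaches_def by (metis (no_types) prod.collapse)
      qed
    qed
    also have "\<dots> = pmf P (x, y) * (\<alpha> j x t * \<beta>' y t')"
      unfolding \<alpha>_def \<beta>'_def
      by (subst integral_AE_const[OF c]) (auto intro!: borel_measurable_times prob_rectangle(2)[OF reaches_True_view follows_False_view] prob_rectangle(3)[OF reaches_True_view follows_False_view])
    finally show ?thesis .
  qed
  have F: "measure \<Omega> {\<omega>\<in>space \<Omega>. fst (run \<pi> \<omega> j) = t \<and> fst \<omega> = (x, y)} = pmf P (x, y) * (\<alpha>' x t' * \<beta> j y t)"
    if *: "\<And>\<omega>. agree \<pi> \<omega> \<Longrightarrow> fst (run \<pi> \<omega> j) = t \<longleftrightarrow> reaches \<pi> False j \<omega> t \<and> follows \<pi> True \<omega> t'" for j t t' x y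
  proof -
    have "measure \<Omega> {\<omega>\<in>space \<Omega>. fst (run \<pi> \<omega> j) = t \<and> fst \<omega> = (x, y)} = pmf P (x, y) *
       (\<integral>u. measure (coin1 \<pi>) {a\<in>space (coin1 \<pi>). follows \<pi> True ((x, undefined), u, a, undefined) t'} *
       measure (coin2 \<pi>) {b\<in>space (coin2 \<pi>). reaches \<pi> False j ((undefined, y), u, undefined, b) t} \<partial>pub \<pi>)"
    proof (rule prob_cong_rectangle[OF ru follows_True_view reaches_False_view])
      show "AE \<omega> in \<Omega>. fst \<omega> = (x, y) \<longrightarrow> (fst (run \<pi> \<omega> j) = t) = (follows \<pi> True ((x, undefined), fst (snd \<omega>), fst (snd (snd \<omega>)), undefined) t' \<and> reaches \<pi> False j ((undefined, y), fst (snd \<omega>), undefined, snd (snd (snd \<omega>))) t)"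
        using AE_agree
      proof eventually_elim
        case (elim \<omega>)
        then show ?case
          using *[OF elim] follows_cong ended_cong(2) unfolding reaches_def by (metis (no_types) prod.collapse)
      qed
    qed
    also have "\<dots> = pmf P (x, y) * (\<alpha>' x t' * \<beta> j y t)"
      unfolding \<alpha>'_def \<beta>_def
      by (subst integral_AE_const[OF c]) (auto intro!: borel_measurable_times prob_rectangle(2)[OF follows_True_view reaches_False_view] prob_rectangle(3)[OF follows_True_view reaches_False_view])
    finally show ?thesis .
  qed
  \<comment> \<open>Where the denominator is zero, the history has probability zero before and after
    the round, and the value of the kernel is immaterial.\<close>
  define \<kappa> where "\<kappa> z t = (case z of Inl x \<Rightarrow> \<alpha> (Suc k) x t / \<alpha> k x (take k t) | Inr y \<Rightarrow> \<beta> (Suc k) y t / \<beta> k y (take k t))" for z t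
  have "history_prob (Suc k) t x y = (if even k then \<kappa> (Inl x) t else \<kappa> (Inr y) t) * history_prob k (take k t) x y" for x y t
  proof (cases "even k")
    case True
    have 1: "history_prob (Suc k) t x y = pmf P (x, y) * (\<alpha> (Suc k) x t * \<beta>' y (take k t))"
      unfolding history_prob_def by (rule T) (use run_Suc_eq_reaches[of \<pi> _ k True] True in simp)
    have 2: "history_prob k (take k t) x y = pmf P (x, y) * (\<alpha> k x (take k t) * \<beta>' y (take k t))"
      unfolding history_prob_def by (rule T) (use run_eq_reaches[of \<pi> _ k _ True] in simp)
    show ?thesis
    proof (cases "\<alpha> k x (take k t) = 0")
      case True
      then have "history_prob k (take k t) x y = 0" using 2 by simp
      then show ?thesis using history_prob_Suc_le[of k t x y] history_prob_nonneg[of "Suc k" t x y] by simp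
    next
      case False
      then show ?thesis using True 1 2 by (simp add: \<kappa>_def)
    qed
  next
    case odd: False
    have 1: "history_prob (Suc k) t x y = pmf P (x, y) * (\<alpha>' x (take k t) * \<beta> (Suc k) y t)"
      unfolding history_prob_def by (rule F) (use run_Suc_eq_reaches[of \<pi> _ k False] odd in simp)
    have 2: "history_prob k (take k t) x y = pmf P (x, y) * (\<alpha>' x (take k t) * \<beta> k y (take k t))"
      unfolding history_prob_def by (rule F) (use run_eq_reaches[of \<pi> _ k _ False] in simp)
    show ?thesis
    proof (cases "\<beta> k y (take k t) = 0")
      case True
      then have "history_prob k (take k t) x y = 0" using 2 by simp
      then show ?thesis using history_prob_Suc_le[of k t x y] history_prob_nonneg[of "Suc k" t x y] by simp
    next
      case False
      then show ?thesis using odd 1 2 by (simp add: \<kappa>_def)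
    qed
  qed
  then show ?thesis by blast
qed

end

text \<open>The map \<open>\<phi>\<close> cuts a transcript down to a history, so this is the joint
  law of a history and the inputs.\<close>

definition joint_mass :: "('t \<times> 'x \<times> 'y) pmf \<Rightarrow> ('t \<Rightarrow> 't) \<Rightarrow> 't \<Rightarrow> 'x \<Rightarrow> 'y \<Rightarrow> real" where
  "joint_mass L \<phi> t x y = measure L {z. \<phi> (fst z) = t \<and> snd z = (x, y)}"

text \<open>The interface to the protocol to be simulated: apart from the law of \<open>n\<close>
  copies, the sequel uses only these four facts. On terminating executions the history after
  \<open>k\<close> rounds is \<open>take k\<close> of the transcript, which turns
  \<open>history_prob\<close> into \<open>joint_mass\<close>.\<close>

lemma protocol_law:
  fixes P :: "('x::countable \<times> 'y::countable) pmf"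
  assumes "is_protocol P \<pi>" "private_coin \<pi>" "bounded_rounds P \<pi>"
  obtains L d where "joint_law P \<pi> = measure_pmf L" "map_pmf snd L = P"
    and "\<forall>z\<in>set_pmf L. length (fst z) \<le> d"
    and "\<And>k. \<exists>\<kappa>. \<forall>x y t. joint_mass L (take (Suc k)) t x y =
       (if even k then \<kappa> (Inl x) t else \<kappa> (Inr y) t) * joint_mass L (take k) (take k t) x y"
proof -
  interpret protocol_space P \<pi> by unfold_locales (rule assms)
  let ?X = "\<lambda>\<omega>. (transcript \<pi> \<omega>, fst (fst \<omega>), snd (fst \<omega>))"
  have X: "?X \<in> \<Omega> \<rightarrow>\<^sub>M count_space UNIV"
  proof -
    have "(\<lambda>\<omega>. (transcript \<pi> \<omega>, fst \<omega>)) \<in> \<Omega> \<rightarrow>\<^sub>M count_space UNIV \<Otimes>\<^sub>M count_space UNIV"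
      using transcript_measurable fst_measurable by (rule measurable_Pair)
    then show ?thesis by (simp add: pair_measure_countable)
  qed
  obtain L where L: "joint_law P \<pi> = measure_pmf L"
    unfolding joint_law_def by (rule distr_countable_pmf[OF sample.prob_space_axioms X])
  have prob_L: "measure L S = measure \<Omega> {\<omega>\<in>space \<Omega>. ?X \<omega> \<in> S}" for S
    using measure_distr[OF X, of S] unfolding joint_law_def[symmetric] L by (simp add: vimage_def Int_def conj_commute)
  obtain d where d: "AE \<omega> in \<Omega>. snd (run \<pi> \<omega> d) = Stop"
    using assms(3) unfolding bounded_rounds_def by blast
  obtain c where c: "AE u in pub \<pi>. u = c" using assms(2) unfolding private_coin_def by blast
  have h: "joint_mass L (take k) t x y = history_prob k t x y" for k t x y
    unfolding joint_mass_def prob_L history_prob_def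
  proof (rule sample.finite_measure_eq_AE)
    show "AE \<omega> in \<Omega>. (\<omega> \<in> {\<omega> \<in> space \<Omega>. ?X \<omega> \<in> {z. take k (fst z) = t \<and> snd z = (x, y)}}) = (\<omega> \<in> {\<omega> \<in> space \<Omega>. fst (run \<pi> \<omega> k) = t \<and> fst \<omega> = (x, y)})"
      using AE_stop by eventually_elim (auto simp: run_fst_transcript)
    show "{\<omega> \<in> space \<Omega>. fst (run \<pi> \<omega> k) = t \<and> fst \<omega> = (x, y)} \<in> sets \<Omega>"
      by (intro predE pred_intros_logic pred_eq_const run_fst_measurable fst_measurable)
    show "{\<omega> \<in> space \<Omega>. ?X \<omega> \<in> {z. take k (fst z) = t \<and> snd z = (x, y)}} \<in> sets \<Omega>"
      using measurable_sets[OF X, of "{z. take k (fst z) = t \<and> snd z = (x, y)}"] by (simp add: vimage_def Int_def conj_commute)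
  qed
  show ?thesis
  proof
    show "joint_law P \<pi> = measure_pmf L" by (rule L)
    show "map_pmf snd L = P"
    proof (rule pmf_eqI)
      fix z
      have "pmf (map_pmf snd L) z = measure L (snd -` {z})" by (simp add: pmf_map)
      also have "\<dots> = measure \<Omega> ({z} \<times> space (pub \<pi> \<Otimes>\<^sub>M (coin1 \<pi> \<Otimes>\<^sub>M coin2 \<pi>)))"
        unfolding prob_L by (rule arg_cong[where f = "measure \<Omega>"]) (auto simp: sample_space_def space_pair_measure)
      also have "\<dots> = pmf P z"
        unfolding sample_space_def measure_def
        by (subst rand.emeasure_pair_measure_Times) (auto simp: rand.emeasure_space_1 emeasure_pmf_single)
      finally show "pmf (map_pmf snd L) z = pmf P z" .
    qed
    show "\<forall>z\<in>set_pmf L. length (fst z) \<le> d"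
    proof -
      have "AE z in joint_law P \<pi>. length (fst z) \<le> d"
        unfolding joint_law_def
      proof (subst AE_distr_iff[OF X])
        show "AE \<omega> in \<Omega>. length (fst (?X \<omega>)) \<le> d"
          using d
        proof eventually_elim
          case (elim \<omega>)
          then have "run \<pi> \<omega> d = (fst (run \<pi> \<omega> d), Stop)" by (metis prod.collapse)
          then have "path \<pi> \<omega> (fst (run \<pi> \<omega> d))" "ended \<pi> True \<omega> (fst (run \<pi> \<omega> d))" "length (fst (run \<pi> \<omega> d)) \<le> d"
            unfolding run_eq_iff by auto
          then show ?case using transcript_eqI by fastforce
        qed
      qed simp
      then show ?thesis unfolding L by (simp add: AE_measure_pmf_iff)
    qed
    show "\<exists>\<kappa>. \<forall>x y t. joint_mass L (take (Suc k)) t x y =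
       (if even k then \<kappa> (Inl x) t else \<kappa> (Inr y) t) * joint_mass L (take k) (take k t) x y" for k
      unfolding h by (rule history_prob_markov[OF c])
  qed
qed

section \<open>Achievability: decision trees, random darts, and a one-shot bound\<close>

section \<open>Deterministic protocol trees\<close>

text \<open>Simulators are designed as decision trees over single bits, deterministic once the
  public randomness has selected the tree. Rounds, messages and codebooks enter only in
  \<open>tree_protocol\<close>.\<close>

datatype ('x, 'y, 'r) tree =
    is_Ret: Ret (result: 'r)
  | is_Say1: Say1 (query1: "'x \<Rightarrow> bool") (succ: "bool \<Rightarrow> ('x, 'y, 'r) tree")
  | is_Say2: Say2 (query2: "'y \<Rightarrow> bool") (succ: "bool \<Rightarrow> ('x, 'y, 'r) tree")

primrec eval :: "('x, 'y, 'r) tree \<Rightarrow> 'x \<Rightarrow> 'y \<Rightarrow> 'r" where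
  "eval (Ret r) x y = r"
| "eval (Say1 q k) x y = eval (k (q x)) x y"
| "eval (Say2 q k) x y = eval (k (q y)) x y"

primrec cost :: "('x, 'y, 'r) tree \<Rightarrow> 'x \<Rightarrow> 'y \<Rightarrow> nat" where
  "cost (Ret r) x y = 0"
| "cost (Say1 q k) x y = Suc (cost (k (q x)) x y)"
| "cost (Say2 q k) x y = Suc (cost (k (q y)) x y)"

definition step :: "('x, 'y, 'r) tree \<Rightarrow> bool \<Rightarrow> ('x, 'y, 'r) tree" where
  "step T b = (if is_Ret T then T else succ T b)"

definition subtree :: "('x, 'y, 'r) tree \<Rightarrow> bits \<Rightarrow> ('x, 'y, 'r) tree" where
  "subtree T w = foldl step T w"

lemma subtree_simps [simp]: "subtree T [] = T" "subtree T (w @ [b]) = step (subtree T w) b"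
  by (simp_all add: subtree_def)

lemma cost_eq_0_iff: "cost T x y = 0 \<longleftrightarrow> is_Ret T"
  by (cases T) auto

text \<open>Cutting the tree off after \<open>l\<close> bits bounds the length of every execution,
  including those on which the tree is expensive.\<close>

definition live :: "('x, 'y, 'r) tree \<Rightarrow> nat \<Rightarrow> bits \<Rightarrow> bool" where
  "live T l w \<longleftrightarrow> length w < l \<and> \<not> is_Ret (subtree T w)"

definition turn :: "('x, 'y, 'r) tree \<Rightarrow> nat \<Rightarrow> bool \<Rightarrow> bits \<Rightarrow> bool" where
  "turn T l p w \<longleftrightarrow> live T l w \<and> (is_Say1 (subtree T w) \<longleftrightarrow> p)"

text \<open>A message is empty unless the tree asks the sender of the round.\<close>

definition tree_book :: "('x, 'y, 'r) tree \<Rightarrow> nat \<Rightarrow> bits list \<Rightarrow> codebook" where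
  "tree_book T l t = (\<lambda>m. if length m = (if turn T l (even (length t)) (concat t) then 1 else 0)
     then Some (if live T l (concat t @ m) then Continue else Stop) else None)"

text \<open>The index of the tree is stored as a real number and recovered by the floor function,
  because \<open>min_sim_length\<close> ranges over real-valued randomness; the private coins are
  constants. Strict alternation of the senders is met by empty messages, which cost no bits.\<close>

definition tree_protocol ::
    "nat pmf \<Rightarrow> nat \<Rightarrow> (nat \<Rightarrow> ('x, 'y, 'r) tree) \<Rightarrow> ('x, 'y, real, real, real) protocol" where
  "tree_protocol \<mu> l T =
    \<lparr> pub = distr (measure_pmf \<mu>) borel real,
      coin1 = return borel 0, coin2 = return borel 0,
      msg1 = \<lambda>x u a t. if turn (T (nat \<lfloor>u\<rfloor>)) l True (concat t)
         then [query1 (subtree (T (nat \<lfloor>u\<rfloor>)) (concat t)) x] else [],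
      msg2 = \<lambda>y u b t. if turn (T (nat \<lfloor>u\<rfloor>)) l False (concat t)
         then [query2 (subtree (T (nat \<lfloor>u\<rfloor>)) (concat t)) y] else [],
      book1 = \<lambda>x u a t. tree_book (T (nat \<lfloor>u\<rfloor>)) l t,
      book2 = \<lambda>y u b t. tree_book (T (nat \<lfloor>u\<rfloor>)) l t \<rparr>"

context
  fixes \<mu> :: "nat pmf" and l :: nat and T :: "nat \<Rightarrow> ('x, 'y, 'r) tree"
begin

lemma next_msg_tree:
  "next_msg (tree_protocol \<mu> l T) ((x, y), u, a, b) t = (if turn (T (nat \<lfloor>u\<rfloor>)) l (even (length t)) (concat t) then
     [if even (length t) then query1 (subtree (T (nat \<lfloor>u\<rfloor>)) (concat t)) x else query2 (subtree (T (nat \<lfloor>u\<rfloor>)) (concat t)) y] else [])"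
  by (simp add: next_msg_def tree_protocol_def)

lemma next_book_tree: "next_book (tree_protocol \<mu> l T) ((x, y), u, a, b) t = tree_book (T (nat \<lfloor>u\<rfloor>)) l t"
  by (simp add: next_book_def tree_protocol_def)

text \<open>Invariants of a run: the bits sent so far select a subtree with the same value and the
  remaining cost. The last clause bounds the number of rounds, since after an empty message it is
  the turn of the party that the tree asks, and hence two empty messages never follow each other
  while the tree is live.\<close>

lemma run_tree:
  fixes x :: 'x and y :: 'y
  assumes "run (tree_protocol \<mu> l T) ((x, y), u, a, b) k = (t, s)"
  defines "S \<equiv> T (nat \<lfloor>u\<rfloor>)"
  shows "length (concat t) \<le> l \<and> eval (subtree S (concat t)) x y = eval S x y \<and>
     cost (subtree S (concat t)) x y + length (concat t) = cost S x y \<and>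
     (s = Stop \<longrightarrow> \<not> live S l (concat t)) \<and>
     (s = Continue \<longrightarrow> length t = k \<and> (k > 0 \<longrightarrow> live S l (concat t)) \<and>
       (k \<le> 2 * length (concat t) \<or> k \<le> 2 * length (concat t) + 1 \<and> turn S l (even k) (concat t)))"
  using assms(1)
proof (induction k arbitrary: t s)
  case 0
  then show ?case by auto
next
  case (Suc k)
  obtain t0 s0 where r: "run (tree_protocol \<mu> l T) ((x, y), u, a, b) k = (t0, s0)" by fastforce
  note IH = Suc.IH[OF r]
  show ?case
  proof (cases s0)
    case Stop
    then show ?thesis using r Suc.prems IH by auto
  next
    case Continue
    let ?w = "concat t0"
    let ?m = "next_msg (tree_protocol \<mu> l T) ((x, y), u, a, b) t0"
    have len: "length t0 = k" using IH Continue by simp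
    have t: "t = t0 @ [?m]" and s: "s = (if tree_book S l t0 ?m = Some Continue then Continue else Stop)"
      using Suc.prems r Continue by (auto simp: next_book_tree S_def Let_def)
    show ?thesis
    proof (cases "turn S l (even k) ?w")
      case True
      define c where "c = (if even k then query1 (subtree S ?w) x else query2 (subtree S ?w) y)"
      have m: "?m = [c]" using True len by (simp add: next_msg_tree S_def c_def)
      have w: "concat t = ?w @ [c]" using t m by simp
      have nr: "\<not> is_Ret (subtree S ?w)" "length ?w < l" "is_Say1 (subtree S ?w) \<longleftrightarrow> even k"
        using True by (auto simp: turn_def live_def)
      then have "eval (step (subtree S ?w) c) x y = eval (subtree S ?w) x y"
          "Suc (cost (step (subtree S ?w) c) x y) = cost (subtree S ?w) x y"
        by (cases "subtree S ?w"; simp add: step_def c_def)+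
      moreover have "s = (if live S l (concat t) then Continue else Stop)"
        using True m w len by (simp add: s tree_book_def)
      ultimately show ?thesis using IH nr len Continue t unfolding w
        by (auto split: if_splits)
    next
      case False
      have m: "?m = []" using False len by (simp add: next_msg_tree S_def)
      have w: "concat t = ?w" using t m by simp
      have s': "s = (if live S l ?w then Continue else Stop)"
        using False m len by (simp add: s tree_book_def)
      have "live S l ?w \<Longrightarrow> turn S l (even (Suc k)) ?w" using False by (auto simp: turn_def)
      then show ?thesis using IH len Continue False t s' unfolding w by (auto split: if_splits)
    qed
  qed
qed

lemma run_tree_stops: "snd (run (tree_protocol \<mu> l T) ((x, y), u, a, b) (2 * l + 2)) = Stop"
proof (rule ccontr)
  obtain t s where r: "run (tree_protocol \<mu> l T) ((x, y), u, a, b) (2 * l + 2) = (t, s)" by fastforce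
  assume "snd (run (tree_protocol \<mu> l T) ((x, y), u, a, b) (2 * l + 2)) \<noteq> Stop"
  then have "s = Continue" using r by (cases s) auto
  then show False using run_tree[OF r] by auto
qed

lemma transcript_tree:
  assumes "cost (T (nat \<lfloor>u\<rfloor>)) x y \<le> l"
  shows "subtree (T (nat \<lfloor>u\<rfloor>)) (concat (transcript (tree_protocol \<mu> l T) ((x, y), u, a, b))) = Ret (eval (T (nat \<lfloor>u\<rfloor>)) x y)"
proof -
  let ?\<omega> = "((x, y), u, a, b)" and ?S = "T (nat \<lfloor>u\<rfloor>)"
  have "\<exists>k. snd (run (tree_protocol \<mu> l T) ?\<omega> k) = Stop" using run_tree_stops by blast
  from transcript_path[OF this] have "run (tree_protocol \<mu> l T) ?\<omega> (length (transcript (tree_protocol \<mu> l T) ?\<omega>)) = (transcript (tree_protocol \<mu> l T) ?\<omega>, Stop)"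
    by (simp add: run_eq_iff)
  note R = run_tree[OF this]
  have "is_Ret (subtree ?S (concat (transcript (tree_protocol \<mu> l T) ?\<omega>)))"
  proof (rule ccontr)
    assume *: "\<not> ?thesis"
    \<comment> \<open>If the run ended for lack of bits, all \<open>l\<close> bits are spent; as the
      cost is at most \<open>l\<close>, nothing remains to be asked.\<close>
    then have "length (concat (transcript (tree_protocol \<mu> l T) ?\<omega>)) = l" using R by (simp add: live_def)
    then have "cost (subtree ?S (concat (transcript (tree_protocol \<mu> l T) ?\<omega>))) x y = 0" using R assms by linarith
    then show False using * by (simp add: cost_eq_0_iff)
  qed
  then show ?thesis using R by (cases "subtree ?S (concat (transcript (tree_protocol \<mu> l T) ?\<omega>))") auto
qed

lemma floor_measurable: "(\<lambda>(u, a). F (nat \<lfloor>u\<rfloor>)) \<in> pub (tree_protocol \<mu> l T) \<Otimes>\<^sub>M M \<rightarrow>\<^sub>M count_space UNIV" for M :: "'a measure"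
proof -
  have "(\<lambda>u::real. F (nat \<lfloor>u\<rfloor>)) \<in> borel \<rightarrow>\<^sub>M count_space UNIV"
    by (rule measurable_compose[where N = "count_space UNIV" and g = "\<lambda>z. F (nat z)"]) simp_all
  then have m: "(\<lambda>u::real. F (nat \<lfloor>u\<rfloor>)) \<in> pub (tree_protocol \<mu> l T) \<rightarrow>\<^sub>M count_space UNIV"
    by (subst measurable_cong_sets[of _ borel _ "count_space UNIV"]) (simp_all add: tree_protocol_def)
  show ?thesis unfolding case_prod_beta by (rule measurable_compose[OF measurable_fst m])
qed

lemma is_protocol_tree: "is_protocol P (tree_protocol \<mu> l T)"
  unfolding is_protocol_def
proof (intro conjI allI)
  show "prob_space (pub (tree_protocol \<mu> l T))"
    unfolding tree_protocol_def by (simp add: measure_pmf.prob_space_distr)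
  show "prob_space (coin1 (tree_protocol \<mu> l T))" "prob_space (coin2 (tree_protocol \<mu> l T))"
    by (simp_all add: tree_protocol_def prob_space_return)
  show "(\<lambda>(u, a). msg1 (tree_protocol \<mu> l T) x u a t) \<in> pub (tree_protocol \<mu> l T) \<Otimes>\<^sub>M coin1 (tree_protocol \<mu> l T) \<rightarrow>\<^sub>M count_space UNIV" for x t
    using floor_measurable[of "\<lambda>j. if turn (T j) l True (concat t) then [query1 (subtree (T j) (concat t)) x] else []"]
    by (simp add: tree_protocol_def)
  show "(\<lambda>(u, a). msg2 (tree_protocol \<mu> l T) x u a t) \<in> pub (tree_protocol \<mu> l T) \<Otimes>\<^sub>M coin2 (tree_protocol \<mu> l T) \<rightarrow>\<^sub>M count_space UNIV" for x t
    using floor_measurable[of "\<lambda>j. if turn (T j) l False (concat t) then [query2 (subtree (T j) (concat t)) x] else []"]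
    by (simp add: tree_protocol_def)
  show "(\<lambda>(u, a). book1 (tree_protocol \<mu> l T) x u a t m) \<in> pub (tree_protocol \<mu> l T) \<Otimes>\<^sub>M coin1 (tree_protocol \<mu> l T) \<rightarrow>\<^sub>M count_space UNIV" for x t m
    using floor_measurable[of "\<lambda>j. tree_book (T j) l t m"] by (simp add: tree_protocol_def)
  show "(\<lambda>(u, a). book2 (tree_protocol \<mu> l T) x u a t m) \<in> pub (tree_protocol \<mu> l T) \<Otimes>\<^sub>M coin2 (tree_protocol \<mu> l T) \<rightarrow>\<^sub>M count_space UNIV" for x t m
    using floor_measurable[of "\<lambda>j. tree_book (T j) l t m"] by (simp add: tree_protocol_def)
  show "AE ((x, y), u, a, b) in sample_space P (tree_protocol \<mu> l T). \<forall>t \<in> pending (tree_protocol \<mu> l T) ((x, y), u, a, b). book1 (tree_protocol \<mu> l T) x u a t = book2 (tree_protocol \<mu> l T) y u b t"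
    by (rule AE_I2) (simp add: tree_protocol_def split: prod.split)
  show "AE \<omega> in sample_space P (tree_protocol \<mu> l T). \<forall>t \<in> pending (tree_protocol \<mu> l T) \<omega>. next_msg (tree_protocol \<mu> l T) \<omega> t \<in> dom (next_book (tree_protocol \<mu> l T) \<omega> t)"
    by (rule AE_I2) (auto simp: next_msg_tree next_book_tree tree_book_def)
  show "AE \<omega> in sample_space P (tree_protocol \<mu> l T). \<exists>k. snd (run (tree_protocol \<mu> l T) \<omega> k) = Stop"
    by (rule AE_I2) (metis run_tree_stops prod.collapse)
qed

text \<open>All strings of one codebook have the same length, 0 or 1.\<close>

lemma self_delimiting_tree: "self_delimiting P (tree_protocol \<mu> l T)"
  unfolding self_delimiting_def
  by (rule AE_I2) (auto simp: next_book_tree tree_book_def strict_prefix_def prefix_def split: if_splits)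

lemma protocol_length_tree: "protocol_length P (tree_protocol \<mu> l T) \<le> enat l"
  unfolding protocol_length_def
proof (intro SUP_least)
  fix \<omega> :: "('x \<times> 'y) \<times> real \<times> real \<times> real" and k
  obtain x y u a b where \<omega>: "\<omega> = ((x, y), u, a, b)" by (metis prod.collapse)
  obtain t s where r: "run (tree_protocol \<mu> l T) \<omega> k = (t, s)" by fastforce
  show "enat (\<Sum>m\<leftarrow>fst (run (tree_protocol \<mu> l T) \<omega> k). length m) \<le> enat l"
    using run_tree[OF r[unfolded \<omega>]] r by (simp add: length_concat)
qed

end

section \<open>Variation distance\<close>

lemma pmf_has_sum: "(pmf p has_sum measure p A) A"
proof -
  have 1: "Infinite_Set_Sum.abs_summable_on (pmf p) A" by (rule pmf_abs_summable)
  then have "pmf p summable_on A"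
    using abs_summable_equivalent abs_summable_summable by blast
  moreover have "infsum (pmf p) A = measure p A"
    using infsetsum_infsum[OF 1] measure_pmf_conv_infsetsum[of p A] by simp
  ultimately show ?thesis using has_sum_infsum by metis
qed

lemma pmf_has_sum_of_bool: "((\<lambda>z. pmf p z * of_bool (z \<in> S)) has_sum measure p S) UNIV"
  using pmf_has_sum[of p S] by (rule has_sum_cong_neutral[THEN iffD1, rotated -1]) auto

lemma d_var_pmf: "d_var (measure_pmf p) (measure_pmf q) = 1 / 2 * (\<Sum>\<^sub>\<infinity>z. \<bar>pmf p z - pmf q z\<bar>)"
  by (simp add: d_var_def pmf.rep_eq)

lemma abs_diff_pmf_summable: "(\<lambda>z. \<bar>pmf p z - pmf q z\<bar>) summable_on UNIV"
proof (rule summable_on_comparison_test)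
  show "(\<lambda>z. pmf p z + pmf q z) summable_on UNIV"
    using pmf_has_sum by (intro summable_on_add) (auto simp: summable_on_def)
qed (auto simp: abs_le_iff intro: order_trans[OF pmf_nonneg])

text \<open>It is enough that the simulated law dominates \<open>c\<close> times the true one on
  \<open>G\<close>. Failures need no estimate, because both laws have total mass one.\<close>

lemma d_var_pmf_le:
  assumes "\<And>z. z \<in> G \<Longrightarrow> c * pmf p z \<le> pmf q z" "c \<le> 1"
  shows "d_var (measure_pmf p) (measure_pmf q) \<le> 1 - c * measure p G"
proof -
  \<comment> \<open>The distance of two numbers is their sum minus twice their minimum, and on
    \<open>G\<close> the minimum is at least \<open>c * pmf p z\<close> because
    \<open>c \<le> 1\<close>.\<close>
  let ?r = "\<lambda>z. pmf p z + pmf q z + (- 2 * c) * (pmf p z * of_bool (z \<in> G))"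
  have r: "(?r has_sum (1 + 1 + (- 2 * c) * measure p G)) UNIV"
    using pmf_has_sum[of p UNIV] pmf_has_sum[of q UNIV] pmf_has_sum_of_bool[of p G]
    by (intro has_sum_add has_sum_cmult_right) simp_all
  have "\<bar>pmf p z - pmf q z\<bar> \<le> ?r z" for z
  proof (cases "z \<in> G")
    case True
    have "c * pmf p z \<le> pmf p z" using mult_right_mono[OF assms(2), of "pmf p z"] by simp
    then show ?thesis using assms(1)[OF True] True by (simp add: abs_if)
  next
    case False
    then show ?thesis using pmf_nonneg[of p z] pmf_nonneg[of q z] by (simp add: abs_if)
  qed
  then have "(\<Sum>\<^sub>\<infinity>z. \<bar>pmf p z - pmf q z\<bar>) \<le> infsum ?r UNIV"
    using r by (intro infsum_mono abs_diff_pmf_summable) (auto simp: summable_on_def)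
  also have "\<dots> = 1 + 1 + (- 2 * c) * measure p G" using r by (rule infsumI)
  finally show ?thesis by (simp add: d_var_pmf)
qed

text \<open>The signed difference, taken as \<open>p - q\<close> on \<open>S\<close> and
  \<open>q - p\<close> elsewhere, stays below the absolute value, and the total masses
  cancel.\<close>

lemma measure_diff_le_d_var:
  fixes p q :: "'a pmf"
  shows
  "measure p S - measure q S \<le> d_var (measure_pmf p) (measure_pmf q)"
proof -
  let ?r = "\<lambda>z. 2 * (pmf p z * of_bool (z \<in> S)) + (- 2) * (pmf q z * of_bool (z \<in> S)) + ((- 1) * pmf p z + pmf q z)"
  have r: "(?r has_sum (2 * measure p S + (- 2) * measure q S + ((- 1) * 1 + 1))) UNIV"
    using pmf_has_sum[of p UNIV] pmf_has_sum[of q UNIV] pmf_has_sum_of_bool[of p S] pmf_has_sum_of_bool[of q S]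
    by (intro has_sum_add has_sum_cmult_right) simp_all
  have "?r z \<le> \<bar>pmf p z - pmf q z\<bar>" for z by auto
  then have "infsum ?r UNIV \<le> (\<Sum>\<^sub>\<infinity>z. \<bar>pmf p z - pmf q z\<bar>)"
    using r by (intro infsum_mono abs_diff_pmf_summable) (auto simp: summable_on_def)
  also have "infsum ?r UNIV = 2 * measure p S + (- 2) * measure q S + ((- 1) * 1 + 1)" using r by (rule infsumI)
  finally show ?thesis by (simp add: d_var_pmf)
qed

section \<open>Simulation by random trees\<close>

definition sim_output ::
    "('x, 'y, 'u, 'a, 'b) protocol \<Rightarrow> ('x \<Rightarrow> 'u \<Rightarrow> 'a \<Rightarrow> bits list \<Rightarrow> 't) \<Rightarrow> ('y \<Rightarrow> 'u \<Rightarrow> 'b \<Rightarrow> bits list \<Rightarrow> 't)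
      \<Rightarrow> ('x \<times> 'y) \<times> 'u \<times> 'a \<times> 'b \<Rightarrow> 't \<times> 't \<times> 'x \<times> 'y" where
  "sim_output \<sigma> f g = (\<lambda>((x, y), u, a, b). let t = transcript \<sigma> ((x, y), u, a, b) in (f x u a t, g y u b t, x, y))"

lemma (in protocol_space) sim_output_measurable:
  fixes f :: "'x \<Rightarrow> 'u \<Rightarrow> 'a \<Rightarrow> bits list \<Rightarrow> 't :: countable"
  assumes f: "\<forall>x t. (\<lambda>(u, a). f x u a t) \<in> pub \<pi> \<Otimes>\<^sub>M coin1 \<pi> \<rightarrow>\<^sub>M count_space UNIV"
    and g: "\<forall>y t. (\<lambda>(u, b). g y u b t) \<in> pub \<pi> \<Otimes>\<^sub>M coin2 \<pi> \<rightarrow>\<^sub>M count_space UNIV"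
  shows "sim_output \<pi> f g \<in> \<Omega> \<rightarrow>\<^sub>M count_space UNIV"
proof -
  have *: "(\<lambda>\<omega>. (f (fst (fst \<omega>)) (fst (snd \<omega>)) (fst (snd (snd \<omega>))) t, g (snd (fst \<omega>)) (fst (snd \<omega>)) (snd (snd (snd \<omega>))) t, fst \<omega>))
      \<in> \<Omega> \<rightarrow>\<^sub>M count_space UNIV" for t
  proof -
    have "(\<lambda>\<omega>. (f (fst (fst \<omega>)) (fst (snd \<omega>)) (fst (snd (snd \<omega>))) t, g (snd (fst \<omega>)) (fst (snd \<omega>)) (snd (snd (snd \<omega>))) t, fst \<omega>))
      \<in> \<Omega> \<rightarrow>\<^sub>M count_space UNIV \<Otimes>\<^sub>M (count_space UNIV \<Otimes>\<^sub>M count_space UNIV)"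
      by (intro measurable_Pair fst_measurable measurable_view1[of "\<lambda>x u a. f x u a t"] measurable_view2[of "\<lambda>x u a. g x u a t"]) (use f g in auto)
    then show ?thesis by (simp add: pair_measure_countable)
  qed
  have "(\<lambda>\<omega>. (f (fst (fst \<omega>)) (fst (snd \<omega>)) (fst (snd (snd \<omega>))) (transcript \<pi> \<omega>), g (snd (fst \<omega>)) (fst (snd \<omega>)) (snd (snd (snd \<omega>))) (transcript \<pi> \<omega>), fst \<omega>))
      \<in> \<Omega> \<rightarrow>\<^sub>M count_space UNIV"
    by (rule measurable_compose_countable[OF * transcript_measurable])
  then show ?thesis
    by (rule measurable_cong[THEN iffD1, rotated]) (auto simp: sim_output_def Let_def split: prod.splits)
qed

text \<open>A leaf carries two functions, since it is known to both parties while each output may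
  still depend on the party's own input.\<close>

definition tree_success :: "'c pmf \<Rightarrow> nat \<Rightarrow> ('c \<Rightarrow> ('x, 'y, ('x \<Rightarrow> 't) \<times> ('y \<Rightarrow> 't)) tree) \<Rightarrow> 't \<Rightarrow> 'x \<Rightarrow> 'y \<Rightarrow> real" where
  "tree_success \<mu> l T \<tau> x y = measure \<mu> {c. cost (T c) x y \<le> l \<and> fst (eval (T c) x y) x = \<tau> \<and> snd (eval (T c) x y) y = \<tau>}"

text \<open>The diagonal map from transcripts to pairs of equal outputs is injective, so pointwise
  domination on \<open>G\<close> carries over to pairs and \<open>d_var_pmf_le\<close>
  applies.\<close>

lemma simulation_by_trees_nat:
  fixes L :: "('t::countable \<times> 'x::countable \<times> 'y::countable) pmf" and \<mu> :: "nat pmf"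
  assumes L: "map_pmf snd L = P"
    and G: "\<And>\<tau> x y. (\<tau>, x, y) \<in> G \<Longrightarrow> c * pmf L (\<tau>, x, y) \<le> pmf P (x, y) * tree_success \<mu> l T \<tau> x y"
    and c: "c \<le> 1" "1 - \<epsilon> \<le> c * measure L G"
  shows "min_sim_length \<epsilon> P (measure_pmf L) \<le> enat l"
proof -
  let ?\<sigma> = "tree_protocol \<mu> l T"
  interpret protocol_space P ?\<sigma> by unfold_locales (rule is_protocol_tree)
  \<comment> \<open>The leaf is read off the transcript. If the run was cut off before a leaf, the
    output is arbitrary and counts as a failure.\<close>
  define f where "f x u a t = (let S = subtree (T (nat \<lfloor>u\<rfloor>)) (concat t) in if is_Ret S then fst (result S) x else undefined)"
    for x and u a :: real and t
  define g where "g x u a t = (let S = subtree (T (nat \<lfloor>u\<rfloor>)) (concat t) in if is_Ret S then snd (result S) x else undefined)"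
    for x and u a :: real and t
  have fm: "\<forall>x t. (\<lambda>(u, a). f x u a t) \<in> pub ?\<sigma> \<Otimes>\<^sub>M coin1 ?\<sigma> \<rightarrow>\<^sub>M count_space UNIV"
    unfolding f_def using floor_measurable[of "\<lambda>j. let S = subtree (T j) (concat t) in if is_Ret S then fst (result S) x else undefined" for t x] by blast
  have gm: "\<forall>x t. (\<lambda>(u, a). g x u a t) \<in> pub ?\<sigma> \<Otimes>\<^sub>M coin2 ?\<sigma> \<rightarrow>\<^sub>M count_space UNIV"
    unfolding g_def using floor_measurable[of "\<lambda>j. let S = subtree (T j) (concat t) in if is_Ret S then snd (result S) x else undefined" for t x] by blast
  note out = sim_output_measurable[OF fm gm]
  obtain q where q: "distr \<Omega> (count_space UNIV) (sim_output ?\<sigma> f g) = measure_pmf q"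
    by (rule distr_countable_pmf[OF sample.prob_space_axioms out])
  let ?\<psi> = "\<lambda>(t, x, y). (t, t, x, y)"
  have p: "distr (measure_pmf L) (count_space UNIV) ?\<psi> = measure_pmf (map_pmf ?\<psi> L)"
    by (simp add: map_pmf_rep_eq)
  have inj: "inj ?\<psi>" by (auto simp: inj_def)
  have "d_var (measure_pmf (map_pmf ?\<psi> L)) (measure_pmf q) \<le> 1 - c * measure (map_pmf ?\<psi> L) (?\<psi> ` G)"
  proof (rule d_var_pmf_le[OF _ c(1)])
    fix z assume "z \<in> ?\<psi> ` G"
    then obtain \<tau> x y where z: "z = (\<tau>, \<tau>, x, y)" "(\<tau>, x, y) \<in> G" by auto
    define A where "A = {u::real. let j = nat \<lfloor>u\<rfloor> in cost (T j) x y \<le> l \<and> fst (eval (T j) x y) x = \<tau> \<and> snd (eval (T j) x y) y = \<tau>}"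
    have Am: "A \<in> sets borel"
    proof -
      have "(\<lambda>u::real. nat \<lfloor>u\<rfloor>) \<in> borel \<rightarrow>\<^sub>M count_space UNIV"
        by (rule measurable_compose[where N = "count_space UNIV" and g = nat]) simp_all
      from measurable_sets[OF this, of "{j. cost (T j) x y \<le> l \<and> fst (eval (T j) x y) x = \<tau> \<and> snd (eval (T j) x y) y = \<tau>}"]
      show ?thesis by (simp add: A_def vimage_def Let_def)
    qed
    have sp: "sets (pub ?\<sigma>) = sets borel" "space (pub ?\<sigma>) = UNIV" by (simp_all add: tree_protocol_def)
    have "pmf (map_pmf ?\<psi> L) z = pmf L (\<tau>, x, y)"
      using pmf_map_inj'[OF inj, of L "(\<tau>, x, y)"] z by simp
    then have "c * pmf (map_pmf ?\<psi> L) z \<le> pmf P (x, y) * tree_success \<mu> l T \<tau> x y"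
      using G[OF z(2)] by simp
    also have "tree_success \<mu> l T \<tau> x y = measure (pub ?\<sigma>) A"
      using Am by (simp add: tree_success_def tree_protocol_def measure_distr A_def Let_def)
    also have "pmf P (x, y) * measure (pub ?\<sigma>) A = measure \<Omega> ({(x, y)} \<times> A \<times> space (coin1 ?\<sigma> \<Otimes>\<^sub>M coin2 ?\<sigma>))"
      unfolding sample_space_def measure_def using Am
      by (simp add: rand.emeasure_pair_measure_Times coins.emeasure_pair_measure_Times coins.emeasure_space_1 sp emeasure_pmf_single enn2real_mult)
    also have "\<dots> \<le> measure \<Omega> (sim_output ?\<sigma> f g -` {z} \<inter> space \<Omega>)"
    proof (rule sample.finite_measure_mono)
      show "sim_output ?\<sigma> f g -` {z} \<inter> space \<Omega> \<in> sets \<Omega>"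
        by (rule measurable_sets[OF out]) simp
      show "{(x, y)} \<times> A \<times> space (coin1 ?\<sigma> \<Otimes>\<^sub>M coin2 ?\<sigma>) \<subseteq> sim_output ?\<sigma> f g -` {z} \<inter> space \<Omega>"
        using transcript_tree[where T = T and l = l and \<mu> = \<mu> and x = x and y = y]
        by (auto simp: A_def sim_output_def Let_def f_def g_def z sample_space_def space_pair_measure sp)
    qed
    also have "\<dots> = pmf q z"
      using measure_distr[OF out, of "{z}"] by (simp add: q pmf.rep_eq)
    finally show "c * pmf (map_pmf ?\<psi> L) z \<le> pmf q z" .
  qed
  also have "measure (map_pmf ?\<psi> L) (?\<psi> ` G) = measure L G"
    by (simp add: inj inj_vimage_image_eq)
  finally have "d_var (distr (measure_pmf L) (count_space UNIV) ?\<psi>) (distr \<Omega> (count_space UNIV) (sim_output ?\<sigma> f g)) \<le> \<epsilon>"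
    unfolding p q by (rule order_trans) (use c(2) in linarith)
  then have "is_simulation \<epsilon> P (measure_pmf L) ?\<sigma>"
    unfolding is_simulation_def sim_output_def using fm gm by blast
  then have "min_sim_length \<epsilon> P (measure_pmf L) \<le> protocol_length P ?\<sigma>"
    unfolding min_sim_length_def
    by (intro INF_lower) (auto simp: is_protocol_tree self_delimiting_tree, simp_all add: tree_protocol_def)
  then show ?thesis using protocol_length_tree order_trans by blast
qed

lemma simulation_by_trees:
  fixes L :: "('t::countable \<times> 'x::countable \<times> 'y::countable) pmf" and \<mu> :: "'c::countable pmf"
  assumes "map_pmf snd L = P"
    and "\<And>\<tau> x y. (\<tau>, x, y) \<in> G \<Longrightarrow> c * pmf L (\<tau>, x, y) \<le> pmf P (x, y) * tree_success \<mu> l T \<tau> x y"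
    and "c \<le> 1" "1 - \<epsilon> \<le> c * measure L G"
  shows "min_sim_length \<epsilon> P (measure_pmf L) \<le> enat l"
  by (rule simulation_by_trees_nat[where \<mu> = "map_pmf to_nat \<mu>" and T = "T \<circ> from_nat" and G = G and c = c])
     (use assms in \<open>simp_all add: tree_success_def vimage_def\<close>)

section \<open>Transmitting a sampled value\<close>

primrec bind_tree :: "('x, 'y, 'r) tree \<Rightarrow> ('r \<Rightarrow> ('x, 'y, 's) tree) \<Rightarrow> ('x, 'y, 's) tree" where
  "bind_tree (Ret r) f = f r"
| "bind_tree (Say1 q k) f = Say1 q (\<lambda>b. bind_tree (k b) f)"
| "bind_tree (Say2 q k) f = Say2 q (\<lambda>b. bind_tree (k b) f)"

lemma eval_bind [simp]: "eval (bind_tree S f) x y = eval (f (eval S x y)) x y"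
  by (induction S) auto

lemma cost_bind [simp]: "cost (bind_tree S f) x y = cost S x y + cost (f (eval S x y)) x y"
  by (induction S) auto

text \<open>A round is constructed with Party 1 as sender; exchanging the roles gives the rounds of
  Party 2.\<close>

primrec swap_tree :: "('x, 'y, 'r) tree \<Rightarrow> ('y, 'x, 'r) tree" where
  "swap_tree (Ret r) = Ret r"
| "swap_tree (Say1 q k) = Say2 q (\<lambda>b. swap_tree (k b))"
| "swap_tree (Say2 q k) = Say1 q (\<lambda>b. swap_tree (k b))"

lemma eval_swap [simp]: "eval (swap_tree S) y x = eval S x y"
  by (induction S) auto

lemma cost_swap [simp]: "cost (swap_tree S) y x = cost S x y"
  by (induction S) auto

primrec send1 :: "('x \<Rightarrow> bits) \<Rightarrow> nat \<Rightarrow> nat \<Rightarrow> ('x, 'y, bits) tree" where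
  "send1 h i 0 = Ret []"
| "send1 h i (Suc n) = Say1 (\<lambda>x. h x ! i) (\<lambda>b. bind_tree (send1 h (Suc i) n) (\<lambda>w. Ret (b # w)))"

lemma send1: "i + n \<le> length (h x) \<Longrightarrow> eval (send1 h i n) x y = take n (drop i (h x)) \<and> cost (send1 h i n) x y = n"
  by (induction n arbitrary: i) (auto simp: Cons_nth_drop_Suc[symmetric])

text \<open>
  A dart is a value, a height and a hash. In stage \<open>r\<close> the sender completes the first \<open>\<l> r\<close> bits of
  the hash of its dart, and the receiver reports whether it has a candidate with this hash prefix.
\<close>

type_synonym 't dart = "'t \<times> nat \<times> bits"

abbreviation hash :: "'t dart \<Rightarrow> bits" where "hash d \<equiv> snd (snd d)"

primrec transmit :: "'t dart list \<Rightarrow> ('x \<Rightarrow> bits) \<Rightarrow> (nat \<Rightarrow> nat) \<Rightarrow> (nat \<Rightarrow> 'y \<Rightarrow> 't dart \<Rightarrow> bool)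
    \<Rightarrow> nat \<Rightarrow> nat \<Rightarrow> bits \<Rightarrow> ('x, 'y, (nat \<times> bits) option) tree" where
  "transmit ds h \<l> cand 0 r w = Ret None"
| "transmit ds h \<l> cand (Suc n) r w =
     bind_tree (send1 h (length w) (\<l> r - length w))
       (\<lambda>v. Say2 (\<lambda>y. \<exists>d\<in>set ds. cand r y d \<and> take (\<l> r) (hash d) = w @ v)
         (\<lambda>ok. if ok then Ret (Some (r, w @ v)) else transmit ds h \<l> cand n (Suc r) (w @ v)))"

text \<open>Stage \<open>r + j\<close> is the first in which the receiver reports success. The start
  \<open>r\<close> and the \<open>i\<close> bits already known are general for the sake of the
  induction; the cost counts the missing bits of the prefix and one report for each stage.\<close>

lemma transmit:
  assumes "mono \<l>" "j < n" "\<l> (r + j) \<le> length (h x)" "i \<le> \<l> r" "w = take i (h x)"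
    and "\<And>j'. j' < j \<Longrightarrow> \<not> (\<exists>d\<in>set ds. cand (r + j') y d \<and> take (\<l> (r + j')) (hash d) = take (\<l> (r + j')) (h x))"
    and "\<exists>d\<in>set ds. cand (r + j) y d \<and> take (\<l> (r + j)) (hash d) = take (\<l> (r + j)) (h x)"
  shows "eval (transmit ds h \<l> cand n r w) x y = Some (r + j, take (\<l> (r + j)) (h x)) \<and>
    cost (transmit ds h \<l> cand n r w) x y = \<l> (r + j) - i + j + 1"
  using assms(2-)
proof (induction n arbitrary: j r i w)
  case 0
  then show ?case by simp
next
  case (Suc n)
  have le: "\<l> r \<le> \<l> (r + j)" using assms(1) by (simp add: monoD)
  then have lr: "\<l> r \<le> length (h x)" using Suc.prems(2) by simp
  have lw: "length w = i" using Suc.prems(3,4) lr by simp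
  have "eval (send1 h (length w) (\<l> r - length w)) x y = take (\<l> r - i) (drop i (h x))"
    "cost (send1 h (length w) (\<l> r - length w)) x y = \<l> r - i"
    using send1[of "length w" "\<l> r - length w" h x y] lw lr Suc.prems(3) by simp_all
  moreover have "w @ take (\<l> r - i) (drop i (h x)) = take (\<l> r) (h x)"
    using Suc.prems(3,4) by (metis le_add_diff_inverse take_add)
  ultimately have E: "eval (transmit ds h \<l> cand (Suc n) r w) x y =
     (if \<exists>d\<in>set ds. cand r y d \<and> take (\<l> r) (hash d) = take (\<l> r) (h x) then Some (r, take (\<l> r) (h x))
      else eval (transmit ds h \<l> cand n (Suc r) (take (\<l> r) (h x))) x y)"
    and C: "cost (transmit ds h \<l> cand (Suc n) r w) x y = \<l> r - i + 1 +
     (if \<exists>d\<in>set ds. cand r y d \<and> take (\<l> r) (hash d) = take (\<l> r) (h x) then 0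
      else cost (transmit ds h \<l> cand n (Suc r) (take (\<l> r) (h x))) x y)"
    by (auto simp del: bex_simps)
  show ?case
  proof (cases j)
    case 0
    then show ?thesis using E C Suc.prems(6) by simp
  next
    case (Suc j0)
    have no: "\<not> (\<exists>d\<in>set ds. cand r y d \<and> take (\<l> r) (hash d) = take (\<l> r) (h x))"
      using Suc.prems(5)[of 0] Suc by simp
    have "eval (transmit ds h \<l> cand n (Suc r) (take (\<l> r) (h x))) x y = Some (Suc r + j0, take (\<l> (Suc r + j0)) (h x)) \<and>
      cost (transmit ds h \<l> cand n (Suc r) (take (\<l> r) (h x))) x y = \<l> (Suc r + j0) - \<l> r + j0 + 1"
    proof (rule Suc.IH)
      show "\<l> r \<le> \<l> (Suc r)" using assms(1) by (simp add: monoD)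
      show "\<not> (\<exists>d\<in>set ds. cand (Suc r + j') y d \<and> take (\<l> (Suc r + j')) (hash d) = take (\<l> (Suc r + j')) (h x))"
        if "j' < j0" for j'
        using Suc.prems(5)[of "Suc j'"] that Suc by simp
    qed (use Suc.prems Suc in auto)
    then show ?thesis using E C no Suc Suc.prems(3) le by auto
  qed
qed

text \<open>The leaf fixes only a stage and a hash prefix. The sender outputs the value of its own
  dart, the receiver that of its first candidate with this prefix; the default values occur only in
  failures.\<close>

definition round1 :: "'t dart list \<Rightarrow> ('x \<Rightarrow> 't dart \<Rightarrow> bool) \<Rightarrow> (nat \<Rightarrow> nat) \<Rightarrow> (nat \<Rightarrow> 'y \<Rightarrow> 't dart \<Rightarrow> bool)
    \<Rightarrow> nat \<Rightarrow> ('x, 'y, ('x \<Rightarrow> 't) \<times> ('y \<Rightarrow> 't)) tree" where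
  "round1 ds acc \<l> cand R =
     bind_tree (transmit ds (\<lambda>x. case find (acc x) ds of None \<Rightarrow> replicate (\<l> R) False | Some d \<Rightarrow> hash d) \<l> cand (Suc R) 0 [])
       (\<lambda>res. Ret (\<lambda>x. case find (acc x) ds of None \<Rightarrow> undefined | Some d \<Rightarrow> fst d,
                   \<lambda>y. case res of None \<Rightarrow> undefined | Some (r, v) \<Rightarrow>
                     (case find (\<lambda>d. cand r y d \<and> take (\<l> r) (hash d) = v) ds of None \<Rightarrow> undefined | Some d \<Rightarrow> fst d)))"

text \<open>Without collisions every positive report concerns the sender's own dart. A report that
  comes before stage \<open>r0\<close> is thus harmless and only saves bits.\<close>

lemma round1:
  assumes "mono \<l>" "find (acc x) ds = Some d" "\<l> R \<le> length (hash d)"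
    and nocoll: "\<And>d' r. d' \<in> set ds \<Longrightarrow> r \<le> R \<Longrightarrow> cand r y d' \<Longrightarrow> take (\<l> r) (hash d') = take (\<l> r) (hash d) \<Longrightarrow> d' = d"
    and r0: "r0 \<le> R" "cand r0 y d"
  shows "fst (eval (round1 ds acc \<l> cand R) x y) x = fst d \<and> snd (eval (round1 ds acc \<l> cand R) x y) y = fst d \<and>
     cost (round1 ds acc \<l> cand R) x y \<le> \<l> r0 + r0 + 1"
proof -
  let ?h = "\<lambda>x. case find (acc x) ds of None \<Rightarrow> replicate (\<l> R) False | Some d \<Rightarrow> hash d"
  have hx: "?h x = hash d" using assms(2) by simp
  have dset: "d \<in> set ds" using assms(2) by (auto simp: find_Some_iff)
  let ?Q = "\<lambda>r. \<exists>d'\<in>set ds. cand r y d' \<and> take (\<l> r) (hash d') = take (\<l> r) (hash d)"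
  define j where "j = (LEAST r. ?Q r)"
  have Q0: "?Q r0" using r0 dset by blast
  have j: "?Q j" "j \<le> r0" "\<And>j'. j' < j \<Longrightarrow> \<not> ?Q j'"
    unfolding j_def using LeastI[of ?Q, OF Q0] Least_le[of ?Q, OF Q0] not_less_Least[of _ ?Q] by blast+
  have lj: "\<l> j \<le> \<l> r0" "\<l> r0 \<le> \<l> R" using j(2) r0(1) assms(1) by (auto simp: monoD)
  have T: "eval (transmit ds ?h \<l> cand (Suc R) 0 []) x y = Some (j, take (\<l> j) (hash d)) \<and>
    cost (transmit ds ?h \<l> cand (Suc R) 0 []) x y = \<l> j + j + 1"
    using transmit[OF assms(1), where j = j and n = "Suc R" and r = 0 and i = 0 and h = ?h and x = x and w = "[]" and ds = ds and cand = cand and y = y]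
      j lj assms(3) r0 hx by auto
  obtain d1 where d1: "find (\<lambda>d'. cand j y d' \<and> take (\<l> j) (hash d') = take (\<l> j) (hash d)) ds = Some d1"
    using j(1) by (cases "find (\<lambda>d'. cand j y d' \<and> take (\<l> j) (hash d') = take (\<l> j) (hash d)) ds") (auto simp: find_None_iff)
  then have "d1 = d"
    using nocoll[of d1 j] j(2) r0(1) by (auto simp: find_Some_iff)
  then show ?thesis
    using T d1 assms(2) lj j(2) by (simp add: round1_def)
qed

section \<open>Random darts\<close>

text \<open>Written through \<open>Pi_pmf\<close>, so that events given by conditions on single
  throws have product probabilities.\<close>

definition throws :: "nat \<Rightarrow> 'c pmf \<Rightarrow> 'c list pmf" where
  "throws N p = map_pmf (\<lambda>\<omega>. map \<omega> [0..<N]) (Pi_pmf {..<N} undefined (\<lambda>_. p))"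

lemma prod_if_two:
  fixes i j N :: nat
  assumes "i < N" "j < N" "i \<noteq> j"
  shows "(\<Prod>k<N. if k = i then a else if k = j then b else (1::real)) = a * b"
proof -
  have "(\<Prod>k<N. if k = i then a else if k = j then b else (1::real)) = (\<Prod>k<N. (if k = i then a else 1) * (if k = j then b else 1))"
    using assms by (intro prod.cong) auto
  also have "\<dots> = a * b"
    using assms by (simp add: prod.distrib)
  finally show ?thesis .
qed

text \<open>Sums over the value of throw \<open>i\<close>; throw \<open>j\<close> is independent of
  it.\<close>

lemma throws_pair:
  assumes "i < N" "j < N" "i \<noteq> j" "finite (set_pmf p)"
    and c: "\<And>a. a \<in> A \<Longrightarrow> measure p (C a) \<le> c"
  shows "measure (throws N p) {ds. ds ! i \<in> A \<and> ds ! j \<in> C (ds ! i)} \<le> measure p A * c"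
proof -
  let ?M = "Pi_pmf {..<N} undefined (\<lambda>_. p)"
  have "measure (throws N p) {ds. ds ! i \<in> A \<and> ds ! j \<in> C (ds ! i)} = measure ?M {\<omega>. \<omega> i \<in> A \<and> \<omega> j \<in> C (\<omega> i)}"
    using assms by (simp add: throws_def vimage_def)
  also have "\<dots> = measure ?M ({\<omega>. \<omega> i \<in> A \<and> \<omega> j \<in> C (\<omega> i)} \<inter> set_pmf ?M)"
    by (simp add: measure_Int_set_pmf)
  also have "\<dots> \<le> measure ?M (\<Union>a\<in>A \<inter> set_pmf p. Pi {..<N} (\<lambda>k. if k = i then {a} else if k = j then C a else UNIV))"
    using assms(1,2,3) by (intro measure_pmf.finite_measure_mono) (auto simp: set_Pi_pmf PiE_dflt_def)
  also have "\<dots> \<le> (\<Sum>a\<in>A \<inter> set_pmf p. measure ?M (Pi {..<N} (\<lambda>k. if k = i then {a} else if k = j then C a else UNIV)))"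
    using assms(4) by (intro measure_pmf.finite_measure_subadditive_finite) auto
  also have "\<dots> = (\<Sum>a\<in>A \<inter> set_pmf p. \<Prod>k<N. measure p (if k = i then {a} else if k = j then C a else UNIV))"
    by (simp add: measure_Pi_pmf_Pi)
  also have "\<dots> = (\<Sum>a\<in>A \<inter> set_pmf p. \<Prod>k<N. if k = i then measure p {a} else if k = j then measure p (C a) else 1)"
    by (intro sum.cong prod.cong refl) auto
  also have "\<dots> = (\<Sum>a\<in>A \<inter> set_pmf p. pmf p a * measure p (C a))"
    using assms by (simp add: prod_if_two pmf.rep_eq)
  also have "\<dots> \<le> (\<Sum>a\<in>A \<inter> set_pmf p. pmf p a * c)"
    using c by (intro sum_mono mult_left_mono) auto
  also have "\<dots> = measure p A * c"
    using assms(4) by (simp add: sum_distrib_right[symmetric] measure_measure_pmf_finite[symmetric] measure_Int_set_pmf)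
  finally show ?thesis .
qed

lemma throws_collision:
  assumes "finite (set_pmf p)" "\<And>a. a \<in> A \<Longrightarrow> measure p (C a) \<le> c" "0 \<le> c"
  shows "measure (throws N p) {ds. \<exists>i<N. \<exists>j<N. i \<noteq> j \<and> ds ! i \<in> A \<and> ds ! j \<in> C (ds ! i)} \<le> (real N)\<^sup>2 * (measure p A * c)"
proof -
  let ?I = "{(i, j). i < N \<and> j < N \<and> i \<noteq> j}"
  have sub: "?I \<subseteq> {..<N} \<times> {..<N}" by auto
  then have fin: "finite ?I" using finite_subset by blast
  have card: "card ?I \<le> N ^ 2"
    using card_mono[OF _ sub] by (simp add: card_cartesian_product power2_eq_square)
  have "{ds. \<exists>i<N. \<exists>j<N. i \<noteq> j \<and> ds ! i \<in> A \<and> ds ! j \<in> C (ds ! i)} = (\<Union>(i, j)\<in>?I. {ds. ds ! i \<in> A \<and> ds ! j \<in> C (ds ! i)})"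
    by auto
  then have "measure (throws N p) {ds. \<exists>i<N. \<exists>j<N. i \<noteq> j \<and> ds ! i \<in> A \<and> ds ! j \<in> C (ds ! i)} \<le>
     (\<Sum>(i, j)\<in>?I. measure (throws N p) {ds. ds ! i \<in> A \<and> ds ! j \<in> C (ds ! i)})"
    using measure_pmf.finite_measure_subadditive_finite[OF fin, of "\<lambda>(i, j). {ds. ds ! i \<in> A \<and> ds ! j \<in> C (ds ! i)}" "throws N p"]
    by (simp add: case_prod_beta)
  also have "\<dots> \<le> (\<Sum>(i, j)\<in>?I. measure p A * c)"
    using throws_pair[OF _ _ _ assms(1,2)] by (intro sum_mono) auto
  also have "\<dots> = real (card ?I) * (measure p A * c)" by (simp add: case_prod_beta)
  also have "\<dots> \<le> (real N)\<^sup>2 * (measure p A * c)"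
    using card assms(3) by (intro mult_right_mono) (auto simp flip: of_nat_power)
  finally show ?thesis .
qed

lemma find_map_upt_Some_iff:
  "find Q (map \<omega> [0..<N]) = Some d \<longleftrightarrow> (\<exists>j<N. \<omega> j = d \<and> Q d \<and> (\<forall>i<j. \<not> Q (\<omega> i)))"
  by (auto simp: find_Some_iff)

text \<open>Splits by the index of the first accepted dart. At each index the earlier rejections and
  the event \<open>B\<close> are independent, which leaves \<open>measure p B\<close> times a
  geometric sum.\<close>

lemma throws_first:
  assumes "B \<subseteq> {d. acc d}"
  shows "measure (throws N p) {ds. \<exists>d\<in>B. find acc ds = Some d} = measure p B * (\<Sum>j<N. (1 - measure p {d. acc d}) ^ j)"
proof -
  let ?M = "Pi_pmf {..<N} undefined (\<lambda>_. p)"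
  define E where "E j = Pi {..<N} (\<lambda>k. if k < j then {d. \<not> acc d} else if k = j then B else UNIV)" for j
  have "measure (throws N p) {ds. \<exists>d\<in>B. find acc ds = Some d} = measure ?M {\<omega>. \<exists>d\<in>B. find acc (map \<omega> [0..<N]) = Some d}"
    by (simp add: throws_def vimage_def)
  also have "{\<omega>. \<exists>d\<in>B. find acc (map \<omega> [0..<N]) = Some d} = (\<Union>j<N. E j)"
    unfolding find_map_upt_Some_iff E_def using assms by (auto simp: Pi_def split: if_splits)
  also have "measure ?M (\<Union>j<N. E j) = (\<Sum>j<N. measure ?M (E j))"
  proof (intro measure_pmf.finite_measure_finite_Union)
    show "disjoint_family_on E {..<N}"
      unfolding disjoint_family_on_def
    proof (intro ballI impI)
      fix i j assume ij: "i \<in> {..<N}" "j \<in> {..<N}" "i \<noteq> j"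
      have "E i \<inter> E j = {}" if "i < j" "j < N" for i j
      proof -
        have "\<omega> i \<in> B" if "\<omega> \<in> E i" for \<omega>
          using that \<open>i < j\<close> \<open>j < N\<close> unfolding E_def by (auto dest!: Pi_mem[of _ _ _ i])
        moreover have "\<omega> i \<notin> {d. acc d}" if "\<omega> \<in> E j" for \<omega>
          using that \<open>i < j\<close> \<open>j < N\<close> unfolding E_def by (auto dest!: Pi_mem[of _ _ _ i])
        ultimately show ?thesis using assms by blast
      qed
      then show "E i \<inter> E j = {}" using ij by (metis inf_commute lessThan_iff linorder_neqE_nat)
    qed
  qed auto
  also have "\<dots> = (\<Sum>j<N. measure p B * (1 - measure p {d. acc d}) ^ j)"
  proof (intro sum.cong refl)
    fix j assume j: "j \<in> {..<N}"
    have N: "{..<N} = {..<j} \<union> {j} \<union> {j<..<N}" using j by auto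
    have "measure ?M (E j) = (\<Prod>k<N. measure p (if k < j then {d. \<not> acc d} else if k = j then B else UNIV))"
      by (simp add: E_def measure_Pi_pmf_Pi)
    also have "\<dots> = (\<Prod>k<j. measure p {d. \<not> acc d}) * measure p B"
      unfolding N by (subst prod.union_disjoint; auto)+
    also have "measure p {d. \<not> acc d} = 1 - measure p {d. acc d}"
      using measure_pmf.prob_compl[of "{d. acc d}" p] by (simp add: Compl_eq_Diff_UNIV[symmetric] Collect_neg_eq)
    finally show "measure ?M (E j) = measure p B * (1 - measure p {d. acc d}) ^ j" by simp
  qed
  finally show ?thesis by (simp add: sum_distrib_left)
qed

section \<open>One round\<close>

text \<open>Rejection sampling with heights on a grid of \<open>K\<close> points in place of the
  unit interval, so that the public randomness stays discrete.\<close>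

definition below :: "nat \<Rightarrow> ('t \<Rightarrow> real) \<Rightarrow> 't dart \<Rightarrow> bool" where
  "below K A d \<longleftrightarrow> real (fst (snd d)) < real K * A (fst d)"

definition darts :: "'t set \<Rightarrow> nat \<Rightarrow> nat \<Rightarrow> 't dart set" where
  "darts M K H = M \<times> {..<K} \<times> {h. length h = H}"

text \<open>In stage \<open>r\<close> the receiver enlarges its law by
  \<open>2 ^ (\<kappa> + r * \<Delta>)\<close>, and the hash prefix is \<open>3 * s\<close> bits
  longer than the exponent. Of these, \<open>2 * s\<close> bits pay for the pairs among
  \<open>card M * 2 ^ s\<close> darts; the other \<open>s\<close> bits make the collision error
  small.\<close>

definition sampled_round :: "nat \<Rightarrow> nat \<Rightarrow> nat \<Rightarrow> nat \<Rightarrow> nat \<Rightarrow> ('x \<Rightarrow> 't \<Rightarrow> real) \<Rightarrow> ('y \<Rightarrow> 't \<Rightarrow> real)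
    \<Rightarrow> 't dart list \<Rightarrow> ('x, 'y, ('x \<Rightarrow> 't) \<times> ('y \<Rightarrow> 't)) tree" where
  "sampled_round K \<kappa> \<Delta> s R A B ds = round1 ds (\<lambda>x. below K (A x)) (\<lambda>r. \<kappa> + r * \<Delta> + 3 * s)
     (\<lambda>r y. below K (\<lambda>m. 2 ^ (\<kappa> + r * \<Delta>) * B y m)) R"

lemma card_lists_take_le:
  "card {h :: bool list. length h = H \<and> take \<l> h = v} \<le> 2 ^ (H - \<l>)"
proof -
  have "card {h :: bool list. length h = H \<and> take \<l> h = v} = card (drop \<l> ` {h. length h = H \<and> take \<l> h = v})"
  proof (rule card_image[symmetric], rule inj_onI)
    fix g h assume "g \<in> {h :: bool list. length h = H \<and> take \<l> h = v}" "h \<in> {h. length h = H \<and> take \<l> h = v}" "drop \<l> g = drop \<l> h"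
    then have "take \<l> g @ drop \<l> g = take \<l> h @ drop \<l> h" by simp
    then show "g = h" by (simp only: append_take_drop_id)
  qed
  also have "\<dots> \<le> card {h :: bool list. set h \<subseteq> UNIV \<and> length h = H - \<l>}"
    by (rule card_mono[OF finite_lists_length_eq]) auto
  also have "\<dots> = 2 ^ (H - \<l>)" by (subst card_lists_length_eq) (simp_all add: card_UNIV_bool)
  finally show ?thesis .
qed

text \<open>Rounding up to the grid adds at most one height for each value; choosing
  \<open>K = card M * 2 ^ s\<close> makes this a relative error of \<open>1 / 2 ^ s\<close>.\<close>

lemma card_below:
  assumes "finite M" "\<And>m. m \<in> M \<Longrightarrow> 0 \<le> A m"
  shows "real (card {(m, p). m \<in> M \<and> p < K \<and> real p < real K * A m}) \<le> real K * sum A M + real (card M)"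
proof -
  have c1: "real (card {p. p < K \<and> real p < real K * A m}) \<le> real K * A m + 1" if "m \<in> M" for m
  proof -
    have "{p. p < K \<and> real p < real K * A m} \<subseteq> {..<nat \<lceil>real K * A m\<rceil>}"
      by (auto simp: less_ceiling_iff zless_nat_eq_int_zless)
    from card_mono[OF _ this] have "card {p. p < K \<and> real p < real K * A m} \<le> nat \<lceil>real K * A m\<rceil>" by simp
    then show ?thesis using assms(2)[OF that] by (smt (verit) of_nat_ceiling of_nat_mono mult_nonneg_nonneg of_nat_0_le_iff of_nat_nat ceiling_correct zero_le_ceiling)
  qed
  have "{(m, p). m \<in> M \<and> p < K \<and> real p < real K * A m} = (SIGMA m:M. {p. p < K \<and> real p < real K * A m})" by auto
  then have "card {(m, p). m \<in> M \<and> p < K \<and> real p < real K * A m} = (\<Sum>m\<in>M. card {p. p < K \<and> real p < real K * A m})"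
    using assms(1) by (simp add: card_SigmaI)
  then have "real (card {(m, p). m \<in> M \<and> p < K \<and> real p < real K * A m}) \<le> (\<Sum>m\<in>M. real K * A m + 1)"
    using c1 by (simp add: sum_mono)
  then show ?thesis by (simp add: sum.distrib sum_distrib_left)
qed

lemma card_below_ge:
  assumes "0 \<le> A" "A \<le> 1"
  shows "real K * A \<le> real (card {p. p < K \<and> real p < real K * A})"
proof -
  have "{..<nat \<lceil>real K * A\<rceil>} \<subseteq> {p. p < K \<and> real p < real K * A}"
  proof
    fix p assume "p \<in> {..<nat \<lceil>real K * A\<rceil>}"
    then have "real p < real K * A" by (auto simp: zless_nat_eq_int_zless less_ceiling_iff)
    moreover have "real K * A \<le> real K" using assms by (simp add: mult_left_le)
    ultimately show "p \<in> {p. p < K \<and> real p < real K * A}" by auto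
  qed
  from card_mono[OF _ this] have "nat \<lceil>real K * A\<rceil> \<le> card {p. p < K \<and> real p < real K * A}" by simp
  then show ?thesis by linarith
qed

text \<open>The darts are accepted with probability at most about \<open>1 / n\<close>, so
  \<open>n * 2 ^ s\<close> throws miss with probability at most \<open>exp (- (2 ^ s))\<close> once
  the rate is raised to \<open>1 / n\<close>, and the geometric sum is close to its limit.\<close>

lemma geometric_lower:
  fixes z :: real and n N s :: nat
  assumes "0 \<le> z" "z \<le> 1" "z \<le> (1 + 1 / 2 ^ s) / n" "n > 0" "N = n * 2 ^ s"
  shows "real n * (1 - 2 / 2 ^ s) \<le> (\<Sum>j<N. (1 - z) ^ j)"
proof -
  \<comment> \<open>The acceptance rate may lie below \<open>1 / n\<close>. The sum decreases in the
    rate, so raising it to \<open>1 / n\<close> is allowed for a lower bound.\<close>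
  define \<zeta> where "\<zeta> = max z (1 / n)"
  have \<zeta>: "z \<le> \<zeta>" "\<zeta> \<le> 1" "0 < \<zeta>" "1 / n \<le> \<zeta>"
    using assms by (auto simp: \<zeta>_def less_max_iff_disj)
  have \<zeta>': "\<zeta> \<le> (1 + 1 / 2 ^ s) / n"
    using assms by (auto simp: \<zeta>_def divide_right_mono)
  have "(1 - \<zeta>) ^ N \<le> exp (- \<zeta>) ^ N"
    using \<zeta> exp_ge_add_one_self[of "- \<zeta>"] by (intro power_mono) auto
  also have "\<dots> = exp (- (\<zeta> * N))" by (simp add: exp_of_nat_mult[symmetric] mult.commute)
  also have "\<dots> \<le> exp (- (2 ^ s))"
  proof -
    have "(1 / n) * N \<le> \<zeta> * N" using \<zeta> by (intro mult_right_mono) auto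
    then show ?thesis using assms(4,5) by simp
  qed
  also have "\<dots> \<le> 1 / 2 ^ s"
  proof -
    have "(2::real) ^ s \<le> exp (2 ^ s)" using exp_ge_add_one_self[of "(2::real) ^ s"] by linarith
    then show ?thesis by (simp add: exp_minus field_simps)
  qed
  finally have p: "(1 - \<zeta>) ^ N \<le> 1 / 2 ^ s" .
  have "real n * (1 - 2 / 2 ^ s) \<le> n * ((1 - 1 / 2 ^ s) / (1 + 1 / 2 ^ s))"
  proof (rule mult_left_mono)
    have "(1 - 2 / 2 ^ s) * (1 + 1 / 2 ^ s) \<le> (1 - 1 / 2 ^ s :: real)"
    proof -
      have "(1 - 2 * e) * (1 + e) \<le> 1 - e" for e :: real
        using zero_le_square[of e] by (simp add: algebra_simps)
      from this[of "1 / 2 ^ s"] show ?thesis by simp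
    qed
    then show "(1 - 2 / 2 ^ s :: real) \<le> (1 - 1 / 2 ^ s) / (1 + 1 / 2 ^ s)"
      by (simp add: pos_le_divide_eq add_pos_pos)
  qed simp
  also have "\<dots> = (1 - 1 / 2 ^ s) / ((1 + 1 / 2 ^ s) / n)" by simp
  also have "\<dots> \<le> (1 - 1 / 2 ^ s) / \<zeta>"
    using \<zeta> \<zeta>' assms(4) by (intro divide_left_mono) (auto intro!: mult_pos_pos divide_pos_pos add_pos_pos)
  also have "\<dots> \<le> (1 - (1 - \<zeta>) ^ N) / \<zeta>"
    using p \<zeta> by (intro divide_right_mono) auto
  also have "\<dots> = (\<Sum>j<N. (1 - \<zeta>) ^ j)"
    using \<zeta> by (simp add: sum_gp_strict)
  also have "\<dots> \<le> (\<Sum>j<N. (1 - z) ^ j)"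
    using \<zeta> by (intro sum_mono power_mono) auto
  finally show ?thesis .
qed

text \<open>The first accepted dart has the value \<open>m\<close> with probability at least
  \<open>q * n * (1 - 2 / 2 ^ s)\<close>, and each of the stages 0 to \<open>R\<close> loses at most
  \<open>q * n * (2 / 2 ^ s)\<close> by collisions; together this is the constant
  \<open>2 * R + 4\<close>. The loss is proportional to the mass of \<open>m\<close> itself because
  a harmful collision involves a dart of value \<open>m\<close>.\<close>

lemma sampled_round:
  fixes M :: "'t set" and A :: "'x \<Rightarrow> 't \<Rightarrow> real" and B :: "'y \<Rightarrow> 't \<Rightarrow> real"
  assumes M: "finite M" and K: "K = card M * 2 ^ s" and N: "N = card M * 2 ^ s" and H: "H = \<kappa> + R * \<Delta> + 3 * s"
    and A: "\<And>m. m \<in> M \<Longrightarrow> 0 \<le> A x m" "sum (A x) M \<le> 1"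
    and B: "\<And>m. m \<in> M \<Longrightarrow> 0 \<le> B y m" "sum (B y) M \<le> 1"
    and m: "m \<in> M" and r0: "r0 \<le> R" "A x m \<le> 2 ^ (\<kappa> + r0 * \<Delta>) * B y m"
  shows "A x m * (1 - (2 * real R + 4) / 2 ^ s) \<le> measure (throws N (pmf_of_set (darts M K H)))
     {ds. fst (eval (sampled_round K \<kappa> \<Delta> s R A B ds) x y) x = m \<and>
          snd (eval (sampled_round K \<kappa> \<Delta> s R A B ds) x y) y = m \<and>
          cost (sampled_round K \<kappa> \<Delta> s R A B ds) x y \<le> \<kappa> + r0 * \<Delta> + 3 * s + r0 + 1}"
    (is "_ \<le> measure ?T ?G")
proof -
  define n where "n = card M"
  have n: "n > 0" using M m by (auto simp: n_def card_gt_0_iff)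
  have KN: "K = n * 2 ^ s" "N = n * 2 ^ s" "K > 0" using K N n by (auto simp: n_def)
  define \<l> where "\<l> r = \<kappa> + r * \<Delta> + 3 * s" for r
  have mono: "mono \<l>" by (auto simp: \<l>_def mono_def)
  let ?D = "darts M K H" and ?p = "pmf_of_set (darts M K H)"
  define cB where "cB r = below K (\<lambda>m. 2 ^ (\<kappa> + r * \<Delta>) * B y m)" for r
  have fin: "finite {h :: bool list. length h = H}" using finite_lists_length_eq[of "UNIV :: bool set" H] by simp
  have cardh: "card {h :: bool list. length h = H} = 2 ^ H" using card_lists_length_eq[of "UNIV :: bool set" H] by (simp add: card_UNIV_bool)
  have finD: "finite ?D" using M fin by (simp add: darts_def)
  have cardD: "card ?D = n * (K * 2 ^ H)" by (simp add: darts_def card_cartesian_product cardh n_def)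
  then have neD: "?D \<noteq> {}" using n KN by (metis card.empty mult_is_0 not_gr_zero power_not_zero zero_neq_numeral)
  have prob: "measure ?p S = real (card (?D \<inter> S)) / (real n * (real K * 2 ^ H))" for S
    using measure_pmf_of_set[OF neD finD, of S] by (simp add: cardD)
  have setp: "set_pmf ?p = ?D" using neD finD by (rule set_pmf_of_set)

  define z where "z = measure ?p {d. below K (A x) d}"
  define Am where "Am = {d \<in> ?D. below K (A x) d \<and> fst d = m}"
  define q where "q = measure ?p Am"
  have z: "z \<le> (1 + 1 / 2 ^ s) / n"
  proof -
    have "?D \<inter> {d. below K (A x) d} = (\<lambda>((m, p), h). (m, p, h)) ` ({(m, p). m \<in> M \<and> p < K \<and> real p < real K * A x m} \<times> {h. length h = H})"
      by (force simp: darts_def below_def)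
    then have "card (?D \<inter> {d. below K (A x) d}) = card ({(m, p). m \<in> M \<and> p < K \<and> real p < real K * A x m} \<times> {h :: bool list. length h = H})"
      by (simp add: card_image inj_on_def case_prod_beta)
    then have "real (card (?D \<inter> {d. below K (A x) d})) = real (card {(m, p). m \<in> M \<and> p < K \<and> real p < real K * A x m}) * 2 ^ H"
      by (simp add: card_cartesian_product cardh)
    also have "\<dots> \<le> (real K * 1 + real n) * 2 ^ H"
    proof (rule mult_right_mono)
      have "real K * sum (A x) M \<le> real K * 1" using A(2) by (rule mult_left_mono) simp
      then show "real (card {(m, p). m \<in> M \<and> p < K \<and> real p < real K * A x m}) \<le> real K * 1 + real n"
        using card_below[where K = K and A = "A x" and M = M] M A(1) unfolding n_def by fastforce
    qed simp
    finally have "z \<le> (real K * 1 + real n) * 2 ^ H / (real n * (real K * 2 ^ H))"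
      unfolding z_def prob by (rule divide_right_mono) simp
    also have "\<dots> = (1 + 1 / 2 ^ s) / n"
      using n by (simp add: KN field_simps)
    finally show ?thesis .
  qed
  have q: "A x m \<le> q * n" "0 \<le> q"
  proof -
    have "A x m \<le> 1" using member_le_sum[of m M "A x"] A M m by simp
    have "?D \<inter> Am = {m} \<times> {p. p < K \<and> real p < real K * A x m} \<times> {h. length h = H}"
      using m by (auto simp: Am_def darts_def below_def)
    then have "real (card (?D \<inter> Am)) = real (card {p. p < K \<and> real p < real K * A x m}) * 2 ^ H"
      by (simp add: card_cartesian_product cardh)
    also have "\<dots> \<ge> real K * A x m * 2 ^ H"
      using card_below_ge[of "A x m" K] A(1)[OF m] \<open>A x m \<le> 1\<close> by (intro mult_right_mono) auto
    finally have "real K * A x m * 2 ^ H / (real n * (real K * 2 ^ H)) \<le> q"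
      unfolding q_def prob by (rule divide_right_mono) simp
    then show "A x m \<le> q * n" using n KN(3) by (simp add: field_simps)
  qed (simp add: q_def)
  \<comment> \<open>In a later stage there are more candidates by the same factor by which the
    longer prefix thins them out, so one bound serves all stages.\<close>
  define c where "c = 2 / (2 ^ (3 * s) * n)"
  define C where "C r d = {d'. cB r d' \<and> take (\<l> r) (hash d') = take (\<l> r) (hash d)}" for r and d :: "'t dart"
  have c: "measure ?p (C r d) \<le> c" if r: "r \<le> R" for r d
  proof -
    have lH: "\<l> r \<le> H" using r by (simp add: \<l>_def H)
    let ?k = "\<kappa> + r * \<Delta>"
    let ?S = "{(m, p). m \<in> M \<and> p < K \<and> real p < real K * (2 ^ ?k * B y m)}"
    let ?h = "{h. length h = H \<and> take (\<l> r) h = take (\<l> r) (hash d)}"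
    have "?D \<inter> C r d = (\<lambda>((m, p), h). (m, p, h)) ` (?S \<times> ?h)"
      by (force simp: darts_def below_def C_def cB_def)
    then have "card (?D \<inter> C r d) = card (?S \<times> ?h)"
      by (simp add: card_image inj_on_def case_prod_beta)
    then have "real (card (?D \<inter> C r d)) = real (card ?S) * real (card ?h)"
      by (simp add: card_cartesian_product)
    also have "\<dots> \<le> (real K * 2 ^ ?k + real n) * 2 ^ (H - \<l> r)"
    proof (rule mult_mono)
      have "real (card ?S) \<le> real K * sum (\<lambda>m. 2 ^ ?k * B y m) M + real (card M)"
        using B(1) by (intro card_below[OF M]) auto
      also have "sum (\<lambda>m. 2 ^ ?k * B y m) M \<le> 2 ^ ?k"
        using B(2) by (simp flip: sum_distrib_left)
      finally show "real (card ?S) \<le> real K * 2 ^ ?k + real n" by (simp add: n_def mult_left_mono)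
      show "real (card ?h) \<le> 2 ^ (H - \<l> r)"
        using card_lists_take_le[of H "\<l> r" "take (\<l> r) (hash d)"] by (simp flip: of_nat_le_iff)
    qed auto
    also have "\<dots> \<le> (2 * real K * 2 ^ ?k) * 2 ^ (H - \<l> r)"
    proof (intro mult_right_mono)
      have "real n \<le> real K" using mult_left_mono[of 1 "2 ^ s" "real n"] by (simp add: KN)
      also have "\<dots> \<le> real K * 2 ^ ?k" by (simp add: mult_le_cancel_left1)
      finally show "real K * 2 ^ ?k + real n \<le> 2 * real K * 2 ^ ?k" by simp
    qed simp
    finally have "measure ?p (C r d) \<le> (2 * real K * 2 ^ ?k) * 2 ^ (H - \<l> r) / (real n * (real K * 2 ^ H))"
      unfolding prob by (rule divide_right_mono) simp
    also have "2 ^ H = (2::real) ^ ?k * 2 ^ (3 * s) * 2 ^ (H - \<l> r)"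
      using lH by (simp flip: power_add add: \<l>_def)
    finally show ?thesis using KN(3) by (simp add: c_def mult.commute)
  qed
  define Bad where "Bad r = {ds. \<exists>i<N. \<exists>j<N. i \<noteq> j \<and> ds ! i \<in> Am \<and> ds ! j \<in> C r (ds ! i)}" for r
  have bad: "measure ?T (Bad r) \<le> q * n * (2 / 2 ^ s)" if "r \<le> R" for r
  proof -
    have "measure ?T (Bad r) \<le> (real N)\<^sup>2 * (q * c)"
      unfolding Bad_def q_def using c[OF that] by (intro throws_collision) (auto simp: setp finD c_def)
    also have "\<dots> = q * n * (2 / 2 ^ s)"
      using n by (simp add: KN c_def power2_eq_square field_simps power_add[symmetric] power_mult_distrib)
    finally show ?thesis .
  qed
  have "A x m * (1 - (2 * real R + 4) / 2 ^ s) \<le> measure ?T ?G"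
  proof (cases "1 - (2 * real R + 4) / 2 ^ s \<le> 0")
    case True
    then show ?thesis using A(1)[OF m] by (meson measure_nonneg mult_nonneg_nonpos order_trans)
  next
    case False
    let ?F = "{ds. \<exists>d\<in>Am. find (below K (A x)) ds = Some d}"
    have "A x m * (1 - (2 * real R + 4) / 2 ^ s) \<le> q * n * (1 - (2 * real R + 4) / 2 ^ s)"
      using q False by (intro mult_right_mono) auto
    also have "\<dots> = q * (n * (1 - 2 / 2 ^ s)) - (\<Sum>r\<le>R. q * n * (2 / 2 ^ s))"
      by (simp add: field_simps)
    also have "\<dots> \<le> q * (\<Sum>j<N. (1 - z) ^ j) - (\<Sum>r\<le>R. measure ?T (Bad r))"
      using q z n bad by (intro diff_mono mult_left_mono geometric_lower sum_mono) (auto simp: KN z_def)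
    also have "q * (\<Sum>j<N. (1 - z) ^ j) = measure ?T ?F"
      unfolding q_def z_def by (rule throws_first[symmetric]) (auto simp: Am_def)
    also have "measure ?T ?F - (\<Sum>r\<le>R. measure ?T (Bad r)) \<le> measure ?T ?F - measure ?T (\<Union>r\<le>R. Bad r)"
      by (intro diff_mono order_refl measure_pmf.finite_measure_subadditive_finite) auto
    also have "measure ?T ?F - measure ?T (\<Union>r\<le>R. Bad r) \<le> measure ?T (?F - (\<Union>r\<le>R. Bad r))"
      by (simp add: measure_pmf.finite_measure_Diff' measure_pmf.finite_measure_mono)
    also have "\<dots> = measure ?T ((?F - (\<Union>r\<le>R. Bad r)) \<inter> set_pmf (throws N ?p))"
      by (simp add: measure_Int_set_pmf)
    also have "\<dots> \<le> measure ?T ?G"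
    proof (rule measure_pmf.finite_measure_mono)
      show "(?F - (\<Union>r\<le>R. Bad r)) \<inter> set_pmf (throws N ?p) \<subseteq> ?G"
      proof
        fix ds assume ds: "ds \<in> (?F - (\<Union>r\<le>R. Bad r)) \<inter> set_pmf (throws N ?p)"
        then have len: "length ds = N" by (auto simp: throws_def)
        obtain d where d: "d \<in> Am" "find (below K (A x)) ds = Some d" using ds by blast
        have dm: "fst d = m" and hd: "length (hash d) = H" using d(1) by (auto simp: Am_def darts_def)
        obtain i where i: "i < N" "ds ! i = d" using d(2) len by (auto simp: find_Some_iff)
        have "fst (eval (round1 ds (\<lambda>x. below K (A x)) \<l> (\<lambda>r y. below K (\<lambda>m. 2 ^ (\<kappa> + r * \<Delta>) * B y m)) R) x y) x = fst d \<and>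
           snd (eval (round1 ds (\<lambda>x. below K (A x)) \<l> (\<lambda>r y. below K (\<lambda>m. 2 ^ (\<kappa> + r * \<Delta>) * B y m)) R) x y) y = fst d \<and>
           cost (round1 ds (\<lambda>x. below K (A x)) \<l> (\<lambda>r y. below K (\<lambda>m. 2 ^ (\<kappa> + r * \<Delta>) * B y m)) R) x y \<le> \<l> r0 + r0 + 1"
        proof (rule round1[OF mono, where d = d])
          show "find (below K (A x)) ds = Some d" by (rule d)
          show "\<l> R \<le> length (hash d)" by (simp add: hd \<l>_def H)
          show "below K (\<lambda>m. 2 ^ (\<kappa> + r0 * \<Delta>) * B y m) d"
          proof -
            have "real K * A x m \<le> real K * (2 ^ (\<kappa> + r0 * \<Delta>) * B y m)" using r0(2) by (rule mult_left_mono) simp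
            then show ?thesis using d(1) dm by (auto simp: Am_def below_def)
          qed
          fix d' r assume *: "d' \<in> set ds" "r \<le> R" "below K (\<lambda>m. 2 ^ (\<kappa> + r * \<Delta>) * B y m) d'" "take (\<l> r) (hash d') = take (\<l> r) (hash d)"
          obtain j where j: "j < N" "ds ! j = d'" using *(1) len by (auto simp: in_set_conv_nth)
          show "d' = d"
          proof (rule ccontr)
            assume "d' \<noteq> d"
            then have "i \<noteq> j" using i j by auto
            moreover have "d' \<in> C r d" using * by (auto simp: C_def cB_def)
            ultimately have "ds \<in> Bad r" using i j d(1) unfolding Bad_def by blast
            then show False using ds *(2) by blast
          qed
        qed (rule r0)
        moreover have "\<l> = (\<lambda>r. \<kappa> + r * \<Delta> + 3 * s)" by (simp add: \<l>_def fun_eq_iff)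
        ultimately show "ds \<in> ?G" unfolding sampled_round_def using dm by simp
      qed
    qed simp
    finally show ?thesis by simp
  qed
  then show ?thesis .
qed

section \<open>Laws generated in rounds\<close>

definition mass1 :: "('t \<times> 'x \<times> 'y) pmf \<Rightarrow> ('t \<Rightarrow> 't) \<Rightarrow> 't \<Rightarrow> 'x \<Rightarrow> real" where
  "mass1 L \<phi> t x = measure L {z. \<phi> (fst z) = t \<and> fst (snd z) = x}"

definition mass2 :: "('t \<times> 'x \<times> 'y) pmf \<Rightarrow> ('t \<Rightarrow> 't) \<Rightarrow> 't \<Rightarrow> 'y \<Rightarrow> real" where
  "mass2 L \<phi> t y = measure L {z. \<phi> (fst z) = t \<and> snd (snd z) = y}"

lemma joint_mass_le: "joint_mass L \<phi> t x y \<le> mass1 L \<phi> t x" "joint_mass L \<phi> t x y \<le> mass2 L \<phi> t y"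
  unfolding joint_mass_def mass1_def mass2_def by (rule measure_pmf.finite_measure_mono; auto)+

lemma joint_mass_nonneg: "0 \<le> joint_mass L \<phi> t x y"
  by (simp add: joint_mass_def)

lemma mass1_sum:
  assumes "finite Y" "snd ` snd ` set_pmf L \<subseteq> Y"
  shows "mass1 L \<phi> t x = (\<Sum>y\<in>Y. joint_mass L \<phi> t x y)"
proof -
  have "mass1 L \<phi> t x = measure L (\<Union>y\<in>Y. {z. \<phi> (fst z) = t \<and> snd z = (x, y)})"
    unfolding mass1_def using assms(2)
    by (intro measure_eq_AE) (auto simp: AE_measure_pmf_iff prod_eq_iff)
  also have "\<dots> = (\<Sum>y\<in>Y. joint_mass L \<phi> t x y)"
    unfolding joint_mass_def using assms(1)
    by (intro measure_pmf.finite_measure_finite_Union) (auto simp: disjoint_family_on_def)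
  finally show ?thesis .
qed

lemma mass2_sum:
  assumes "finite X" "fst ` snd ` set_pmf L \<subseteq> X"
  shows "mass2 L \<phi> t y = (\<Sum>x\<in>X. joint_mass L \<phi> t x y)"
proof -
  have "mass2 L \<phi> t y = measure L (\<Union>x\<in>X. {z. \<phi> (fst z) = t \<and> snd z = (x, y)})"
    unfolding mass2_def using assms(2)
    by (intro measure_eq_AE) (auto simp: AE_measure_pmf_iff prod_eq_iff)
  also have "\<dots> = (\<Sum>x\<in>X. joint_mass L \<phi> t x y)"
    unfolding joint_mass_def using assms(1)
    by (intro measure_pmf.finite_measure_finite_Union) (auto simp: disjoint_family_on_def)
  finally show ?thesis .
qed

text \<open>Stated for abstract truncations \<open>\<phi>\<close>, so that it applies both to a
  single transcript cut by \<open>take\<close> and to a list of \<open>n\<close> transcripts cut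
  coordinatewise.\<close>

locale round_law =
  fixes L :: "('t::countable \<times> 'x::countable \<times> 'y::countable) pmf" and \<phi> :: "nat \<Rightarrow> 't \<Rightarrow> 't" and d :: nat
  assumes finite_inputs: "finite (snd ` set_pmf L)"
    and \<phi>_\<phi>: "\<And>k \<tau>. \<phi> k (\<phi> (Suc k) \<tau>) = \<phi> k \<tau>"
    and \<phi>_0: "\<And>\<tau> \<tau>'. \<phi> 0 \<tau> = \<phi> 0 \<tau>'"
    and \<phi>_d: "\<And>z. z \<in> set_pmf L \<Longrightarrow> \<phi> d (fst z) = fst z"
    and markov: "\<And>k. \<exists>\<kappa>. \<forall>x y t. joint_mass L (\<phi> (Suc k)) t x y =
       (if even k then \<kappa> (Inl x) t else \<kappa> (Inr y) t) * joint_mass L (\<phi> k) (\<phi> k t) x y"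
begin

definition "J k = joint_mass L (\<phi> k)"
definition "JX k = mass1 L (\<phi> k)"
definition "JY k = mass2 L (\<phi> k)"
text \<open>Conditional laws of the next history given the present one and the input of one party.
  The law of the party that sends is the true kernel, that of the other party is the receiver's
  prediction.\<close>

definition "A1 k t x = JX (Suc k) t x / JX k (\<phi> k t) x"
definition "A2 k t y = JY (Suc k) t y / JY k (\<phi> k t) y"

text \<open>The true kernel, squared, over the laws of both parties. One of the two equals the true
  kernel and cancels, leaving the ratio of the sender's law to the receiver's; the symmetric form
  makes the sum over the rounds telescope.\<close>

definition llr :: "nat \<Rightarrow> 't \<Rightarrow> 'x \<Rightarrow> 'y \<Rightarrow> real" where
  "llr k t x y = log 2 ((J (Suc k) t x y / J k (\<phi> k t) x y)\<^sup>2 / (A1 k t x * A2 k t y))"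

lemma J_nonneg [simp]: "0 \<le> J k t x y" "0 \<le> JX k t x" "0 \<le> JY k t y" "0 \<le> A1 k t x" "0 \<le> A2 k t y"
  by (simp_all add: J_def joint_mass_nonneg JX_def JY_def mass1_def mass2_def A1_def A2_def)

lemma J_le: "J k t x y \<le> JX k t x" "J k t x y \<le> JY k t y"
  by (simp_all add: J_def JX_def JY_def joint_mass_le)

lemma JX_sum: "JX k t x = (\<Sum>y\<in>snd ` snd ` set_pmf L. J k t x y)"
  and JY_sum: "JY k t y = (\<Sum>x\<in>fst ` snd ` set_pmf L. J k t x y)"
  using finite_inputs unfolding JX_def JY_def J_def by (simp_all add: mass1_sum mass2_sum)

text \<open>A kernel that does not depend on \<open>y\<close> is unchanged by summing out
  \<open>y\<close>, so it is the conditional law given \<open>x\<close> alone.\<close>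

lemma J_Suc_even:
  assumes "even k" shows "J (Suc k) t x y = A1 k t x * J k (\<phi> k t) x y"
proof -
  have "\<exists>\<kappa> :: 'x + 'y \<Rightarrow> 't \<Rightarrow> real. \<forall>x y t. J (Suc k) t x y = \<kappa> (Inl x) t * J k (\<phi> k t) x y"
    using markov[of k] assms by (simp add: J_def)
  then obtain \<kappa> :: "'x + 'y \<Rightarrow> 't \<Rightarrow> real" where \<kappa>: "\<And>x y t. J (Suc k) t x y = \<kappa> (Inl x) t * J k (\<phi> k t) x y" by blast
  have "JX (Suc k) t x = \<kappa> (Inl x) t * JX k (\<phi> k t) x"
    unfolding JX_sum \<kappa> by (simp add: sum_distrib_left)
  then show ?thesis
    using J_le(1)[of k "\<phi> k t" x y] J_nonneg(1)[of k "\<phi> k t" x y]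
    by (cases "JX k (\<phi> k t) x = 0") (simp_all add: \<kappa> A1_def)
qed

lemma J_Suc_odd:
  assumes "odd k" shows "J (Suc k) t x y = A2 k t y * J k (\<phi> k t) x y"
proof -
  have "\<exists>\<kappa> :: 'x + 'y \<Rightarrow> 't \<Rightarrow> real. \<forall>x y t. J (Suc k) t x y = \<kappa> (Inr y) t * J k (\<phi> k t) x y"
    using markov[of k] assms by (simp add: J_def)
  then obtain \<kappa> :: "'x + 'y \<Rightarrow> 't \<Rightarrow> real" where \<kappa>: "\<And>x y t. J (Suc k) t x y = \<kappa> (Inr y) t * J k (\<phi> k t) x y" by blast
  have "JY (Suc k) t y = \<kappa> (Inr y) t * JY k (\<phi> k t) y"
    unfolding JY_sum \<kappa> by (simp add: sum_distrib_left)
  then show ?thesis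
    using J_le(2)[of k "\<phi> k t" x y] J_nonneg(1)[of k "\<phi> k t" x y]
    by (cases "JY k (\<phi> k t) y = 0") (simp_all add: \<kappa> A2_def)
qed

lemma J_pos:
  assumes "(\<tau>, x, y) \<in> set_pmf L"
  shows "0 < J k (\<phi> k \<tau>) x y" "0 < JX k (\<phi> k \<tau>) x" "0 < JY k (\<phi> k \<tau>) y"
proof -
  have "measure L {(\<tau>, x, y)} \<le> J k (\<phi> k \<tau>) x y"
    unfolding J_def joint_mass_def by (rule measure_pmf.finite_measure_mono) auto
  moreover have "0 < measure L {(\<tau>, x, y)}" using assms by (simp add: measure_pmf_single pmf_positive)
  ultimately show 1: "0 < J k (\<phi> k \<tau>) x y" by linarith
  show "0 < JX k (\<phi> k \<tau>) x" "0 < JY k (\<phi> k \<tau>) y"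
    using 1 J_le[of k "\<phi> k \<tau>" x y] by linarith+
qed

lemma A_pos:
  assumes "(\<tau>, x, y) \<in> set_pmf L"
  shows "0 < A1 k (\<phi> (Suc k) \<tau>) x" "0 < A2 k (\<phi> (Suc k) \<tau>) y"
  using J_pos[OF assms] by (simp_all add: A1_def A2_def \<phi>_\<phi>)

lemma llr_even:
  assumes "even k" "(\<tau>, x, y) \<in> set_pmf L"
  shows "llr k (\<phi> (Suc k) \<tau>) x y = log 2 (A1 k (\<phi> (Suc k) \<tau>) x / A2 k (\<phi> (Suc k) \<tau>) y)"
  using J_pos[OF assms(2), of k] A_pos[OF assms(2), of k]
  by (simp add: llr_def J_Suc_even[OF assms(1)] \<phi>_\<phi> power2_eq_square)

lemma llr_odd:
  assumes "odd k" "(\<tau>, x, y) \<in> set_pmf L"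
  shows "llr k (\<phi> (Suc k) \<tau>) x y = log 2 (A2 k (\<phi> (Suc k) \<tau>) y / A1 k (\<phi> (Suc k) \<tau>) x)"
  using J_pos[OF assms(2), of k] A_pos[OF assms(2), of k]
  by (simp add: llr_def J_Suc_odd[OF assms(1)] \<phi>_\<phi> power2_eq_square)

text \<open>The indicator keeps the continuations of the party's present history. Only an inequality
  holds, since \<open>M\<close> may miss part of the support.\<close>

lemma sum_A1_le: "finite M \<Longrightarrow> (\<Sum>m\<in>M. of_bool (\<phi> k m = t) * A1 k m x) \<le> 1"
proof -
  assume M: "finite M"
  let ?M = "{m\<in>M. \<phi> k m = t}"
  have "(\<Sum>m\<in>M. of_bool (\<phi> k m = t) * A1 k m x) = (\<Sum>m\<in>?M. A1 k m x)"
    using M by (intro sum.mono_neutral_cong_right) auto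
  also have "\<dots> = (\<Sum>m\<in>?M. JX (Suc k) m x) / JX k t x"
    by (simp add: A1_def sum_divide_distrib)
  also have "\<dots> \<le> 1"
  proof -
  have "(\<Sum>m\<in>?M. JX (Suc k) m x) = measure L (\<Union>m\<in>?M. {z. \<phi> (Suc k) (fst z) = m \<and> fst (snd z) = x})"
    unfolding JX_def mass1_def using M
    by (intro measure_pmf.finite_measure_finite_Union[symmetric]) (auto simp: disjoint_family_on_def)
  also have "\<dots> \<le> JX k t x"
    unfolding JX_def mass1_def using \<phi>_\<phi> by (intro measure_pmf.finite_measure_mono) auto
  finally show ?thesis using J_nonneg(2)[of k t x] by (simp add: divide_le_eq_1 less_le)
  qed
  finally show ?thesis .
qed

lemma sum_A2_le: "finite M \<Longrightarrow> (\<Sum>m\<in>M. of_bool (\<phi> k m = t) * A2 k m y) \<le> 1"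
proof -
  assume M: "finite M"
  let ?M = "{m\<in>M. \<phi> k m = t}"
  have "(\<Sum>m\<in>M. of_bool (\<phi> k m = t) * A2 k m y) = (\<Sum>m\<in>?M. A2 k m y)"
    using M by (intro sum.mono_neutral_cong_right) auto
  also have "\<dots> = (\<Sum>m\<in>?M. JY (Suc k) m y) / JY k t y"
    by (simp add: A2_def sum_divide_distrib)
  also have "\<dots> \<le> 1"
  proof -
  have "(\<Sum>m\<in>?M. JY (Suc k) m y) = measure L (\<Union>m\<in>?M. {z. \<phi> (Suc k) (fst z) = m \<and> snd (snd z) = y})"
    unfolding JY_def mass2_def using M
    by (intro measure_pmf.finite_measure_finite_Union[symmetric]) (auto simp: disjoint_family_on_def)
  also have "\<dots> \<le> JY k t y"
    unfolding JY_def mass2_def using \<phi>_\<phi> by (intro measure_pmf.finite_measure_mono) auto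
  finally show ?thesis using J_nonneg(3)[of k t y] by (simp add: divide_le_eq_1 less_le)
  qed
  finally show ?thesis .
qed

end

section \<open>Round by round simulation\<close>

text \<open>Round \<open>k\<close> opens with a portion of \<open>\<kappa> k\<close> bits besides
  the \<open>3 * s\<close> extra ones, and up to \<open>R\<close> portions of
  \<open>\<Delta>\<close> bits follow. The darts are restricted to the histories of a finite set
  \<open>B\<close> of transcripts.\<close>

locale round_simulation = round_law L \<phi> d
  for L :: "('t::countable \<times> 'x::countable \<times> 'y::countable) pmf" and \<phi> d +
  fixes \<kappa> :: "nat \<Rightarrow> nat" and \<Delta> s R :: nat and B :: "'t set"
  assumes B: "finite B" and \<Delta>: "0 < \<Delta>" and \<delta>: "(2 * real R + 4) / 2 ^ s \<le> 1"
begin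

abbreviation "K k \<equiv> card (\<phi> (Suc k) ` B) * 2 ^ s"

text \<open>Here \<open>f x\<close> and \<open>g y\<close> are the histories that the parties have
  recovered so far. Each party admits only continuations of its own; on success the two
  coincide.\<close>

definition round_tree :: "nat \<Rightarrow> 't dart list \<Rightarrow> ('x \<Rightarrow> 't) \<times> ('y \<Rightarrow> 't) \<Rightarrow> ('x, 'y, ('x \<Rightarrow> 't) \<times> ('y \<Rightarrow> 't)) tree" where
  "round_tree k ds = (\<lambda>(f, g).
     let p1 = (\<lambda>x m. of_bool (\<phi> k m = f x) * A1 k m x); p2 = (\<lambda>y m. of_bool (\<phi> k m = g y) * A2 k m y) in
     if even k then sampled_round (K k) (\<kappa> k) \<Delta> s R p1 p2 ds
     else bind_tree (swap_tree (sampled_round (K k) (\<kappa> k) \<Delta> s R p2 p1 ds)) (\<lambda>(g', f'). Ret (f', g')))"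

definition round_darts :: "nat \<Rightarrow> 't dart list pmf" where
  "round_darts k = throws (K k) (pmf_of_set (darts (\<phi> (Suc k) ` B) (K k) (\<kappa> k + R * \<Delta> + 3 * s)))"

text \<open>The most recent round comes first.\<close>

primrec all_darts :: "nat \<Rightarrow> 't dart list list pmf" where
  "all_darts 0 = return_pmf []"
| "all_darts (Suc k) = bind_pmf (all_darts k) (\<lambda>rs. map_pmf (\<lambda>ds. ds # rs) (round_darts k))"

primrec full_tree :: "'t dart list list \<Rightarrow> ('x, 'y, ('x \<Rightarrow> 't) \<times> ('y \<Rightarrow> 't)) tree" where
  "full_tree [] = Ret (\<lambda>_. \<phi> 0 undefined, \<lambda>_. \<phi> 0 undefined)"
| "full_tree (ds # rs) = bind_tree (full_tree rs) (round_tree (length rs) ds)"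

lemma length_all_darts: "rs \<in> set_pmf (all_darts k) \<Longrightarrow> length rs = k"
  by (induction k arbitrary: rs) auto

abbreviation "\<delta> \<equiv> (2 * real R + 4) / 2 ^ s"

text \<open>The first stage in which the enlarged law of the receiver lies above the law of the
  sender; \<open>nat\<close> sends ratios below \<open>\<kappa> k\<close> to stage 0.\<close>

definition stage :: "nat \<Rightarrow> 't \<Rightarrow> 'x \<Rightarrow> 'y \<Rightarrow> nat" where
  "stage k t x y = nat \<lceil>(llr k t x y - \<kappa> k) / \<Delta>\<rceil>"

definition round_cost :: "nat \<Rightarrow> 't \<Rightarrow> 'x \<Rightarrow> 'y \<Rightarrow> nat" where
  "round_cost k t x y = \<kappa> k + stage k t x y * \<Delta> + 3 * s + stage k t x y + 1"

lemma stage: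
  assumes "llr k t x y \<le> \<kappa> k + R * \<Delta>"
  shows "stage k t x y \<le> R" "llr k t x y \<le> \<kappa> k + stage k t x y * \<Delta>"
proof -
  have "(llr k t x y - \<kappa> k) / \<Delta> \<le> R"
    using assms \<Delta> by (simp add: pos_divide_le_eq)
  then show "stage k t x y \<le> R" by (simp add: stage_def ceiling_le_iff)
  have "(llr k t x y - \<kappa> k) / \<Delta> \<le> stage k t x y"
    unfolding stage_def by linarith
  then show "llr k t x y \<le> \<kappa> k + stage k t x y * \<Delta>"
    using \<Delta> by (simp add: pos_divide_le_eq)
qed

text \<open>The overhead consists of the \<open>3 * s\<close> extra hash bits, at most
  \<open>\<Delta>\<close> for overshooting in the last portion, at most \<open>s\<close> if the
  ratio lies below the first portion, and at most \<open>R + 1\<close> reports.\<close>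

lemma round_cost_le:
  assumes "llr k t x y \<le> \<kappa> k + R * \<Delta>" "real (\<kappa> k) - real s \<le> llr k t x y"
  shows "real (round_cost k t x y) \<le> llr k t x y + real (4 * s + \<Delta> + R + 1)"
proof -
  have "real (stage k t x y) * \<Delta> \<le> max 0 (llr k t x y - \<kappa> k + \<Delta>)"
  proof (cases "llr k t x y \<le> \<kappa> k")
    case True
    then have "(llr k t x y - \<kappa> k) / \<Delta> \<le> 0" by (simp add: divide_nonpos_nonneg)
    then have "stage k t x y = 0" by (simp add: stage_def ceiling_le_iff)
    then show ?thesis by simp
  next
    case False
    then have "0 < (llr k t x y - \<kappa> k) / \<Delta>" using \<Delta> by simp
    then have "real (stage k t x y) \<le> (llr k t x y - \<kappa> k) / \<Delta> + 1" unfolding stage_def by linarith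
    then have "real (stage k t x y) * \<Delta> \<le> ((llr k t x y - \<kappa> k) / \<Delta> + 1) * \<Delta>" by (rule mult_right_mono) simp
    also have "\<dots> = llr k t x y - \<kappa> k + \<Delta>" using \<Delta> by (simp add: distrib_right)
    finally show ?thesis by simp
  qed
  moreover have "real (stage k t x y) \<le> R" using stage(1)[OF assms(1)] by simp
  ultimately show ?thesis using assms(2) unfolding round_cost_def by (simp add: max_def split: if_splits)
qed

text \<open>The law that is sampled is the sender's, which by the Markov property is the true
  kernel; the receiver's law affects only the cost and the collisions.\<close>

lemma round_tree:
  assumes L: "(\<tau>, x, y) \<in> set_pmf L" and B': "\<tau> \<in> B"
    and dens: "llr k (\<phi> (Suc k) \<tau>) x y \<le> \<kappa> k + R * \<Delta>"
    and fg: "f x = \<phi> k \<tau>" "g y = \<phi> k \<tau>"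
  shows "(1 - \<delta>) * (J (Suc k) (\<phi> (Suc k) \<tau>) x y / J k (\<phi> k \<tau>) x y) \<le> measure (round_darts k)
    {ds. fst (eval (round_tree k ds (f, g)) x y) x = \<phi> (Suc k) \<tau> \<and> snd (eval (round_tree k ds (f, g)) x y) y = \<phi> (Suc k) \<tau> \<and>
       cost (round_tree k ds (f, g)) x y \<le> round_cost k (\<phi> (Suc k) \<tau>) x y}"
proof -
  let ?m = "\<phi> (Suc k) \<tau>" and ?M = "\<phi> (Suc k) ` B"
  let ?p1 = "\<lambda>x m. of_bool (\<phi> k m = f x) * A1 k m x" and ?p2 = "\<lambda>y m. of_bool (\<phi> k m = g y) * A2 k m y"
  note A = A_pos[OF L, of k] and J = J_pos(1)[OF L, of k]
  have M: "finite ?M" "?m \<in> ?M" using B B' by auto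
  have p: "?p1 x ?m = A1 k ?m x" "?p2 y ?m = A2 k ?m y" using fg by (simp_all add: \<phi>_\<phi>)
  note st = stage[OF dens]
  show ?thesis
  proof (cases "even k")
    case True
    have "A1 k ?m x / A2 k ?m y = 2 powr llr k ?m x y"
      using A by (simp add: llr_even[OF True L])
    also have "\<dots> \<le> 2 powr (\<kappa> k + stage k ?m x y * \<Delta>)" using st(2) by (intro powr_mono) auto
    also have "\<dots> = 2 ^ (\<kappa> k + stage k ?m x y * \<Delta>)"
      by (subst powr_realpow[symmetric]) simp_all
    finally have "?p1 x ?m \<le> 2 ^ (\<kappa> k + stage k ?m x y * \<Delta>) * ?p2 y ?m"
      unfolding p using A by (simp add: pos_divide_le_eq)
    from sampled_round[OF M(1) refl refl refl, where A = ?p1 and B = ?p2, OF _ _ _ _ M(2) st(1) this]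
    have "A1 k ?m x * (1 - \<delta>) \<le> measure (round_darts k) {ds. fst (eval (round_tree k ds (f, g)) x y) x = ?m \<and>
        snd (eval (round_tree k ds (f, g)) x y) y = ?m \<and> cost (round_tree k ds (f, g)) x y \<le> round_cost k ?m x y}"
      unfolding p using sum_A1_le[OF M(1)] sum_A2_le[OF M(1)] True
      by (simp add: round_tree_def round_darts_def round_cost_def)
    moreover have "(1 - \<delta>) * (J (Suc k) ?m x y / J k (\<phi> k \<tau>) x y) = A1 k ?m x * (1 - \<delta>)"
      using J True by (simp add: J_Suc_even \<phi>_\<phi>)
    ultimately show ?thesis by simp
  next
    case False
    have "A2 k ?m y / A1 k ?m x = 2 powr llr k ?m x y"
      using A by (simp add: llr_odd[OF False L])
    also have "\<dots> \<le> 2 powr (\<kappa> k + stage k ?m x y * \<Delta>)" using st(2) by (intro powr_mono) auto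
    also have "\<dots> = 2 ^ (\<kappa> k + stage k ?m x y * \<Delta>)"
      by (subst powr_realpow[symmetric]) simp_all
    finally have "?p2 y ?m \<le> 2 ^ (\<kappa> k + stage k ?m x y * \<Delta>) * ?p1 x ?m"
      unfolding p using A by (simp add: pos_divide_le_eq)
    from sampled_round[OF M(1) refl refl refl, where A = ?p2 and B = ?p1, OF _ _ _ _ M(2) st(1) this]
    have "A2 k ?m y * (1 - \<delta>) \<le> measure (round_darts k) {ds. fst (eval (round_tree k ds (f, g)) x y) x = ?m \<and>
        snd (eval (round_tree k ds (f, g)) x y) y = ?m \<and> cost (round_tree k ds (f, g)) x y \<le> round_cost k ?m x y}"
      unfolding p using sum_A1_le[OF M(1)] sum_A2_le[OF M(1)] False
      by (simp add: round_tree_def round_darts_def round_cost_def case_prod_beta conj_commute conj_left_commute)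
    moreover have "(1 - \<delta>) * (J (Suc k) ?m x y / J k (\<phi> k \<tau>) x y) = A2 k ?m y * (1 - \<delta>)"
      using J False by (simp add: J_Suc_odd \<phi>_\<phi>)
    ultimately show ?thesis by simp
  qed
qed

lemma measure_bind_ge:
  fixes p :: "'c pmf" and f :: "'c \<Rightarrow> 'd pmf"
  assumes "\<And>a. a \<in> S \<Longrightarrow> a \<in> set_pmf p \<Longrightarrow> c \<le> measure (f a) E" "0 \<le> c"
  shows "measure p S * c \<le> measure (bind_pmf p f) E"
proof -
  have "ennreal (measure p S * c) = (\<integral>\<^sup>+a. indicator S a * ennreal c \<partial>p)"
    using assms(2) by (simp add: nn_integral_multc measure_pmf.emeasure_eq_measure ennreal_mult)
  also have "\<dots> \<le> (\<integral>\<^sup>+a. emeasure (f a) E \<partial>p)"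
    using assms by (intro nn_integral_mono_AE) (auto simp: AE_measure_pmf_iff measure_pmf.emeasure_eq_measure indicator_def)
  also have "\<dots> = ennreal (measure (bind_pmf p f) E)"
    by (simp only: emeasure_bind_pmf[symmetric] measure_pmf.emeasure_eq_measure[symmetric])
  finally show ?thesis by simp
qed

text \<open>Every round uses fresh darts, so the lower bounds multiply, and the kernels multiply to
  the law of the history given the inputs.\<close>

lemma full_tree:
  assumes L: "(\<tau>, x, y) \<in> set_pmf L" and B': "\<tau> \<in> B"
    and dens: "\<And>j. j < k \<Longrightarrow> llr j (\<phi> (Suc j) \<tau>) x y \<le> \<kappa> j + R * \<Delta>"
  shows "(1 - \<delta>) ^ k * (J k (\<phi> k \<tau>) x y / J 0 (\<phi> 0 \<tau>) x y) \<le> measure (all_darts k)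
    {rs. fst (eval (full_tree rs) x y) x = \<phi> k \<tau> \<and> snd (eval (full_tree rs) x y) y = \<phi> k \<tau> \<and>
       cost (full_tree rs) x y \<le> (\<Sum>j<k. round_cost j (\<phi> (Suc j) \<tau>) x y)}"
    (is "_ \<le> measure _ (?G k)")
  using dens
proof (induction k)
  case 0
  then show ?case
    using J_pos(1)[OF L, of 0] \<phi>_0[of undefined \<tau>] by simp
next
  case (Suc k)
  have "(1 - \<delta>) ^ Suc k * (J (Suc k) (\<phi> (Suc k) \<tau>) x y / J 0 (\<phi> 0 \<tau>) x y) =
     ((1 - \<delta>) ^ k * (J k (\<phi> k \<tau>) x y / J 0 (\<phi> 0 \<tau>) x y)) * ((1 - \<delta>) * (J (Suc k) (\<phi> (Suc k) \<tau>) x y / J k (\<phi> k \<tau>) x y))"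
    using J_pos(1)[OF L, of k] by simp
  also have "\<dots> \<le> measure (all_darts k) (?G k) * ((1 - \<delta>) * (J (Suc k) (\<phi> (Suc k) \<tau>) x y / J k (\<phi> k \<tau>) x y))"
    using Suc.IH Suc.prems \<delta> by (intro mult_right_mono) auto
  also have "\<dots> \<le> measure (all_darts (Suc k)) (?G (Suc k))"
    unfolding all_darts.simps
  proof (rule measure_bind_ge)
    show "0 \<le> (1 - \<delta>) * (J (Suc k) (\<phi> (Suc k) \<tau>) x y / J k (\<phi> k \<tau>) x y)" using \<delta> by simp
    fix rs assume rs: "rs \<in> ?G k" "rs \<in> set_pmf (all_darts k)"
    obtain f g where fg: "eval (full_tree rs) x y = (f, g)" by fastforce
    have "(1 - \<delta>) * (J (Suc k) (\<phi> (Suc k) \<tau>) x y / J k (\<phi> k \<tau>) x y) \<le> measure (round_darts k)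
    {ds. fst (eval (round_tree k ds (f, g)) x y) x = \<phi> (Suc k) \<tau> \<and> snd (eval (round_tree k ds (f, g)) x y) y = \<phi> (Suc k) \<tau> \<and>
       cost (round_tree k ds (f, g)) x y \<le> round_cost k (\<phi> (Suc k) \<tau>) x y}"
      using rs fg Suc.prems by (intro round_tree[OF L B']) auto
    also have "\<dots> \<le> measure (round_darts k) ((\<lambda>ds. ds # rs) -` ?G (Suc k))"
      using rs length_all_darts[OF rs(2)] by (intro measure_pmf.finite_measure_mono) (auto simp: fg)
    finally show "(1 - \<delta>) * (J (Suc k) (\<phi> (Suc k) \<tau>) x y / J k (\<phi> k \<tau>) x y) \<le> measure (map_pmf (\<lambda>ds. ds # rs) (round_darts k)) (?G (Suc k))"
      by simp
  qed
  finally show ?case .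
qed

text \<open>One-shot achievability. As \<open>J 0\<close> is the law of the inputs and
  \<open>J d\<close> that of the transcript with the inputs, \<open>full_tree\<close> bounds the
  success probability below by a constant times the conditional law of the transcript, the form
  required by \<open>simulation_by_trees\<close>.\<close>

theorem min_sim_length_le:
  assumes G: "\<And>\<tau> x y. (\<tau>, x, y) \<in> G \<Longrightarrow> (\<tau>, x, y) \<in> set_pmf L \<and> \<tau> \<in> B \<and>
      (\<forall>k<d. real (\<kappa> k) - real s \<le> llr k (\<phi> (Suc k) \<tau>) x y \<and> llr k (\<phi> (Suc k) \<tau>) x y \<le> \<kappa> k + R * \<Delta>) \<and>
      (\<Sum>k<d. llr k (\<phi> (Suc k) \<tau>) x y) + real d * real (4 * s + \<Delta> + R + 1) \<le> real l"
    and \<epsilon>: "1 - \<epsilon> \<le> (1 - \<delta>) ^ d * measure L G"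
  shows "min_sim_length \<epsilon> (map_pmf snd L) (measure_pmf L) \<le> enat l"
proof (rule simulation_by_trees[where T = full_tree and \<mu> = "all_darts d" and G = G and c = "(1 - \<delta>) ^ d"])
  show "(1 - \<delta>) ^ d \<le> 1" using \<delta> by (intro power_le_one) auto
  fix \<tau> x y assume g: "(\<tau>, x, y) \<in> G"
  note G' = G[OF g]
  have L: "(\<tau>, x, y) \<in> set_pmf L" using G' by blast
  have J0: "J 0 (\<phi> 0 \<tau>) x y = pmf (map_pmf snd L) (x, y)"
    using \<phi>_0 by (simp add: J_def joint_mass_def pmf_map vimage_def)
  have "\<phi> d (fst z) = \<tau> \<longleftrightarrow> fst z = \<tau>" if "z \<in> set_pmf L" for z
    using \<phi>_d[OF that] by simp
  then have Jd: "J d \<tau> x y = pmf L (\<tau>, x, y)"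
    unfolding J_def joint_mass_def pmf.rep_eq
    by (intro measure_eq_AE) (auto simp: AE_measure_pmf_iff prod_eq_iff)
  have \<phi>d: "\<phi> d \<tau> = \<tau>" using \<phi>_d[OF L] by simp
  have cost: "(\<Sum>j<d. round_cost j (\<phi> (Suc j) \<tau>) x y) \<le> l"
  proof -
    have "real (\<Sum>j<d. round_cost j (\<phi> (Suc j) \<tau>) x y) \<le> (\<Sum>j<d. llr j (\<phi> (Suc j) \<tau>) x y + real (4 * s + \<Delta> + R + 1))"
      unfolding of_nat_sum using G' by (intro sum_mono round_cost_le) auto
    also have "\<dots> = (\<Sum>k<d. llr k (\<phi> (Suc k) \<tau>) x y) + real d * real (4 * s + \<Delta> + R + 1)"
      by (simp add: sum.distrib)
    also have "\<dots> \<le> l" using G' by blast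
    finally show ?thesis by linarith
  qed
  have "(1 - \<delta>) ^ d * pmf L (\<tau>, x, y) = pmf (map_pmf snd L) (x, y) * ((1 - \<delta>) ^ d * (J d (\<phi> d \<tau>) x y / J 0 (\<phi> 0 \<tau>) x y))"
    using J_pos(1)[OF L, of 0] by (simp add: J0 Jd \<phi>d)
  also have "\<dots> \<le> pmf (map_pmf snd L) (x, y) * measure (all_darts d)
    {rs. fst (eval (full_tree rs) x y) x = \<phi> d \<tau> \<and> snd (eval (full_tree rs) x y) y = \<phi> d \<tau> \<and>
       cost (full_tree rs) x y \<le> (\<Sum>j<d. round_cost j (\<phi> (Suc j) \<tau>) x y)}"
    using G' by (intro mult_left_mono full_tree[OF L]) auto
  also have "\<dots> \<le> pmf (map_pmf snd L) (x, y) * tree_success (all_darts d) l full_tree \<tau> x y"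
    unfolding tree_success_def \<phi>d using cost
    by (intro mult_left_mono measure_pmf.finite_measure_mono) auto
  finally show "(1 - \<delta>) ^ d * pmf L (\<tau>, x, y) \<le> pmf (map_pmf snd L) (x, y) * tree_success (all_darts d) l full_tree \<tau> x y" .
qed (use \<epsilon> in auto)

end

section \<open>Converse: a one-shot bound on the overlap of the true and the simulated law\<close>

section \<open>Overlap of a law with the outputs of a short protocol\<close>

text \<open>
  Given the public randomness \<open>u\<close>, a transcript \<open>t\<close> and an output \<open>\<tau>\<close> of both parties occur with
  probability \<open>a u x t \<tau> * b u y t \<tau>\<close>. The weights \<open>wX t\<close> and \<open>wY t\<close> are one half to the power of the
  number of bits of Party 1 and of Party 2 in \<open>t\<close>.
\<close>

locale overlap =
  fixes U :: "'u measure" and a :: "'u \<Rightarrow> 'x \<Rightarrow> 't \<Rightarrow> 'o \<Rightarrow> real" and b :: "'u \<Rightarrow> 'y \<Rightarrow> 't \<Rightarrow> 'o \<Rightarrow> real"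
    and X :: "'x set" and Y :: "'y set" and T :: "'t set" and F :: "'o set"
    and p :: "'x \<Rightarrow> 'y \<Rightarrow> real" and P :: "'x \<Rightarrow> 'y \<Rightarrow> 'o \<Rightarrow> real"
    and wX wY :: "'t \<Rightarrow> real" and W S :: real
  assumes prob_space: "prob_space U"
    and fin: "finite X" "finite Y" "finite T" "finite F"
    and a_meas: "\<And>x t \<tau>. (\<lambda>u. a u x t \<tau>) \<in> borel_measurable U"
    and b_meas: "\<And>y t \<tau>. (\<lambda>u. b u y t \<tau>) \<in> borel_measurable U"
    and a_bounds: "\<And>u x t \<tau>. 0 \<le> a u x t \<tau>" "\<And>u x t \<tau>. a u x t \<tau> \<le> 1"
    and b_bounds: "\<And>u y t \<tau>. 0 \<le> b u y t \<tau>" "\<And>u y t \<tau>. b u y t \<tau> \<le> 1"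
    and p_nonneg: "\<And>x y. 0 \<le> p x y" and p_le: "(\<Sum>x\<in>X. \<Sum>y\<in>Y. p x y) \<le> 1"
    and P_nonneg: "\<And>x y \<tau>. 0 \<le> P x y \<tau>" and P_le: "(\<Sum>x\<in>X. \<Sum>y\<in>Y. \<Sum>\<tau>\<in>F. P x y \<tau>) \<le> 1"
    and w_nonneg: "\<And>t. 0 \<le> wX t" "\<And>t. 0 \<le> wY t" and W: "0 < W" and S: "0 < S"
    and kraft_a: "\<And>u x. u \<in> space U \<Longrightarrow> (\<Sum>\<tau>\<in>F. \<Sum>t\<in>T. wY t * a u x t \<tau>) \<le> 1"
    and kraft_b: "\<And>u y. u \<in> space U \<Longrightarrow> (\<Sum>\<tau>\<in>F. \<Sum>t\<in>T. wX t * b u y t \<tau>) \<le> 1"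
    and W_le: "\<And>u x y t \<tau>. u \<in> space U \<Longrightarrow> p x y > 0 \<Longrightarrow> t \<in> T \<Longrightarrow> a u x t \<tau> * b u y t \<tau> > 0 \<Longrightarrow> W \<le> wX t * wY t"
begin

sublocale prob_space U by (rule prob_space)

definition "Q x y \<tau> = p x y * (\<integral>u. (\<Sum>t\<in>T. a u x t \<tau> * b u y t \<tau>) \<partial>U)"
definition "pX x = (\<Sum>y\<in>Y. p x y)"
definition "pY y = (\<Sum>x\<in>X. p x y)"
definition "A u y t \<tau> = (\<Sum>x\<in>X. p x y * a u x t \<tau>)"
definition "B u x t \<tau> = (\<Sum>y\<in>Y. p x y * b u y t \<tau>)"
text \<open>\<open>A u y t \<tau> / pY y\<close> is the conditional mean of \<open>a\<close> given
  \<open>y\<close>. It is compared with \<open>wX t\<close>, the weight of the bits that Party 1 has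
  sent.\<close>

definition "badA u y t \<tau> \<longleftrightarrow> A u y t \<tau> < wX t * pY y / S"
definition "badB u x t \<tau> \<longleftrightarrow> B u x t \<tau> < wY t * pX x / S"
definition "QA x y \<tau> = (\<integral>u. (\<Sum>t\<in>T. p x y * (a u x t \<tau> * b u y t \<tau>) * of_bool (badA u y t \<tau>)) \<partial>U)"
definition "QB x y \<tau> = (\<integral>u. (\<Sum>t\<in>T. p x y * (a u x t \<tau> * b u y t \<tau>) * of_bool (badB u x t \<tau>)) \<partial>U)"
definition "Q1 x \<tau> = (\<Sum>y\<in>Y. Q x y \<tau>)"
definition "Q2 y \<tau> = (\<Sum>x\<in>X. Q x y \<tau>)"
definition "P1 x \<tau> = (\<Sum>y\<in>Y. P x y \<tau>)"
definition "P2 y \<tau> = (\<Sum>x\<in>X. P x y \<tau>)"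

lemma ab_bounds: "0 \<le> a u x t \<tau> * b u y t \<tau>" "a u x t \<tau> * b u y t \<tau> \<le> 1"
  using a_bounds b_bounds by (auto intro: mult_le_one)

lemma pXY_nonneg: "0 \<le> pX x" "0 \<le> pY y"
  by (auto simp: pX_def pY_def p_nonneg sum_nonneg)

lemma A_nonneg: "0 \<le> A u y t \<tau>" and B_nonneg: "0 \<le> B u x t \<tau>"
  by (auto simp: A_def B_def p_nonneg a_bounds b_bounds sum_nonneg)

lemma A_meas [measurable]: "(\<lambda>u. A u y t \<tau>) \<in> borel_measurable U"
  and B_meas [measurable]: "(\<lambda>u. B u x t \<tau>) \<in> borel_measurable U"
  unfolding A_def B_def by (intro borel_measurable_sum borel_measurable_times a_meas b_meas borel_measurable_const)+

lemma bounded_integrable: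
  assumes "f \<in> borel_measurable U" "\<And>u. \<bar>f u\<bar> \<le> c"
  shows "integrable U (f :: 'u \<Rightarrow> real)"
  using assms by (intro integrable_const_bound[where B = c]) auto

lemma ab_integrable: "integrable U (\<lambda>u. a u x t \<tau> * b u y t \<tau>)"
  using a_meas b_meas ab_bounds by (intro bounded_integrable[where c = 1]) auto

lemma bad_integrable:
  "integrable U (\<lambda>u. p x y * (a u x t \<tau> * b u y t \<tau>) * of_bool (badA u y t \<tau>))"
  "integrable U (\<lambda>u. p x y * (a u x t \<tau> * b u y t \<tau>) * of_bool (badB u x t \<tau>))"
proof -
  note [measurable] = a_meas b_meas
  have m: "(\<lambda>u. of_bool (badA u y t \<tau>) :: real) \<in> borel_measurable U" "(\<lambda>u. of_bool (badB u x t \<tau>) :: real) \<in> borel_measurable U"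
    unfolding badA_def badB_def by measurable
  have b: "\<bar>p x y * (a u x t \<tau> * b u y t \<tau>) * of_bool c\<bar> \<le> p x y" for u c
    using mult_left_mono[OF ab_bounds(2) p_nonneg, of x y u x t \<tau> y] ab_bounds(1)[of u x t \<tau> y] p_nonneg[of x y]
    by (cases c) auto
  show "integrable U (\<lambda>u. p x y * (a u x t \<tau> * b u y t \<tau>) * of_bool (badA u y t \<tau>))"
  "integrable U (\<lambda>u. p x y * (a u x t \<tau> * b u y t \<tau>) * of_bool (badB u x t \<tau>))"
    using b m by (intro bounded_integrable[where c = "p x y"]; measurable)+
qed

text \<open>On the bad event the mean of \<open>a\<close> is replaced by its bound
  \<open>wX t / S\<close>. What remains is a sum of \<open>wX t * b\<close>, which Kraft's
  inequality from the view of Party 2 bounds by one.\<close>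

lemma sum_QA_le: "(\<Sum>x\<in>X. \<Sum>y\<in>Y. \<Sum>\<tau>\<in>F. QA x y \<tau>) \<le> 1 / S"
proof -
  have "(\<Sum>x\<in>X. \<Sum>y\<in>Y. \<Sum>\<tau>\<in>F. QA x y \<tau>) =
      (\<integral>u. (\<Sum>x\<in>X. \<Sum>y\<in>Y. \<Sum>\<tau>\<in>F. \<Sum>t\<in>T. p x y * (a u x t \<tau> * b u y t \<tau>) * of_bool (badA u y t \<tau>)) \<partial>U)"
    unfolding QA_def by (simp add: Bochner_Integration.integral_sum bad_integrable)
  also have "\<dots> \<le> (\<integral>u. 1 / S \<partial>U)"
  proof (rule integral_mono)
    show "integrable U (\<lambda>u. (\<Sum>x\<in>X. \<Sum>y\<in>Y. \<Sum>\<tau>\<in>F. \<Sum>t\<in>T. p x y * (a u x t \<tau> * b u y t \<tau>) * of_bool (badA u y t \<tau>)))"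
      by (intro Bochner_Integration.integrable_sum bad_integrable)
    fix u assume u: "u \<in> space U"
    \<comment> \<open>The sum over \<open>x\<close> is moved inside because neither \<open>b\<close>
      nor \<open>badA\<close> depends on \<open>x\<close>; it turns \<open>a\<close> into
      \<open>A\<close>.\<close>
    have "(\<Sum>x\<in>X. \<Sum>y\<in>Y. \<Sum>\<tau>\<in>F. \<Sum>t\<in>T. p x y * (a u x t \<tau> * b u y t \<tau>) * of_bool (badA u y t \<tau>)) =
       (\<Sum>y\<in>Y. \<Sum>\<tau>\<in>F. \<Sum>t\<in>T. \<Sum>x\<in>X. p x y * (a u x t \<tau> * b u y t \<tau>) * of_bool (badA u y t \<tau>))"
      by (simp only: sum.swap[where A = X])
    also have "\<dots> = (\<Sum>y\<in>Y. \<Sum>\<tau>\<in>F. \<Sum>t\<in>T. A u y t \<tau> * (b u y t \<tau> * of_bool (badA u y t \<tau>)))"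
      by (simp add: A_def sum_distrib_left mult_ac)
    also have "\<dots> \<le> (\<Sum>y\<in>Y. \<Sum>\<tau>\<in>F. \<Sum>t\<in>T. pY y / S * (wX t * b u y t \<tau>))"
    proof (intro sum_mono)
      fix y \<tau> t
      show "A u y t \<tau> * (b u y t \<tau> * of_bool (badA u y t \<tau>)) \<le> pY y / S * (wX t * b u y t \<tau>)"
      proof (cases "badA u y t \<tau>")
        case True
        then have "A u y t \<tau> * b u y t \<tau> \<le> (wX t * pY y / S) * b u y t \<tau>"
          unfolding badA_def using b_bounds(1) by (intro mult_right_mono) auto
        then show ?thesis using True by (simp add: mult_ac)
      qed (use S b_bounds pXY_nonneg w_nonneg in auto)
    qed
    also have "\<dots> = (\<Sum>y\<in>Y. pY y / S * (\<Sum>\<tau>\<in>F. \<Sum>t\<in>T. wX t * b u y t \<tau>))"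
      by (simp add: sum_distrib_left)
    also have "\<dots> \<le> (\<Sum>y\<in>Y. pY y / S * 1)"
      using kraft_b[OF u] pXY_nonneg S by (intro sum_mono mult_left_mono) auto
    also have "\<dots> = (\<Sum>x\<in>X. \<Sum>y\<in>Y. p x y) / S"
      unfolding pY_def by (subst sum.swap) (simp add: sum_divide_distrib)
    also have "\<dots> \<le> 1 / S" using p_le S by (simp add: divide_right_mono)
    finally show "(\<Sum>x\<in>X. \<Sum>y\<in>Y. \<Sum>\<tau>\<in>F. \<Sum>t\<in>T. p x y * (a u x t \<tau> * b u y t \<tau>) * of_bool (badA u y t \<tau>)) \<le> 1 / S" .
  qed simp
  finally show ?thesis by (simp add: prob_space)
qed

text \<open>The assumptions are symmetric in the parties, so each bound for one side yields the
  other.\<close>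

lemma swapped: "overlap U b a Y X T F (\<lambda>y x. p x y) (\<lambda>y x. P x y) wY wX W S"
proof unfold_locales
  show "(\<Sum>y\<in>Y. \<Sum>x\<in>X. p x y) \<le> 1" using p_le by (subst sum.swap)
  show "(\<Sum>y\<in>Y. \<Sum>x\<in>X. \<Sum>\<tau>\<in>F. P x y \<tau>) \<le> 1" using P_le by (subst sum.swap)
  show "W \<le> wY t * wX t" if "u \<in> space U" "p x y > 0" "t \<in> T" "b u y t \<tau> * a u x t \<tau> > 0" for u x y t \<tau>
    using W_le[of u x y t \<tau>] that by (simp add: mult.commute)
qed (rule fin a_meas b_meas a_bounds b_bounds p_nonneg P_nonneg w_nonneg W S kraft_a kraft_b; assumption)+

lemma swapped_defs:
  "overlap.Q U b a T (\<lambda>y x. p x y) y x \<tau> = Q x y \<tau>"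
  "overlap.B a X (\<lambda>y x. p x y) u y t \<tau> = A u y t \<tau>"
  "overlap.QA U b a Y T (\<lambda>y x. p x y) wY S y x \<tau> = QB x y \<tau>"
  "overlap.Q1 U b a X T (\<lambda>y x. p x y) y \<tau> = Q2 y \<tau>"
  "overlap.P1 X (\<lambda>y x. P x y) y \<tau> = P2 y \<tau>"
proof -
  interpret swap: overlap U b a Y X T F "\<lambda>y x. p x y" "\<lambda>y x. P x y" wY wX W S by (rule swapped)
  have ba: "b u y t \<tau> * a u x t \<tau> = a u x t \<tau> * b u y t \<tau>" for u x y t \<tau> by (rule mult.commute)
  show Q: "swap.Q y x \<tau> = Q x y \<tau>" for x y by (simp only: swap.Q_def Q_def ba)
  show "swap.B u y t \<tau> = A u y t \<tau>" by (simp only: swap.B_def A_def)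
  show "swap.QA y x \<tau> = QB x y \<tau>"
    by (simp only: swap.QA_def QB_def swap.badA_def badB_def swap.A_def B_def swap.pY_def pX_def ba)
  show "swap.Q1 y \<tau> = Q2 y \<tau>" by (simp only: swap.Q1_def Q2_def Q)
  show "swap.P1 y \<tau> = P2 y \<tau>" by (simp only: swap.P1_def P2_def)
qed

lemma sum_QB_le: "(\<Sum>x\<in>X. \<Sum>y\<in>Y. \<Sum>\<tau>\<in>F. QB x y \<tau>) \<le> 1 / S"
  using overlap.sum_QA_le[OF swapped] unfolding swapped_defs by (subst sum.swap)

text \<open>Linear in \<open>r\<close> and \<open>s\<close> for every \<open>\<theta>\<close>, so
  that it can be integrated over the public randomness before \<open>\<theta>\<close> is
  chosen.\<close>

lemma arith_geo_mean_weighted: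
  fixes r s \<theta> :: real
  assumes "0 \<le> r" "0 \<le> s" "0 < \<theta>"
  shows "2 * sqrt (r * s) \<le> \<theta> * r + s / \<theta>"
proof -
  have "2 * sqrt ((\<theta> * r) * (s / \<theta>)) \<le> \<theta> * r + s / \<theta>"
    using arith_geo_mean_sqrt[of "\<theta> * r" "s / \<theta>"] assms by simp
  then show ?thesis using assms by simp
qed

text \<open>Off the bad events the product of the two means is at least
  \<open>W / S\<^sup>2\<close>, so the square root of \<open>a * b\<close> is bounded by that of
  \<open>(a * B / pX) * (b * A / pY)\<close> up to \<open>S / sqrt W\<close>. The root may be
  inserted on the left because \<open>a * b \<le> 1\<close>.\<close>

lemma pointwise:
  assumes u: "u \<in> space U" and t: "t \<in> T" and x: "x \<in> X" and y: "y \<in> Y" and p: "p x y > 0" and \<theta>: "0 < \<theta>"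
  shows "a u x t \<tau> * b u y t \<tau> \<le> a u x t \<tau> * b u y t \<tau> * of_bool (badA u y t \<tau>) + a u x t \<tau> * b u y t \<tau> * of_bool (badB u x t \<tau>)
     + S / (2 * sqrt W) * (\<theta> * (a u x t \<tau> * B u x t \<tau> / pX x) + (b u y t \<tau> * A u y t \<tau> / pY y) / \<theta>)"
proof -
  have pXp: "pX x > 0" "pY y > 0"
    using p x y fin member_le_sum[of y Y "\<lambda>y. p x y"] member_le_sum[of x X "\<lambda>x. p x y"] p_nonneg
    unfolding pX_def pY_def by (auto intro: less_le_trans)
  let ?a = "a u x t \<tau>" and ?b = "b u y t \<tau>" and ?A = "A u y t \<tau>" and ?B = "B u x t \<tau>"
  let ?m = "S / (2 * sqrt W) * (\<theta> * (?a * ?B / pX x) + (?b * ?A / pY y) / \<theta>)"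
  have m0: "0 \<le> ?m"
    using S W \<theta> a_bounds b_bounds A_nonneg B_nonneg pXp by (intro mult_nonneg_nonneg add_nonneg_nonneg divide_nonneg_nonneg) auto
  show ?thesis
  proof (cases "badA u y t \<tau> \<or> badB u x t \<tau> \<or> ?a * ?b = 0")
    case True
    then show ?thesis using m0 ab_bounds(1)[of u x t \<tau> y] by auto
  next
    case False
    then have pos: "?a * ?b > 0" using ab_bounds(1)[of u x t \<tau> y] by linarith
    have "wX t * pY y / S \<le> ?A" "wY t * pX x / S \<le> ?B"
      using False by (auto simp: badA_def badB_def)
    then have "wX t / S \<le> ?A / pY y" "wY t / S \<le> ?B / pX x"
      using pXp by (simp_all add: pos_le_divide_eq field_simps)
    then have "(wX t / S) * (wY t / S) \<le> (?A / pY y) * (?B / pX x)"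
      using w_nonneg S A_nonneg pXp by (intro mult_mono) (auto intro: divide_nonneg_nonneg)
    moreover have "W / S\<^sup>2 \<le> (wX t / S) * (wY t / S)"
      using W_le[OF u p t pos] S by (simp add: power2_eq_square divide_right_mono)
    ultimately have "W / S\<^sup>2 \<le> (?A / pY y) * (?B / pX x)" by linarith
    then have "?a * ?b * (W / S\<^sup>2) \<le> (?a * ?B / pX x) * (?b * ?A / pY y)"
      using mult_left_mono[of "W / S\<^sup>2" "(?A / pY y) * (?B / pX x)" "?a * ?b"] ab_bounds(1)[of u x t \<tau> y] by (simp add: mult_ac)
    then have "sqrt (?a * ?b * (W / S\<^sup>2)) \<le> sqrt ((?a * ?B / pX x) * (?b * ?A / pY y))" by simp
    moreover have "sqrt (?a * ?b * (W / S\<^sup>2)) = sqrt (?a * ?b) * (sqrt W / S)"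
      using S by (simp add: real_sqrt_mult real_sqrt_divide)
    moreover have "?a * ?b \<le> sqrt (?a * ?b)"
      using ab_bounds[of u x t \<tau> y] by (intro real_le_rsqrt) (simp add: power2_eq_square mult_left_le)
    moreover from this have "?a * ?b * (sqrt W / S) \<le> sqrt (?a * ?b) * (sqrt W / S)"
      using S W by (intro mult_right_mono) auto
    ultimately have "?a * ?b * (sqrt W / S) \<le> sqrt ((?a * ?B / pX x) * (?b * ?A / pY y))"
      by linarith
    also have "\<dots> \<le> (\<theta> * (?a * ?B / pX x) + (?b * ?A / pY y) / \<theta>) / 2"
      using arith_geo_mean_weighted[of "?a * ?B / pX x" "?b * ?A / pY y" \<theta>] \<theta> a_bounds b_bounds A_nonneg B_nonneg pXp
      by (simp add: mult_ac)
    finally have "?a * ?b * (sqrt W / S) * (S / sqrt W) \<le> (\<theta> * (?a * ?B / pX x) + (?b * ?A / pY y) / \<theta>) / 2 * (S / sqrt W)"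
      using S W by (intro mult_right_mono) auto
    then have "?a * ?b \<le> ?m" using S W by (simp add: mult_ac)
    then show ?thesis using False by simp
  qed
qed

text \<open>Once integrated and summed over \<open>t\<close>, the linear terms of
  \<open>pointwise\<close> are marginals of the simulated law \<open>Q\<close>.\<close>

lemma Q1_integral: "Q1 x \<tau> = (\<integral>u. (\<Sum>t\<in>T. a u x t \<tau> * B u x t \<tau>) \<partial>U)"
  and Q1_integrable: "integrable U (\<lambda>u. a u x t \<tau> * B u x t \<tau>)"
proof -
  have eq: "a u x t \<tau> * B u x t \<tau> = (\<Sum>y\<in>Y. p x y * (a u x t \<tau> * b u y t \<tau>))" for u t
    by (simp add: B_def sum_distrib_left mult_ac)
  show "integrable U (\<lambda>u. a u x t \<tau> * B u x t \<tau>)"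
    unfolding eq by (intro Bochner_Integration.integrable_sum integrable_mult_right ab_integrable)
  have "Q1 x \<tau> = (\<Sum>y\<in>Y. \<Sum>t\<in>T. p x y * (\<integral>u. a u x t \<tau> * b u y t \<tau> \<partial>U))"
    unfolding Q1_def Q_def by (simp add: Bochner_Integration.integral_sum ab_integrable sum_distrib_left)
  also have "\<dots> = (\<Sum>t\<in>T. \<Sum>y\<in>Y. p x y * (\<integral>u. a u x t \<tau> * b u y t \<tau> \<partial>U))" by (rule sum.swap)
  also have "\<dots> = (\<integral>u. (\<Sum>t\<in>T. a u x t \<tau> * B u x t \<tau>) \<partial>U)"
    unfolding eq by (simp add: Bochner_Integration.integral_sum ab_integrable integrable_mult_right)
  finally show "Q1 x \<tau> = (\<integral>u. (\<Sum>t\<in>T. a u x t \<tau> * B u x t \<tau>) \<partial>U)" .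
qed

lemma Q2_integral: "Q2 y \<tau> = (\<integral>u. (\<Sum>t\<in>T. b u y t \<tau> * A u y t \<tau>) \<partial>U)"
  and Q2_integrable: "integrable U (\<lambda>u. b u y t \<tau> * A u y t \<tau>)"
  using overlap.Q1_integral[OF swapped] overlap.Q1_integrable[OF swapped] unfolding swapped_defs .

lemma Q_le:
  assumes x: "x \<in> X" and y: "y \<in> Y" and p: "p x y > 0" and \<theta>: "0 < \<theta>"
  shows "Q x y \<tau> \<le> QA x y \<tau> + QB x y \<tau> + p x y * (S / (2 * sqrt W) * (\<theta> * (Q1 x \<tau> / pX x) + (Q2 y \<tau> / pY y) / \<theta>))"
proof -
  let ?c = "S / (2 * sqrt W)"
  let ?f = "\<lambda>u t. p x y * (a u x t \<tau> * b u y t \<tau>) * of_bool (badA u y t \<tau>) + p x y * (a u x t \<tau> * b u y t \<tau>) * of_bool (badB u x t \<tau>)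
     + (p x y * ?c * \<theta> / pX x * (a u x t \<tau> * B u x t \<tau>) + p x y * ?c / \<theta> / pY y * (b u y t \<tau> * A u y t \<tau>))"
  have "Q x y \<tau> = (\<integral>u. (\<Sum>t\<in>T. p x y * (a u x t \<tau> * b u y t \<tau>)) \<partial>U)"
    unfolding Q_def by (simp add: Bochner_Integration.integral_sum ab_integrable integrable_mult_right sum_distrib_left)
  also have "\<dots> \<le> (\<integral>u. (\<Sum>t\<in>T. ?f u t) \<partial>U)"
  proof (rule integral_mono)
    show "integrable U (\<lambda>u. \<Sum>t\<in>T. p x y * (a u x t \<tau> * b u y t \<tau>))"
      by (intro Bochner_Integration.integrable_sum integrable_mult_right ab_integrable)
    show "integrable U (\<lambda>u. \<Sum>t\<in>T. ?f u t)"
      by (intro Bochner_Integration.integrable_sum Bochner_Integration.integrable_add integrable_mult_right[OF Q1_integrable] integrable_mult_right[OF Q2_integrable] bad_integrable)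
    fix u assume u: "u \<in> space U"
    show "(\<Sum>t\<in>T. p x y * (a u x t \<tau> * b u y t \<tau>)) \<le> (\<Sum>t\<in>T. ?f u t)"
    proof (rule sum_mono)
      fix t assume t: "t \<in> T"
      show "p x y * (a u x t \<tau> * b u y t \<tau>) \<le> ?f u t"
        using mult_left_mono[OF pointwise[OF u t x y p \<theta>, of \<tau>], of "p x y"] p by (simp add: algebra_simps)
    qed
  qed
  also have "\<dots> = QA x y \<tau> + QB x y \<tau> + (p x y * ?c * \<theta> / pX x * Q1 x \<tau> + p x y * ?c / \<theta> / pY y * Q2 y \<tau>)"
    unfolding QA_def QB_def Q1_integral Q2_integral
    by (simp add: sum.distrib Bochner_Integration.integral_add Bochner_Integration.integral_sum bad_integrable Q1_integrable Q2_integrable integrable_mult_right sum_distrib_left)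
  finally show ?thesis by (simp add: algebra_simps)
qed

lemma Q_nonneg: "0 \<le> Q x y \<tau>"
  unfolding Q_def using p_nonneg a_bounds b_bounds by (intro mult_nonneg_nonneg Bochner_Integration.integral_nonneg sum_nonneg) auto

lemma QAB_nonneg: "0 \<le> QA x y \<tau>" "0 \<le> QB x y \<tau>"
  unfolding QA_def QB_def by (rule Bochner_Integration.integral_nonneg, intro sum_nonneg mult_nonneg_nonneg; simp add: p_nonneg a_bounds b_bounds)+

text \<open>Unless a flag is raised, the marginals of \<open>Q\<close> are at most \<open>S\<close>
  times those of \<open>P\<close>. The linear bound can then be optimised at the true marginals, and
  the assumed density turns their geometric mean into \<open>P\<close> itself.\<close>

lemma min_le:
  assumes x: "x \<in> X" and y: "y \<in> Y" and p: "p x y > 0" and P: "P x y \<tau> > 0" and \<Lambda>: "0 < \<Lambda>"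
    and d: "(P1 x \<tau> / pX x) * (P2 y \<tau> / pY y) * \<Lambda> \<le> (P x y \<tau> / p x y)\<^sup>2"
  shows "min (P x y \<tau>) (Q x y \<tau>) \<le> QA x y \<tau> + QB x y \<tau> + P x y \<tau> * of_bool (S * P1 x \<tau> < Q1 x \<tau>)
     + P x y \<tau> * of_bool (S * P2 y \<tau> < Q2 y \<tau>) + S\<^sup>2 / sqrt (W * \<Lambda>) * P x y \<tau>"
proof -
  have last: "0 \<le> S\<^sup>2 / sqrt (W * \<Lambda>) * P x y \<tau>" using W \<Lambda> P by simp
  show ?thesis
  proof (cases "S * P1 x \<tau> < Q1 x \<tau> \<or> S * P2 y \<tau> < Q2 y \<tau>")
    case True
    then show ?thesis using last QAB_nonneg[of x y \<tau>] P by auto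
  next
    case False
    have pXp: "pX x > 0" "pY y > 0"
      using p x y fin member_le_sum[of y Y "\<lambda>y. p x y"] member_le_sum[of x X "\<lambda>x. p x y"] p_nonneg
      unfolding pX_def pY_def by (auto intro: less_le_trans)
    have Pp: "P1 x \<tau> > 0" "P2 y \<tau> > 0"
      using P x y fin member_le_sum[of y Y "\<lambda>y. P x y \<tau>"] member_le_sum[of x X "\<lambda>x. P x y \<tau>"] P_nonneg
      unfolding P1_def P2_def by (auto intro: less_le_trans)
    define r where "r = P1 x \<tau> / pX x"
    define s where "s = P2 y \<tau> / pY y"
    have rs: "r > 0" "s > 0" using Pp pXp by (auto simp: r_def s_def)
    \<comment> \<open>Balances the two terms of the linear bound at the true conditional marginals
      \<open>r\<close> and \<open>s\<close>.\<close>
    define \<theta> where "\<theta> = sqrt (s / r)"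
    have \<theta>: "\<theta> > 0" using rs by (simp add: \<theta>_def)
    have th: "\<theta> * r = sqrt (r * s)" "s / \<theta> = sqrt (r * s)"
    proof -
      have "\<theta> * r = sqrt (s / r) * sqrt (r\<^sup>2)" using rs by (simp add: \<theta>_def)
      also have "\<dots> = sqrt (r * s)" unfolding real_sqrt_mult[symmetric] using rs by (simp add: power2_eq_square)
      finally show 1: "\<theta> * r = sqrt (r * s)" .
      have "sqrt (r * s) * \<theta> = sqrt (s\<^sup>2)" unfolding \<theta>_def real_sqrt_mult[symmetric] using rs by (simp add: power2_eq_square)
      then show "s / \<theta> = sqrt (r * s)" using \<theta> rs by (simp add: field_simps)
    qed
    have 1: "Q1 x \<tau> / pX x \<le> S * r" "Q2 y \<tau> / pY y \<le> S * s"
      using False pXp by (auto simp: r_def s_def divide_right_mono)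
    have "sqrt (r * s) * sqrt \<Lambda> \<le> P x y \<tau> / p x y"
    proof -
      have "sqrt (r * s * \<Lambda>) \<le> sqrt ((P x y \<tau> / p x y)\<^sup>2)"
        unfolding r_def s_def by (rule real_sqrt_le_mono[OF d])
      then show ?thesis using P p by (simp add: real_sqrt_mult)
    qed
    then have 2: "p x y * sqrt (r * s) \<le> P x y \<tau> / sqrt \<Lambda>" using p \<Lambda> by (simp add: field_simps)
    have "min (P x y \<tau>) (Q x y \<tau>) \<le> QA x y \<tau> + QB x y \<tau> + p x y * (S / (2 * sqrt W) * (\<theta> * (Q1 x \<tau> / pX x) + (Q2 y \<tau> / pY y) / \<theta>))"
      using Q_le[OF x y p \<theta>, of \<tau>] by linarith
    also have "p x y * (S / (2 * sqrt W) * (\<theta> * (Q1 x \<tau> / pX x) + (Q2 y \<tau> / pY y) / \<theta>)) \<le> p x y * (S / (2 * sqrt W) * (\<theta> * (S * r) + (S * s) / \<theta>))"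
      using 1 \<theta> p S W by (intro mult_left_mono add_mono divide_right_mono) auto
    also have "\<dots> = S\<^sup>2 / sqrt W * (p x y * sqrt (r * s))"
    proof -
      have "\<theta> * (S * r) + (S * s) / \<theta> = S * (\<theta> * r) + S * (s / \<theta>)" by simp
      also have "\<dots> = 2 * S * sqrt (r * s)" unfolding th by simp
      finally show ?thesis by (simp add: power2_eq_square)
    qed
    also have "\<dots> \<le> S\<^sup>2 / sqrt W * (P x y \<tau> / sqrt \<Lambda>)"
      using 2 S W by (intro mult_left_mono) auto
    also have "\<dots> = S\<^sup>2 / sqrt (W * \<Lambda>) * P x y \<tau>" by (simp add: real_sqrt_mult)
    finally show ?thesis using P by (simp add: add_mono)
  qed
qed

text \<open>Markov's inequality: under the flag \<open>P1\<close> is at most \<open>Q1 / S\<close>,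
  and \<open>Q\<close> has mass at most one.\<close>

lemma sum_flag1_le:
  assumes "(\<Sum>x\<in>X. \<Sum>y\<in>Y. \<Sum>\<tau>\<in>F. Q x y \<tau>) \<le> 1"
  shows "(\<Sum>x\<in>X. \<Sum>y\<in>Y. \<Sum>\<tau>\<in>F. P x y \<tau> * of_bool (S * P1 x \<tau> < Q1 x \<tau>)) \<le> 1 / S"
proof -
  have "(\<Sum>x\<in>X. \<Sum>y\<in>Y. \<Sum>\<tau>\<in>F. P x y \<tau> * of_bool (S * P1 x \<tau> < Q1 x \<tau>)) = (\<Sum>x\<in>X. \<Sum>\<tau>\<in>F. P1 x \<tau> * of_bool (S * P1 x \<tau> < Q1 x \<tau>))"
    unfolding P1_def sum_distrib_right by (intro sum.cong refl sum.swap)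
  also have "\<dots> \<le> (\<Sum>x\<in>X. \<Sum>\<tau>\<in>F. Q1 x \<tau> / S)"
  proof (intro sum_mono)
    fix x \<tau>
    have "0 \<le> Q1 x \<tau>" using Q_nonneg by (simp add: Q1_def sum_nonneg)
    then show "P1 x \<tau> * of_bool (S * P1 x \<tau> < Q1 x \<tau>) \<le> Q1 x \<tau> / S" using S by (auto simp: field_simps)
  qed
  also have "\<dots> = (\<Sum>x\<in>X. \<Sum>\<tau>\<in>F. \<Sum>y\<in>Y. Q x y \<tau>) / S"
    by (simp add: Q1_def sum_divide_distrib)
  also have "(\<Sum>x\<in>X. \<Sum>\<tau>\<in>F. \<Sum>y\<in>Y. Q x y \<tau>) = (\<Sum>x\<in>X. \<Sum>y\<in>Y. \<Sum>\<tau>\<in>F. Q x y \<tau>)"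
    by (intro sum.cong refl sum.swap)
  finally show ?thesis using assms S by (meson divide_right_mono less_imp_le order_trans)
qed

lemma sum_flag2_le:
  assumes "(\<Sum>x\<in>X. \<Sum>y\<in>Y. \<Sum>\<tau>\<in>F. Q x y \<tau>) \<le> 1"
  shows "(\<Sum>x\<in>X. \<Sum>y\<in>Y. \<Sum>\<tau>\<in>F. P x y \<tau> * of_bool (S * P2 y \<tau> < Q2 y \<tau>)) \<le> 1 / S"
proof -
  have "(\<Sum>y\<in>Y. \<Sum>x\<in>X. \<Sum>\<tau>\<in>F. Q x y \<tau>) \<le> 1" using assms by (subst sum.swap)
  then show ?thesis
    using overlap.sum_flag1_le[OF swapped] unfolding swapped_defs by (subst sum.swap)
qed

text \<open>The four terms \<open>1 / S\<close> come from the two bad events and the two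
  flags.\<close>

theorem overlap_le:
  assumes Q: "(\<Sum>x\<in>X. \<Sum>y\<in>Y. \<Sum>\<tau>\<in>F. Q x y \<tau>) \<le> 1" and \<Lambda>: "0 < \<Lambda>"
    and E: "\<And>x y \<tau>. E x y \<tau> \<Longrightarrow> p x y > 0 \<and> P x y \<tau> > 0 \<and> (P1 x \<tau> / pX x) * (P2 y \<tau> / pY y) * \<Lambda> \<le> (P x y \<tau> / p x y)\<^sup>2"
  shows "(\<Sum>x\<in>X. \<Sum>y\<in>Y. \<Sum>\<tau>\<in>F. min (P x y \<tau>) (Q x y \<tau>) * of_bool (E x y \<tau>)) \<le> 4 / S + S\<^sup>2 / sqrt (W * \<Lambda>)"
proof -
  let ?c = "S\<^sup>2 / sqrt (W * \<Lambda>)"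
  have c: "0 \<le> ?c" using W \<Lambda> by simp
  have "(\<Sum>x\<in>X. \<Sum>y\<in>Y. \<Sum>\<tau>\<in>F. min (P x y \<tau>) (Q x y \<tau>) * of_bool (E x y \<tau>)) \<le>
     (\<Sum>x\<in>X. \<Sum>y\<in>Y. \<Sum>\<tau>\<in>F. QA x y \<tau> + QB x y \<tau> + P x y \<tau> * of_bool (S * P1 x \<tau> < Q1 x \<tau>)
     + P x y \<tau> * of_bool (S * P2 y \<tau> < Q2 y \<tau>) + ?c * P x y \<tau>)"
  proof (intro sum_mono)
    fix x y \<tau> assume xy: "x \<in> X" "y \<in> Y"
    have "0 \<le> ?c * P x y \<tau>" using c P_nonneg[of x y \<tau>] by (rule mult_nonneg_nonneg)
    then show "min (P x y \<tau>) (Q x y \<tau>) * of_bool (E x y \<tau>) \<le> QA x y \<tau> + QB x y \<tau> + P x y \<tau> * of_bool (S * P1 x \<tau> < Q1 x \<tau>)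
     + P x y \<tau> * of_bool (S * P2 y \<tau> < Q2 y \<tau>) + ?c * P x y \<tau>"
      using min_le[OF xy _ _ \<Lambda>, of \<tau>] E[of x y \<tau>] QAB_nonneg[of x y \<tau>] P_nonneg[of x y \<tau>]
      by (cases "E x y \<tau>") auto
  qed
  also have "\<dots> = (\<Sum>x\<in>X. \<Sum>y\<in>Y. \<Sum>\<tau>\<in>F. QA x y \<tau>) + (\<Sum>x\<in>X. \<Sum>y\<in>Y. \<Sum>\<tau>\<in>F. QB x y \<tau>)
     + (\<Sum>x\<in>X. \<Sum>y\<in>Y. \<Sum>\<tau>\<in>F. P x y \<tau> * of_bool (S * P1 x \<tau> < Q1 x \<tau>))
     + (\<Sum>x\<in>X. \<Sum>y\<in>Y. \<Sum>\<tau>\<in>F. P x y \<tau> * of_bool (S * P2 y \<tau> < Q2 y \<tau>))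
     + ?c * (\<Sum>x\<in>X. \<Sum>y\<in>Y. \<Sum>\<tau>\<in>F. P x y \<tau>)"
    by (simp only: sum.distrib sum_distrib_left)
  also have "\<dots> \<le> 1 / S + 1 / S + 1 / S + 1 / S + ?c * 1"
    by (intro add_mono sum_QA_le sum_QB_le sum_flag1_le[OF Q] sum_flag2_le[OF Q] mult_left_mono P_le c)
  finally show ?thesis by simp
qed

end

section \<open>Lengths of transcripts\<close>

primrec sent :: "bool \<Rightarrow> bits list \<Rightarrow> bits" where
  "sent p [] = []"
| "sent p (m # t) = (if p then m else []) @ sent (\<not> p) t"

lemma sent_append: "sent p (s @ t) = sent p s @ sent (p \<longleftrightarrow> even (length s)) t"
proof (induction s arbitrary: p)
  case (Cons m s)
  from Cons[of "\<not> p"] show ?case by (cases p; cases "even (length s)") auto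
qed simp

lemma length_sent: "length (sent p t) + length (sent (\<not> p) t) = (\<Sum>m\<leftarrow>t. length m)"
proof (induction t arbitrary: p)
  case (Cons m t)
  from Cons[of "\<not> p"] show ?case by auto
qed simp

text \<open>For the messages that party \<open>p\<close> receives, membership in a prefix-free
  codebook of its own. This holds almost surely along the transcript; as part of
  \<open>complete\<close> it makes Kraft's inequality true at every sample point.\<close>

definition valid :: "('x, 'y, 'u, 'a, 'b) protocol \<Rightarrow> bool \<Rightarrow> ('x \<times> 'y) \<times> 'u \<times> 'a \<times> 'b \<Rightarrow> bits list \<Rightarrow> bool" where
  "valid \<pi> p \<omega> t \<longleftrightarrow> (\<forall>i<length t. (even i \<longleftrightarrow> \<not> p) \<longrightarrow>
     t ! i \<in> dom (book_of \<pi> p \<omega> (take i t)) \<and> prefix_free (dom (book_of \<pi> p \<omega> (take i t))))"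

definition complete :: "('x, 'y, 'u, 'a, 'b) protocol \<Rightarrow> bool \<Rightarrow> ('x \<times> 'y) \<times> 'u \<times> 'a \<times> 'b \<Rightarrow> bits list \<Rightarrow> bool" where
  "complete \<pi> p \<omega> t \<longleftrightarrow> follows \<pi> p \<omega> t \<and> ended \<pi> p \<omega> t \<and> valid \<pi> p \<omega> t"

text \<open>
  Among the transcripts that one party deems possible, the bits of the other party form a
  prefix-free set, because two of them first differ in a message of the other party.
\<close>

lemma complete_sent_prefix:
  assumes t: "complete \<pi> p \<omega> t" and t': "complete \<pi> p \<omega> t'" and pre: "prefix (sent (\<not> p) t) (sent (\<not> p) t')"
  shows "t = t'"
proof (rule ccontr)
  assume ne: "t \<noteq> t'"
  \<comment> \<open>The codebook stops the execution after the last message of \<open>s\<close>, so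
    no complete transcript continues it.\<close>
  have not_prefix: "\<not> strict_prefix s s'" if s: "complete \<pi> p \<omega> s" and s': "complete \<pi> p \<omega> s'" for s s'
  proof
    assume "strict_prefix s s'"
    then obtain m r where s'eq: "s' = s @ m # r" by (metis strict_prefixE')
    have "s \<noteq> []" using s by (simp add: complete_def ended_def)
    then have "Suc (length s - 1) < length s'" by (simp add: s'eq)
    then have "book_of \<pi> p \<omega> (take (length s - 1) s') (s' ! (length s - 1)) = Some Continue"
      using s' unfolding complete_def follows_def by blast
    moreover have "take (length s - 1) s' = butlast s" "s' ! (length s - 1) = last s"
      using \<open>s \<noteq> []\<close> by (auto simp: s'eq nth_append last_conv_nth butlast_conv_take)
    ultimately show False using s by (simp add: complete_def ended_def)
  qed
  have "parallel t t'"
    using ne not_prefix[OF t t'] not_prefix[OF t' t] by (auto simp: strict_prefix_def)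
  then obtain c m r m' r' where d: "m \<noteq> m'" "t = c @ m # r" "t' = c @ m' # r'"
    using parallel_decomp by blast
  let ?i = "length c"
  have tk: "take ?i t = c" "t ! ?i = m" "?i < length t" "take ?i t' = c" "t' ! ?i = m'" "?i < length t'"
    using d by auto
  show False
  proof (cases "even ?i \<longleftrightarrow> p")
    case True
    then have "next_msg \<pi> \<omega> c = m" "next_msg \<pi> \<omega> c = m'"
      using t t' tk unfolding complete_def follows_def by metis+
    then show False using d by simp
  next
    case False
    then have "m \<in> dom (book_of \<pi> p \<omega> c)" "m' \<in> dom (book_of \<pi> p \<omega> c)" "prefix_free (dom (book_of \<pi> p \<omega> c))"
      using t t' tk unfolding complete_def valid_def by metis+
    then have "\<not> prefix m m'" "\<not> prefix m' m"
      using d(1) by (auto simp: prefix_free_def strict_prefix_def)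
    moreover have "prefix (m @ sent False r) (m' @ sent False r')"
      using pre False unfolding d sent_append by (cases p) auto
    then have "prefix m m' \<or> prefix m' m"
      by (meson append_prefixD prefixI prefix_same_cases)
    ultimately show False by blast
  qed
qed

lemma complete_kraft:
  assumes "finite T"
  shows "(\<Sum>t\<in>{t\<in>T. complete \<pi> p \<omega> t}. (1/2) ^ length (sent (\<not> p) t)) \<le> (1::real)"
proof -
  let ?C = "{t\<in>T. complete \<pi> p \<omega> t}"
  have inj: "inj_on (sent (\<not> p)) ?C"
    by (rule inj_onI) (metis (no_types, lifting) complete_sent_prefix mem_Collect_eq prefix_order.refl)
  have "(\<Sum>t\<in>?C. (1/2) ^ length (sent (\<not> p) t)) = (\<Sum>m\<in>sent (\<not> p) ` ?C. (1/2::real) ^ length m)"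
    by (simp add: sum.reindex[OF inj])
  also have "\<dots> \<le> 1"
  proof (rule kraft_inequality)
    show "prefix_free (sent (\<not> p) ` ?C)"
      unfolding prefix_free_def strict_prefix_def using complete_sent_prefix by blast
  qed (use assms in auto)
  finally show ?thesis .
qed

lemma complete_path:
  assumes "complete \<pi> True \<omega> t" "complete \<pi> False \<omega> t"
  shows "path \<pi> \<omega> t" "ended \<pi> True \<omega> t"
  using assms by (auto simp: complete_def follows_def path_def)

lemma complete_transcript:
  assumes ag: "agree \<pi> \<omega>" and stop: "\<exists>k. snd (run \<pi> \<omega> k) = Stop"
    and dom: "\<forall>t\<in>pending \<pi> \<omega>. next_msg \<pi> \<omega> t \<in> dom (next_book \<pi> \<omega> t)"
    and pf: "\<forall>t\<in>pending \<pi> \<omega>. prefix_free (dom (next_book \<pi> \<omega> t))"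
  shows "complete \<pi> p \<omega> (transcript \<pi> \<omega>)"
proof -
  let ?t = "transcript \<pi> \<omega>"
  have pt: "path \<pi> \<omega> ?t" "ended \<pi> True \<omega> ?t" using transcript_path[OF stop] by auto
  have "?t ! i \<in> dom (book_of \<pi> p \<omega> (take i ?t)) \<and> prefix_free (dom (book_of \<pi> p \<omega> (take i ?t)))"
    if i: "i < length ?t" for i
  proof -
    have pend: "take i ?t \<in> pending \<pi> \<omega>" by (rule path_pending[OF pt(1) i])
    have "book_of \<pi> p \<omega> (take i ?t) = next_book \<pi> \<omega> (take i ?t)"
      using ag pend unfolding agree_def next_book_eq by (cases p) auto
    moreover have "?t ! i = next_msg \<pi> \<omega> (take i ?t)" using pt(1) i by (simp add: path_def)
    ultimately show ?thesis using dom pf pend by simp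
  qed
  then show ?thesis
    using agree_path[OF ag pt(1), of p] pt(2) by (auto simp: complete_def valid_def ended_def)
qed

lemma valid_cong:
  "valid \<pi> True ((x, y), u, a, b) t = valid \<pi> True ((x, y'), u, a, b') t"
  "valid \<pi> False ((x, y), u, a, b) t = valid \<pi> False ((x', y), u, a', b) t"
  by (auto simp: valid_def book_of_def)

lemma complete_cong:
  "complete \<pi> True ((x, y), u, a, b) t = complete \<pi> True ((x, y'), u, a, b') t"
  "complete \<pi> False ((x, y), u, a, b) t = complete \<pi> False ((x', y), u, a', b) t"
  unfolding complete_def using follows_cong ended_cong valid_cong by metis+

context protocol_space
begin

lemma book_defined_prefix_free_pred:
  assumes "\<And>m. (\<lambda>z. f z m) \<in> M \<rightarrow>\<^sub>M count_space UNIV"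
  shows "Measurable.pred M (\<lambda>z. m \<in> dom (f z :: codebook) \<and> prefix_free (dom (f z)))"
proof -
  have "(\<lambda>z. m \<in> dom (f z) \<and> prefix_free (dom (f z))) =
     (\<lambda>z. \<not> f z m = None \<and> (\<forall>m m'. \<not> f z m = None \<longrightarrow> \<not> f z m' = None \<longrightarrow> \<not> strict_prefix m m'))"
    by (auto simp: prefix_free_def dom_def fun_eq_iff)
  then show ?thesis
    by (simp only:, intro pred_intros_logic pred_intros_countable pred_eq_const assms) simp_all
qed

lemma valid_True_view: "Measurable.pred (pub \<pi> \<Otimes>\<^sub>M coin1 \<pi>) (\<lambda>(u, a). valid \<pi> True ((x, y), u, a, b) t)"
  unfolding valid_def book_of_def case_prod_beta prod.sel if_True
  by (intro pred_intros_countable pred_intros_imp' book_defined_prefix_free_pred book1_measurable[unfolded case_prod_beta])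

lemma valid_False_view: "Measurable.pred (pub \<pi> \<Otimes>\<^sub>M coin2 \<pi>) (\<lambda>(u, b). valid \<pi> False ((x, y), u, a, b) t)"
  unfolding valid_def book_of_def case_prod_beta prod.sel if_False
  by (intro pred_intros_countable pred_intros_imp' book_defined_prefix_free_pred book2_measurable[unfolded case_prod_beta])

lemma complete_True_view: "Measurable.pred (pub \<pi> \<Otimes>\<^sub>M coin1 \<pi>) (\<lambda>(u, a). complete \<pi> True ((x, y), u, a, b) t)"
  unfolding complete_def case_prod_beta
  by (intro pred_intros_logic follows_True_view[unfolded case_prod_beta] ended_True_view[unfolded case_prod_beta] valid_True_view[unfolded case_prod_beta])

lemma complete_False_view: "Measurable.pred (pub \<pi> \<Otimes>\<^sub>M coin2 \<pi>) (\<lambda>(u, b). complete \<pi> False ((x, y), u, a, b) t)"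
  unfolding complete_def case_prod_beta
  by (intro pred_intros_logic follows_False_view[unfolded case_prod_beta] ended_False_view[unfolded case_prod_beta] valid_False_view[unfolded case_prod_beta])

lemma section_sets:
  assumes "Measurable.pred (pub \<pi> \<Otimes>\<^sub>M M) (\<lambda>(u, a). A u a)" "u \<in> space (pub \<pi>)"
  shows "{a \<in> space M. A u a} \<in> sets M"
  using measurable_compose[OF measurable_Pair1'[OF assms(2)] assms(1)] by (simp add: pred_def)

text \<open>For a fixed transcript the outputs are disjoint events, so summing over them removes
  \<open>h\<close>; the Kraft bound, valid for every value of the coin, is then integrated.\<close>

lemma section_sum_le:
  fixes M :: "'m measure"
  assumes M: "prob_space M" and fin: "finite T" "finite F"
    and C: "\<And>t. {a \<in> space M. C a t} \<in> sets M" and h: "\<And>t \<tau>. {a \<in> space M. C a t \<and> h a t = \<tau>} \<in> sets M"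
    and kraft: "\<And>a. (\<Sum>t\<in>{t\<in>T. C a t}. w t) \<le> (1::real)" and w: "\<And>t. 0 \<le> w t"
  shows "(\<Sum>\<tau>\<in>F. \<Sum>t\<in>T. w t * measure M {a \<in> space M. C a t \<and> h a t = \<tau>}) \<le> 1"
proof -
  interpret prob_space M by (rule M)
  have "(\<Sum>\<tau>\<in>F. \<Sum>t\<in>T. w t * measure M {a \<in> space M. C a t \<and> h a t = \<tau>}) =
     (\<Sum>t\<in>T. w t * (\<Sum>\<tau>\<in>F. measure M {a \<in> space M. C a t \<and> h a t = \<tau>}))"
    by (subst sum.swap) (simp add: sum_distrib_left)
  also have "\<dots> \<le> (\<Sum>t\<in>T. w t * measure M {a \<in> space M. C a t})"
  proof (intro sum_mono mult_left_mono w)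
    fix t
    have "(\<Sum>\<tau>\<in>F. measure M {a \<in> space M. C a t \<and> h a t = \<tau>}) = measure M (\<Union>\<tau>\<in>F. {a \<in> space M. C a t \<and> h a t = \<tau>})"
      using fin h by (intro finite_measure_finite_Union[symmetric]) (auto simp: disjoint_family_on_def)
    also have "\<dots> \<le> measure M {a \<in> space M. C a t}"
      using C by (intro finite_measure_mono) auto
    finally show "(\<Sum>\<tau>\<in>F. measure M {a \<in> space M. C a t \<and> h a t = \<tau>}) \<le> measure M {a \<in> space M. C a t}" .
  qed
  also have "\<dots> = (\<integral>a. (\<Sum>t\<in>T. w t * indicator {a \<in> space M. C a t} a) \<partial>M)"
    using C by (subst Bochner_Integration.integral_sum) (auto simp: emeasure_eq_measure)
  also have "\<dots> \<le> (\<integral>a. 1 \<partial>M)"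
  proof (rule integral_mono)
    show "integrable M (\<lambda>a. \<Sum>t\<in>T. w t * indicator {a \<in> space M. C a t} a)"
      using C by (intro Bochner_Integration.integrable_sum integrable_mult_right) (auto simp: emeasure_eq_measure)
    fix a assume a: "a \<in> space M"
    have "(\<Sum>t\<in>T. w t * indicator {a \<in> space M. C a t} a) = (\<Sum>t\<in>{t\<in>T. C a t}. w t)"
      using fin a by (intro sum.mono_neutral_cong_right) (auto simp: indicator_def)
    then show "(\<Sum>t\<in>T. w t * indicator {a \<in> space M. C a t} a) \<le> 1" using kraft[of a] by simp
  qed simp
  finally show ?thesis by (simp add: prob_space)
qed

end

lemma pmf_finite_approx:
  fixes r :: "'a pmf"
  assumes "0 < \<eta>"
  obtains T where "finite T" "measure r (- T) < \<eta>"
proof -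
  have "((\<lambda>T. sum (pmf r) T) \<longlongrightarrow> 1) (finite_subsets_at_top UNIV)"
    using pmf_has_sum[of r UNIV] by (simp add: has_sum_def)
  then have "\<forall>\<^sub>F T in finite_subsets_at_top UNIV. dist (sum (pmf r) T) 1 < \<eta>"
    using assms by (rule tendstoD)
  then obtain T where T: "finite T" "dist (sum (pmf r) T) 1 < \<eta>"
    unfolding eventually_finite_subsets_at_top by auto
  moreover have "measure r (- T) = 1 - measure r T"
    using measure_pmf.prob_compl[of T r] by (simp add: Compl_eq_Diff_UNIV)
  ultimately show ?thesis using that[of T] by (auto simp: measure_measure_pmf_finite dist_real_def abs_if split: if_splits)
qed

text \<open>A constant truncation \<open>\<phi>\<close> expresses the input laws as masses of a
  trivial history. In this shape the density matches the assumption of \<open>overlap_le\<close> and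
  the telescoping sum of the rounds.\<close>

lemma info_density_eq:
  fixes L :: "('t \<times> 'x \<times> 'y) pmf"
  assumes "(\<tau>, x, y) \<in> set_pmf L" and c: "\<And>\<tau>. \<phi> \<tau> = c"
  shows "info_density (measure_pmf L) (\<tau>, x, y) = log 2 ((pmf L (\<tau>, x, y) / joint_mass L \<phi> c x y)\<^sup>2 /
     ((mass1 L id \<tau> x / mass1 L \<phi> c x) * (mass2 L id \<tau> y / mass2 L \<phi> c y)))"
proof -
  have eqs: "({\<tau>} \<times> UNIV \<times> UNIV) \<inter> ((UNIV \<times> {x} \<times> UNIV) \<inter> (UNIV \<times> UNIV \<times> {y})) = {(\<tau>, x, y)}"
    "(UNIV \<times> {x} \<times> UNIV) \<inter> (UNIV \<times> UNIV \<times> {y}) = {z. \<phi> (fst z) = c \<and> snd z = (x, y)}"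
    "({\<tau>} \<times> UNIV \<times> UNIV) \<inter> (UNIV \<times> {x} \<times> UNIV) = {z. id (fst z) = \<tau> \<and> fst (snd z) = x}"
    "(UNIV \<times> {x} \<times> UNIV) = {z. \<phi> (fst z) = c \<and> fst (snd z) = x}"
    "({\<tau>} \<times> UNIV \<times> UNIV) \<inter> (UNIV \<times> UNIV \<times> {y}) = {z. id (fst z) = \<tau> \<and> snd (snd z) = y}"
    "(UNIV \<times> UNIV \<times> {y}) = {z. \<phi> (fst z) = c \<and> snd (snd z) = y}"
    using c by auto
  have p: "0 < pmf L (\<tau>, x, y)" using assms by (simp add: pmf_positive)
  have "measure L {(\<tau>, x, y)} \<le> joint_mass L \<phi> c x y" "measure L {(\<tau>, x, y)} \<le> joint_mass L id \<tau> x y"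
    unfolding joint_mass_def using c by (auto intro!: measure_pmf.finite_measure_mono)
  then have pos: "0 < joint_mass L \<phi> c x y" "0 < joint_mass L id \<tau> x y"
    using p by (auto simp: measure_pmf_single)
  then have pos': "0 < mass1 L \<phi> c x" "0 < mass2 L \<phi> c y" "0 < mass1 L id \<tau> x" "0 < mass2 L id \<tau> y"
    using joint_mass_le less_le_trans by metis+
  let ?T = "{\<tau>} \<times> UNIV \<times> UNIV" and ?X = "UNIV \<times> {x} \<times> UNIV" and ?Y = "UNIV \<times> UNIV \<times> {y}"
  have cp: "cprob (measure_pmf L) ?T (?X \<inter> ?Y) = pmf L (\<tau>, x, y) / joint_mass L \<phi> c x y"
    "cprob (measure_pmf L) ?T ?X = mass1 L id \<tau> x / mass1 L \<phi> c x"
    "cprob (measure_pmf L) ?T ?Y = mass2 L id \<tau> y / mass2 L \<phi> c y"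
    unfolding cprob_def
    by (subst eqs(1), subst eqs(2), simp add: joint_mass_def measure_pmf_single)
       (subst eqs(3), subst eqs(4), simp add: mass1_def, subst eqs(5), subst eqs(6), simp add: mass2_def)
  have "info_density (measure_pmf L) (\<tau>, x, y) =
     log 2 ((pmf L (\<tau>, x, y) / joint_mass L \<phi> c x y) / (mass1 L id \<tau> x / mass1 L \<phi> c x)) +
     log 2 ((pmf L (\<tau>, x, y) / joint_mass L \<phi> c x y) / (mass2 L id \<tau> y / mass2 L \<phi> c y))"
    unfolding info_density_def Let_def case_prod_conv cp ..
  also have "\<dots> = log 2 (((pmf L (\<tau>, x, y) / joint_mass L \<phi> c x y) / (mass1 L id \<tau> x / mass1 L \<phi> c x)) *
     ((pmf L (\<tau>, x, y) / joint_mass L \<phi> c x y) / (mass2 L id \<tau> y / mass2 L \<phi> c y)))"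
    using p pos pos' by (intro log_mult_pos[symmetric]) auto
  finally show ?thesis by (simp add: power2_eq_square mult_ac)
qed

section \<open>Converse\<close>

text \<open>One-shot converse. The mass of the event is split into the overlap with the simulated
  law, bounded by \<open>overlap_le\<close> with \<open>W = (1/2) ^ l\<close> and
  \<open>\<Lambda> = 2 powr \<nu>\<close>, and the excess over the simulated law, bounded by the
  variation distance.\<close>

theorem (in protocol_space) simulation_converse:
  fixes L :: "('t::countable \<times> 'x \<times> 'y) pmf"
  assumes sd: "self_delimiting P \<pi>" and sim: "is_simulation \<epsilon> P (measure_pmf L) \<pi>"
    and L: "map_pmf snd L = P" and fin: "finite (set_pmf P)"
    and len: "protocol_length P \<pi> \<le> enat l" and S: "0 < S"
  shows "measure L {z \<in> set_pmf L. info_density (measure_pmf L) z > \<nu>} \<le> \<epsilon> + (4 / S + S\<^sup>2 * 2 powr ((real l - \<nu>) / 2))"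
proof -
  obtain f :: "'x \<Rightarrow> 'u \<Rightarrow> 'a \<Rightarrow> bits list \<Rightarrow> 't" and g :: "'y \<Rightarrow> 'u \<Rightarrow> 'b \<Rightarrow> bits list \<Rightarrow> 't" where
    fm: "\<forall>x t. (\<lambda>(u, a). f x u a t) \<in> pub \<pi> \<Otimes>\<^sub>M coin1 \<pi> \<rightarrow>\<^sub>M count_space UNIV" and
    gm: "\<forall>y t. (\<lambda>(u, b). g y u b t) \<in> pub \<pi> \<Otimes>\<^sub>M coin2 \<pi> \<rightarrow>\<^sub>M count_space UNIV" and
    dv: "d_var (distr (measure_pmf L) (count_space UNIV) (\<lambda>(t, x, y). (t, t, x, y)))
              (distr \<Omega> (count_space UNIV) (sim_output \<pi> f g)) \<le> \<epsilon>"
    using sim unfolding is_simulation_def sim_output_def by blast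
  let ?\<psi> = "\<lambda>(t, x, y). (t, t, x, y)"
  note out = sim_output_measurable[OF fm gm]
  obtain q where q: "distr \<Omega> (count_space UNIV) (sim_output \<pi> f g) = measure_pmf q"
    by (rule distr_countable_pmf[OF sample.prob_space_axioms out])
  have dv': "d_var (measure_pmf (map_pmf ?\<psi> L)) (measure_pmf q) \<le> \<epsilon>"
    using dv unfolding q by (simp add: map_pmf_rep_eq)
  have inj: "inj ?\<psi>" by (auto simp: inj_def)
  obtain r where r: "distr \<Omega> (count_space UNIV) (transcript \<pi>) = measure_pmf r"
    by (rule distr_countable_pmf[OF sample.prob_space_axioms transcript_measurable])
  let ?bound = "4 / S + S\<^sup>2 * 2 powr ((real l - \<nu>) / 2)"
  let ?D = "{z \<in> set_pmf L. info_density (measure_pmf L) z > \<nu>}"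
  \<comment> \<open>Both the event and the set of transcripts may be infinite;
    \<open>overlap\<close> is applied to a finite part \<open>E\<close> of the event and to finitely
    many transcripts, at the price of \<open>\<eta>\<close>.\<close>
  have bound: "measure L E \<le> \<epsilon> + ?bound + \<eta>" if E: "finite E" "E \<subseteq> ?D" and \<eta>: "0 < \<eta>" for E \<eta>
  proof -
    obtain T where T: "finite T" "measure r (- T) < \<eta>" using pmf_finite_approx[OF \<eta>] .
    define a where "a u x t \<tau> = measure (coin1 \<pi>) {c \<in> space (coin1 \<pi>). complete \<pi> True ((x, undefined), u, c, undefined) t \<and> f x u c t = \<tau>}" for u x t \<tau>
    define b where "b u y t \<tau> = measure (coin2 \<pi>) {c \<in> space (coin2 \<pi>). complete \<pi> False ((undefined, y), u, undefined, c) t \<and> g y u c t = \<tau>}" for u y t \<tau>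
    define X where "X = fst ` set_pmf P"
    define Y where "Y = snd ` set_pmf P"
    define F where "F = fst ` E"
    define p where "p x y = pmf P (x, y)" for x y
    define Pm where "Pm x y \<tau> = pmf L (\<tau>, x, y)" for x y \<tau>
    define wX where "wX t = (1/2::real) ^ length (sent True t)" for t
    define wY where "wY t = (1/2::real) ^ length (sent False t)" for t
    have finXY: "finite X" "finite Y" "finite F" using fin E by (auto simp: X_def Y_def F_def)
    have predA: "Measurable.pred (pub \<pi> \<Otimes>\<^sub>M coin1 \<pi>) (\<lambda>(u, c). complete \<pi> True ((x, undefined), u, c, undefined) t \<and> f x u c t = \<tau>)" for x t \<tau>
      using pred_eq_const[OF fm[rule_format, of x t], of \<tau>] complete_True_view[of x undefined undefined t]
      unfolding case_prod_beta by (intro pred_intros_logic)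
    have predB: "Measurable.pred (pub \<pi> \<Otimes>\<^sub>M coin2 \<pi>) (\<lambda>(u, c). complete \<pi> False ((undefined, y), u, undefined, c) t \<and> g y u c t = \<tau>)" for y t \<tau>
      using pred_eq_const[OF gm[rule_format, of y t], of \<tau>] complete_False_view[of undefined y undefined t]
      unfolding case_prod_beta by (intro pred_intros_logic)
    have abs_sum_P: "(\<Sum>x\<in>X. \<Sum>y\<in>Y. h x y) = (\<Sum>z\<in>X \<times> Y. h (fst z) (snd z))" for h :: "'x \<Rightarrow> 'y \<Rightarrow> real"
      by (simp add: sum.cartesian_product case_prod_beta)
    have sum3: "(\<Sum>x\<in>X. \<Sum>y\<in>Y. \<Sum>\<tau>\<in>F. h x y \<tau>) = (\<Sum>(x, y, \<tau>)\<in>X \<times> Y \<times> F. h x y \<tau>)" for h :: "'x \<Rightarrow> 'y \<Rightarrow> 't \<Rightarrow> real"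
      by (simp add: sum.cartesian_product)
    have meas_ab: "(\<lambda>u. a u x t \<tau>) \<in> borel_measurable (pub \<pi>)" "(\<lambda>u. b u y t \<tau>) \<in> borel_measurable (pub \<pi>)" for x y t \<tau>
      unfolding a_def b_def by (rule prob_rectangle(2)[OF predA predB] prob_rectangle(3)[OF predA predB])+
    \<comment> \<open>Positive probabilities produce coins for which \<open>t\<close> is an actual
      transcript. The length is a supremum over all executions, so no null set has to be
      avoided.\<close>
    have Wle: "(1/2) ^ l \<le> wX t * wY t" if u: "u \<in> space (pub \<pi>)" and pp: "p x y > 0" and t: "t \<in> T" and ab: "a u x t \<tau> * b u y t \<tau> > 0" for u x y t \<tau>
    proof -
      have nz: "a u x t \<tau> \<noteq> 0" "b u y t \<tau> \<noteq> 0" using ab by auto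
      have ne1: "{c \<in> space (coin1 \<pi>). complete \<pi> True ((x, undefined), u, c, undefined) t \<and> f x u c t = \<tau>} \<noteq> {}"
        using nz(1) unfolding a_def by (rule contrapos_nn) (simp only: measure_empty)
      have ne2: "{c \<in> space (coin2 \<pi>). complete \<pi> False ((undefined, y), u, undefined, c) t \<and> g y u c t = \<tau>} \<noteq> {}"
        using nz(2) unfolding b_def by (rule contrapos_nn) (simp only: measure_empty)
      obtain c where c: "c \<in> space (coin1 \<pi>)" "complete \<pi> True ((x, undefined), u, c, undefined) t"
        using ne1 by blast
      obtain d where d: "d \<in> space (coin2 \<pi>)" "complete \<pi> False ((undefined, y), u, undefined, d) t"
        using ne2 by blast
      let ?\<omega> = "((x, y), u, c, d)"
      have "complete \<pi> True ?\<omega> t" "complete \<pi> False ?\<omega> t" using c d complete_cong by metis+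
      from complete_path[OF this] have "run \<pi> ?\<omega> (length t) = (t, Stop)" by (simp add: run_eq_iff)
      then have "enat (\<Sum>m\<leftarrow>t. length m) \<le> (SUP k. enat (\<Sum>m\<leftarrow>fst (run \<pi> ?\<omega> k). length m))"
        by (intro SUP_upper2[of "length t"]) auto
      also have "\<dots> \<le> protocol_length P \<pi>"
        unfolding protocol_length_def using u c d pp
        by (intro SUP_upper) (auto simp: p_def set_pmf_iff)
      finally have "(\<Sum>m\<leftarrow>t. length m) \<le> l" using len by (meson enat_ord_simps(1) order_trans)
      then show ?thesis
        using length_sent[of True t] unfolding wX_def wY_def by (simp flip: power_add add: power_decreasing)
    qed
    have sumP: "(\<Sum>x\<in>X. \<Sum>y\<in>Y. p x y) \<le> 1"
    proof -
      have "(\<Sum>x\<in>X. \<Sum>y\<in>Y. p x y) = measure P (X \<times> Y)"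
        unfolding abs_sum_P p_def using finXY by (simp add: measure_measure_pmf_finite)
      then show ?thesis by simp
    qed
    have sumPm: "(\<Sum>x\<in>X. \<Sum>y\<in>Y. \<Sum>\<tau>\<in>F. Pm x y \<tau>) \<le> 1"
    proof -
      have "(\<Sum>x\<in>X. \<Sum>y\<in>Y. \<Sum>\<tau>\<in>F. Pm x y \<tau>) = sum (pmf L) ((\<lambda>(x, y, \<tau>). (\<tau>, x, y)) ` (X \<times> Y \<times> F))"
        unfolding sum3 Pm_def by (subst sum.reindex) (auto simp: inj_on_def case_prod_beta)
      also have "\<dots> = measure L ((\<lambda>(x, y, \<tau>). (\<tau>, x, y)) ` (X \<times> Y \<times> F))"
        using finXY by (simp add: measure_measure_pmf_finite)
      finally show ?thesis by simp
    qed
    interpret overlap "pub \<pi>" a b X Y T F p Pm wX wY "(1/2) ^ l" S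
    proof unfold_locales
      show "(\<Sum>\<tau>\<in>F. \<Sum>t\<in>T. wY t * a u x t \<tau>) \<le> 1" if u: "u \<in> space (pub \<pi>)" for u x
        unfolding a_def
      proof (rule section_sum_le[OF coin1.prob_space_axioms T(1) finXY(3)])
        show "(\<Sum>t\<in>{t \<in> T. complete \<pi> True ((x, undefined), u, c, undefined) t}. wY t) \<le> 1" for c
          unfolding wY_def using complete_kraft[OF T(1), where \<pi> = \<pi> and p = True] by simp
        show "{c \<in> space (coin1 \<pi>). complete \<pi> True ((x, undefined), u, c, undefined) t} \<in> sets (coin1 \<pi>)" for t
          by (rule section_sets[OF complete_True_view u])
        show "{c \<in> space (coin1 \<pi>). complete \<pi> True ((x, undefined), u, c, undefined) t \<and> f x u c t = \<tau>} \<in> sets (coin1 \<pi>)" for t \<tau>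
          by (rule section_sets[OF predA u])
      qed (simp add: wY_def)
      show "(\<Sum>\<tau>\<in>F. \<Sum>t\<in>T. wX t * b u y t \<tau>) \<le> 1" if u: "u \<in> space (pub \<pi>)" for u y
        unfolding b_def
      proof (rule section_sum_le[OF coin2.prob_space_axioms T(1) finXY(3)])
        show "(\<Sum>t\<in>{t \<in> T. complete \<pi> False ((undefined, y), u, undefined, c) t}. wX t) \<le> 1" for c
          unfolding wX_def using complete_kraft[OF T(1), where \<pi> = \<pi> and p = False] by simp
        show "{c \<in> space (coin2 \<pi>). complete \<pi> False ((undefined, y), u, undefined, c) t} \<in> sets (coin2 \<pi>)" for t
          by (rule section_sets[OF complete_False_view u])
        show "{c \<in> space (coin2 \<pi>). complete \<pi> False ((undefined, y), u, undefined, c) t \<and> g y u c t = \<tau>} \<in> sets (coin2 \<pi>)" for t \<tau>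
          by (rule section_sets[OF predB u])
      qed (simp add: wX_def)
    qed (use finXY T meas_ab sumP sumPm Wle S in \<open>auto simp: a_def b_def p_def Pm_def wX_def wY_def\<close>)
    let ?o = "sim_output \<pi> f g"
    have osets: "{\<omega> \<in> space \<Omega>. ?o \<omega> = z} \<in> sets \<Omega>" for z
      using pred_eq_const[OF out, of z] by (simp add: pred_def)
    have tsets: "{\<omega> \<in> space \<Omega>. transcript \<pi> \<omega> = t} \<in> sets \<Omega>" "{\<omega> \<in> space \<Omega>. transcript \<pi> \<omega> \<in> T} \<in> sets \<Omega>" for t
      using measurable_sets[OF transcript_measurable, of "{t}"] measurable_sets[OF transcript_measurable, of T]
      by (auto simp: vimage_def Int_def conj_commute)
    have one: "measure \<Omega> {\<omega> \<in> space \<Omega>. transcript \<pi> \<omega> = t \<and> ?o \<omega> = (\<tau>, \<tau>, x, y)} = p x y * (\<integral>u. a u x t \<tau> * b u y t \<tau> \<partial>pub \<pi>)" for t \<tau> x y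
    proof -
      let ?Q = "\<lambda>\<omega>. transcript \<pi> \<omega> = t \<and> fst (?o \<omega>) = \<tau> \<and> fst (snd (?o \<omega>)) = \<tau>"
      have "{\<omega> \<in> space \<Omega>. transcript \<pi> \<omega> = t \<and> ?o \<omega> = (\<tau>, \<tau>, x, y)} = {\<omega> \<in> space \<Omega>. ?Q \<omega> \<and> fst \<omega> = (x, y)}"
        by (auto simp: sim_output_def Let_def split: prod.splits)
      also have "measure \<Omega> \<dots> = p x y * (\<integral>u. a u x t \<tau> * b u y t \<tau> \<partial>pub \<pi>)"
        unfolding a_def b_def p_def
      proof (rule prob_cong_rectangle[OF _ predA predB])
        have "(\<lambda>\<omega>. fst (?o \<omega>)) \<in> \<Omega> \<rightarrow>\<^sub>M count_space UNIV" "(\<lambda>\<omega>. fst (snd (?o \<omega>))) \<in> \<Omega> \<rightarrow>\<^sub>M count_space UNIV"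
          by (rule measurable_compose[OF out], simp)+
        then show "Measurable.pred \<Omega> ?Q"
          by (intro pred_intros_logic pred_eq_const transcript_measurable)
        have pf: "AE \<omega> in \<Omega>. \<forall>t\<in>pending \<pi> \<omega>. prefix_free (dom (next_book \<pi> \<omega> t))"
          using sd unfolding self_delimiting_def prefix_free_def .
        show "AE \<omega> in \<Omega>. fst \<omega> = (x, y) \<longrightarrow> ?Q \<omega> =
           ((complete \<pi> True ((x, undefined), fst (snd \<omega>), fst (snd (snd \<omega>)), undefined) t \<and> f x (fst (snd \<omega>)) (fst (snd (snd \<omega>))) t = \<tau>) \<and>
            (complete \<pi> False ((undefined, y), fst (snd \<omega>), undefined, snd (snd (snd \<omega>))) t \<and> g y (fst (snd \<omega>)) (snd (snd (snd \<omega>))) t = \<tau>))"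
          using AE_agree AE_stop AE_dom pf
        proof eventually_elim
          case (elim \<omega>)
          obtain x' y' u c d where \<omega>: "\<omega> = ((x', y'), u, c, d)" by (metis prod.collapse)
          note cc = complete_transcript[OF elim]
          have "transcript \<pi> \<omega> = t \<longleftrightarrow> complete \<pi> True \<omega> t \<and> complete \<pi> False \<omega> t"
            using cc complete_path[of \<pi> \<omega> t] transcript_eqI by blast
          then show ?case
            using complete_cong(1)[of \<pi> x' y' u c d t undefined undefined] complete_cong(2)[of \<pi> x' y' u c d t undefined undefined]
            unfolding \<omega> by (auto simp: sim_output_def Let_def)
        qed
      qed
      finally show ?thesis .
    qed
    have QT: "Q x y \<tau> = measure \<Omega> {\<omega> \<in> space \<Omega>. transcript \<pi> \<omega> \<in> T \<and> ?o \<omega> = (\<tau>, \<tau>, x, y)}" for x y \<tau>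
    proof -
      have "Q x y \<tau> = (\<Sum>t\<in>T. measure \<Omega> {\<omega> \<in> space \<Omega>. transcript \<pi> \<omega> = t \<and> ?o \<omega> = (\<tau>, \<tau>, x, y)})"
        unfolding one Q_def by (simp add: Bochner_Integration.integral_sum ab_integrable sum_distrib_left)
      also have "\<dots> = measure \<Omega> (\<Union>t\<in>T. {\<omega> \<in> space \<Omega>. transcript \<pi> \<omega> = t \<and> ?o \<omega> = (\<tau>, \<tau>, x, y)})"
      proof (rule sample.finite_measure_finite_Union[symmetric])
        have "{\<omega> \<in> space \<Omega>. transcript \<pi> \<omega> = t \<and> ?o \<omega> = (\<tau>, \<tau>, x, y)} = {\<omega> \<in> space \<Omega>. transcript \<pi> \<omega> = t} \<inter> {\<omega> \<in> space \<Omega>. ?o \<omega> = (\<tau>, \<tau>, x, y)}" for t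
          by auto
        then show "(\<lambda>t. {\<omega> \<in> space \<Omega>. transcript \<pi> \<omega> = t \<and> ?o \<omega> = (\<tau>, \<tau>, x, y)}) ` T \<subseteq> sets \<Omega>"
          using osets tsets by auto
      qed (auto simp: T disjoint_family_on_def)
      also have "(\<Union>t\<in>T. {\<omega> \<in> space \<Omega>. transcript \<pi> \<omega> = t \<and> ?o \<omega> = (\<tau>, \<tau>, x, y)}) = {\<omega> \<in> space \<Omega>. transcript \<pi> \<omega> \<in> T \<and> ?o \<omega> = (\<tau>, \<tau>, x, y)}"
        by auto
      finally show ?thesis .
    qed
    have Tsets: "{\<omega> \<in> space \<Omega>. transcript \<pi> \<omega> \<in> T \<and> ?o \<omega> = z} \<in> sets \<Omega>" "{\<omega> \<in> space \<Omega>. transcript \<pi> \<omega> \<notin> T \<and> ?o \<omega> = z} \<in> sets \<Omega>" for z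
    proof -
      have e: "{\<omega> \<in> space \<Omega>. transcript \<pi> \<omega> \<in> T \<and> ?o \<omega> = z} = {\<omega> \<in> space \<Omega>. transcript \<pi> \<omega> \<in> T} \<inter> {\<omega> \<in> space \<Omega>. ?o \<omega> = z}"
        "{\<omega> \<in> space \<Omega>. transcript \<pi> \<omega> \<notin> T \<and> ?o \<omega> = z} = {\<omega> \<in> space \<Omega>. ?o \<omega> = z} - {\<omega> \<in> space \<Omega>. transcript \<pi> \<omega> \<in> T}"
        by auto
      show "{\<omega> \<in> space \<Omega>. transcript \<pi> \<omega> \<in> T \<and> ?o \<omega> = z} \<in> sets \<Omega>"
        unfolding e(1) by (rule sets.Int[OF tsets(2) osets])
      show "{\<omega> \<in> space \<Omega>. transcript \<pi> \<omega> \<notin> T \<and> ?o \<omega> = z} \<in> sets \<Omega>"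
        unfolding e(2) by (rule sets.Diff[OF osets tsets(2)])
    qed
    \<comment> \<open>The outputs produced by transcripts outside \<open>T\<close>; their total mass
      is below \<open>\<eta>\<close>.\<close>
    define rest where "rest z = measure \<Omega> {\<omega> \<in> space \<Omega>. transcript \<pi> \<omega> \<notin> T \<and> ?o \<omega> = ?\<psi> z}" for z
    have q_split: "pmf q (\<tau>, \<tau>, x, y) = Q x y \<tau> + rest (\<tau>, x, y)" for \<tau> x y
    proof -
      have "pmf q (\<tau>, \<tau>, x, y) = measure \<Omega> {\<omega> \<in> space \<Omega>. ?o \<omega> = (\<tau>, \<tau>, x, y)}"
        using measure_distr[OF out, of "{(\<tau>, \<tau>, x, y)}"] unfolding q by (simp add: measure_pmf_single vimage_def Int_def conj_commute)
      also have "{\<omega> \<in> space \<Omega>. ?o \<omega> = (\<tau>, \<tau>, x, y)} = {\<omega> \<in> space \<Omega>. transcript \<pi> \<omega> \<in> T \<and> ?o \<omega> = (\<tau>, \<tau>, x, y)} \<union>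
          {\<omega> \<in> space \<Omega>. transcript \<pi> \<omega> \<notin> T \<and> ?o \<omega> = (\<tau>, \<tau>, x, y)}" by auto
      also have "measure \<Omega> \<dots> = Q x y \<tau> + rest (\<tau>, x, y)"
        unfolding QT rest_def using Tsets by (subst sample.finite_measure_Union) auto
      finally show ?thesis .
    qed
    have sumQ: "(\<Sum>x\<in>X. \<Sum>y\<in>Y. \<Sum>\<tau>\<in>F. Q x y \<tau>) \<le> 1"
    proof -
      have "(\<Sum>x\<in>X. \<Sum>y\<in>Y. \<Sum>\<tau>\<in>F. Q x y \<tau>) \<le> (\<Sum>x\<in>X. \<Sum>y\<in>Y. \<Sum>\<tau>\<in>F. pmf q (\<tau>, \<tau>, x, y))"
        unfolding q_split by (intro sum_mono) (simp add: rest_def)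
      also have "\<dots> = sum (pmf q) ((\<lambda>(x, y, \<tau>). (\<tau>, \<tau>, x, y)) ` (X \<times> Y \<times> F))"
        unfolding sum3 by (subst sum.reindex) (auto simp: inj_on_def case_prod_beta)
      also have "\<dots> = measure q ((\<lambda>(x, y, \<tau>). (\<tau>, \<tau>, x, y)) ` (X \<times> Y \<times> F))"
        using finXY by (simp add: measure_measure_pmf_finite)
      finally show ?thesis by (rule order_trans) simp
    qed
    have inX: "x \<in> X" "y \<in> Y" "\<tau> \<in> F" if "(\<tau>, x, y) \<in> E" for \<tau> x y
    proof -
      have "(\<tau>, x, y) \<in> set_pmf L" using that E(2) by blast
      then have "(x, y) \<in> set_pmf P" unfolding L[symmetric] by force
      then show "x \<in> X" "y \<in> Y" by (force simp: X_def Y_def)+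
      show "\<tau> \<in> F" using that by (force simp: F_def)
    qed
    have ov: "(\<Sum>x\<in>X. \<Sum>y\<in>Y. \<Sum>\<tau>\<in>F. min (Pm x y \<tau>) (Q x y \<tau>) * of_bool ((\<tau>, x, y) \<in> E)) \<le> 4 / S + S\<^sup>2 / sqrt ((1/2) ^ l * 2 powr \<nu>)"
    proof (rule overlap_le[OF sumQ])
      fix x y \<tau> assume z: "(\<tau>, x, y) \<in> E"
      let ?c = "\<lambda>_::'t. undefined :: 't"
      have zL: "(\<tau>, x, y) \<in> set_pmf L" "info_density (measure_pmf L) (\<tau>, x, y) > \<nu>" using z E(2) by blast+
      have fL: "snd ` snd ` set_pmf L = Y" "fst ` snd ` set_pmf L = X"
        unfolding X_def Y_def L[symmetric] by (simp_all add: image_image)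
      have j: "joint_mass L id \<tau>' x' y' = Pm x' y' \<tau>'" "joint_mass L ?c undefined x' y' = p x' y'" for \<tau>' x' y'
      proof -
        have "{z. id (fst z) = \<tau>' \<and> snd z = (x', y')} = {(\<tau>', x', y')}" by auto
        then show "joint_mass L id \<tau>' x' y' = Pm x' y' \<tau>'" by (simp add: joint_mass_def Pm_def measure_pmf_single)
        show "joint_mass L ?c undefined x' y' = p x' y'"
          by (simp add: joint_mass_def p_def L[symmetric] pmf_map vimage_def)
      qed
      have m: "mass1 L id \<tau> x = P1 x \<tau>" "mass2 L id \<tau> y = P2 y \<tau>" "mass1 L ?c undefined x = pX x" "mass2 L ?c undefined y = pY y"
        unfolding P1_def P2_def pX_def pY_def using finXY fL by (simp_all add: mass1_sum[of Y] mass2_sum[of X] j)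
      have pos: "Pm x y \<tau> > 0" using zL by (simp add: Pm_def pmf_positive)
      have "(x, y) \<in> set_pmf P" using zL(1) unfolding L[symmetric] by force
      then have pp: "p x y > 0" by (simp add: p_def pmf_positive)
      have "0 < P1 x \<tau>" "0 < P2 y \<tau>" "0 < pX x" "0 < pY y"
        unfolding m[symmetric] using joint_mass_le[of L id \<tau> x y] joint_mass_le[of L ?c undefined x y] pos pp by (simp_all add: j)
      then have pos2: "0 < P1 x \<tau> / pX x * (P2 y \<tau> / pY y)" by simp
      have X: "0 < (Pm x y \<tau> / p x y)\<^sup>2 / (P1 x \<tau> / pX x * (P2 y \<tau> / pY y))"
        using pos pp pos2 by (intro divide_pos_pos zero_less_power) auto
      have "\<nu> < log 2 ((Pm x y \<tau> / p x y)\<^sup>2 / (P1 x \<tau> / pX x * (P2 y \<tau> / pY y)))"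
        using zL(2) info_density_eq[OF zL(1), of ?c undefined] by (simp add: m j Pm_def)
      then have "2 powr \<nu> < (Pm x y \<tau> / p x y)\<^sup>2 / (P1 x \<tau> / pX x * (P2 y \<tau> / pY y))"
        by (subst (asm) less_log_iff[OF _ X]) simp_all
      from pos_less_divide_eq[OF pos2, THEN iffD1, OF this]
      have "P1 x \<tau> / pX x * (P2 y \<tau> / pY y) * 2 powr \<nu> \<le> (Pm x y \<tau> / p x y)\<^sup>2"
        by (subst mult.commute) (rule less_imp_le)
      then show "p x y > 0 \<and> Pm x y \<tau> > 0 \<and> P1 x \<tau> / pX x * (P2 y \<tau> / pY y) * 2 powr \<nu> \<le> (Pm x y \<tau> / p x y)\<^sup>2"
        using pos pp by blast
    qed simp
    have "S\<^sup>2 / sqrt ((1/2) ^ l * 2 powr \<nu>) = S\<^sup>2 * 2 powr ((real l - \<nu>) / 2)"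
    proof -
      have "(1/2::real) ^ l * 2 powr \<nu> = 2 powr (\<nu> - real l)"
        by (simp add: powr_diff powr_realpow power_one_over)
      then have "sqrt ((1/2) ^ l * 2 powr \<nu>) = 2 powr ((\<nu> - real l) / 2)"
        by (simp add: powr_half_sqrt[symmetric] powr_powr)
      moreover have "(real l - \<nu>) / 2 = - ((\<nu> - real l) / 2)" by (simp add: field_simps)
      ultimately show ?thesis by (simp only: powr_minus_divide) simp
    qed
    note ov = ov[unfolded this]
    have EP: "(\<Sum>z\<in>E. min (pmf L z) (case z of (\<tau>, x, y) \<Rightarrow> Q x y \<tau>)) \<le> ?bound"
    proof -
      have "(\<Sum>z\<in>E. min (pmf L z) (case z of (\<tau>, x, y) \<Rightarrow> Q x y \<tau>)) =
        (\<Sum>(x, y, \<tau>)\<in>(\<lambda>(\<tau>, x, y). (x, y, \<tau>)) ` E. min (Pm x y \<tau>) (Q x y \<tau>))"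
        by (subst sum.reindex) (auto simp: inj_on_def case_prod_beta Pm_def)
      also have "\<dots> = (\<Sum>(x, y, \<tau>)\<in>X \<times> Y \<times> F. min (Pm x y \<tau>) (Q x y \<tau>) * of_bool ((\<tau>, x, y) \<in> E))"
        using inX finXY by (intro sum.mono_neutral_cong_left) (auto simp: image_iff)
      finally show ?thesis using ov unfolding sum3 by simp
    qed
    have Erest: "(\<Sum>z\<in>E. rest z) \<le> \<eta>"
    proof -
      have "(\<Sum>z\<in>E. rest z) = measure \<Omega> (\<Union>z\<in>E. {\<omega> \<in> space \<Omega>. transcript \<pi> \<omega> \<notin> T \<and> ?o \<omega> = ?\<psi> z})"
        unfolding rest_def using Tsets E(1)
        by (intro sample.finite_measure_finite_Union[symmetric]) (auto simp: disjoint_family_on_def)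
      also have "\<dots> \<le> measure \<Omega> (transcript \<pi> -` (- T) \<inter> space \<Omega>)"
        by (intro sample.finite_measure_mono measurable_sets[OF transcript_measurable]) auto
      also have "\<dots> = measure r (- T)"
        using measure_distr[OF transcript_measurable, of "- T"] unfolding r by simp
      finally show ?thesis using T(2) by simp
    qed
    \<comment> \<open>The part of \<open>E\<close> on which the true law exceeds the simulated one;
      elsewhere the minimum is the true law.\<close>
    define E1 where "E1 = {z \<in> E. pmf q (?\<psi> z) < pmf L z}"
    have finE1: "finite E1" using E(1) by (simp add: E1_def)
    have "(\<Sum>z\<in>E1. pmf L z - pmf q (?\<psi> z)) = measure (map_pmf ?\<psi> L) (?\<psi> ` E1) - measure q (?\<psi> ` E1)"
    proof -
      have "measure (map_pmf ?\<psi> L) (?\<psi> ` E1) = (\<Sum>z\<in>E1. pmf L z)"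
        unfolding measure_map_pmf inj_vimage_image_eq[OF inj] using finE1 by (rule measure_measure_pmf_finite)
      moreover have "measure q (?\<psi> ` E1) = (\<Sum>z\<in>E1. pmf q (?\<psi> z))"
        using finE1 by (simp add: measure_measure_pmf_finite sum.reindex[OF inj_on_subset[OF inj]])
      ultimately show ?thesis by (simp add: sum_subtractf)
    qed
    also have "\<dots> \<le> \<epsilon>" using measure_diff_le_d_var dv' by (rule order_trans)
    finally have E1: "(\<Sum>z\<in>E1. pmf L z - pmf q (?\<psi> z)) \<le> \<epsilon>" .
    have "measure L E = (\<Sum>z\<in>E. pmf L z)" using E(1) by (rule measure_measure_pmf_finite)
    also have "\<dots> = (\<Sum>z\<in>E. min (pmf L z) (pmf q (?\<psi> z))) + (\<Sum>z\<in>E. (pmf L z - pmf q (?\<psi> z)) * of_bool (z \<in> E1))"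
      unfolding sum.distrib[symmetric] by (intro sum.cong) (auto simp: E1_def)
    also have "(\<Sum>z\<in>E. (pmf L z - pmf q (?\<psi> z)) * of_bool (z \<in> E1)) = (\<Sum>z\<in>E1. pmf L z - pmf q (?\<psi> z))"
      using E(1) by (intro sum.mono_neutral_cong_right) (auto simp: E1_def)
    also have "(\<Sum>z\<in>E. min (pmf L z) (pmf q (?\<psi> z))) \<le> (\<Sum>z\<in>E. min (pmf L z) (case z of (\<tau>, x, y) \<Rightarrow> Q x y \<tau>) + rest z)"
    proof (rule sum_mono)
      fix z assume "z \<in> E"
      obtain \<tau> x y where z: "z = (\<tau>, x, y)" by (metis prod.collapse)
      have "0 \<le> rest z" by (simp add: rest_def)
      then show "min (pmf L z) (pmf q (?\<psi> z)) \<le> min (pmf L z) (case z of (\<tau>, x, y) \<Rightarrow> Q x y \<tau>) + rest z"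
        by (simp add: z q_split min_def)
    qed
    also have "\<dots> \<le> ?bound + \<eta>" unfolding sum.distrib using EP Erest by (rule add_mono)
    finally show ?thesis using E1 by linarith
  qed
  have "measure L ?D = infsum (pmf L) ?D" using pmf_has_sum[of L ?D] by (simp add: infsumI)
  also have "\<dots> \<le> \<epsilon> + ?bound"
  proof (rule infsum_le_finite_sums)
    show "pmf L summable_on ?D" using pmf_has_sum[of L ?D] by (auto simp: summable_on_def)
    fix E assume E: "finite E" "E \<subseteq> ?D"
    have "measure L E \<le> \<epsilon> + ?bound"
      by (rule field_le_epsilon) (rule bound[OF E])
    then show "sum (pmf L) E \<le> \<epsilon> + ?bound" using E(1) by (simp add: measure_measure_pmf_finite)
  qed
  finally show ?thesis .
qed

section \<open>Independent copies and the central limit theorem\<close>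

section \<open>Independent repetitions\<close>

lemma pmf_replicate_pmf: "length zs = n \<Longrightarrow> pmf (replicate_pmf n p) zs = (\<Prod>i<n. pmf p (zs ! i))"
proof (induction n arbitrary: zs)
  case (Suc n)
  then obtain z ws where zs: "zs = z # ws" "length ws = n" by (cases zs) auto
  have "replicate_pmf (Suc n) p = map_pmf (\<lambda>(x, xs). x # xs) (pair_pmf p (replicate_pmf n p))"
    by (simp add: pair_pmf_def map_bind_pmf map_pmf_def[symmetric] bind_return_pmf bind_assoc_pmf map_pmf_comp)
  moreover have "pmf (map_pmf (\<lambda>(x, xs). x # xs) (pair_pmf p (replicate_pmf n p))) ((\<lambda>(x, xs). x # xs) (z, ws)) =
      pmf (pair_pmf p (replicate_pmf n p)) (z, ws)"
    by (rule pmf_map_inj') (auto simp: inj_def)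
  ultimately have "pmf (replicate_pmf (Suc n) p) zs = pmf p z * pmf (replicate_pmf n p) ws"
    by (simp add: zs pmf_pair)
  then show ?case using Suc.IH[OF zs(2)] by (simp add: zs prod.lessThan_Suc_shift del: prod.lessThan_Suc)
qed simp

text \<open>Used with \<open>{..<n}\<close> for the product protocol and with \<open>UNIV\<close>
  for the infinite sequence.\<close>

lemma distr_PiM_map:
  fixes X :: "'a \<Rightarrow> 'z :: countable"
  assumes M: "prob_space M" and X: "X \<in> M \<rightarrow>\<^sub>M count_space UNIV" and p: "distr M (count_space UNIV) X = measure_pmf p"
    and I: "{..<n} \<subseteq> I"
  shows "(\<lambda>\<omega>. map (\<lambda>i. X (\<omega> i)) [0..<n]) \<in> PiM I (\<lambda>_. M) \<rightarrow>\<^sub>M count_space UNIV"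
    and "distr (PiM I (\<lambda>_. M)) (count_space UNIV) (\<lambda>\<omega>. map (\<lambda>i. X (\<omega> i)) [0..<n]) = measure_pmf (replicate_pmf n p)"
proof -
  interpret M: prob_space M by (rule M)
  interpret product_prob_space "\<lambda>_. M" I by unfold_locales
  let ?N = "PiM I (\<lambda>_. M)" and ?Y = "\<lambda>\<omega>. map (\<lambda>i. X (\<omega> i)) [0..<n]"
  have XS: "X -` {z} \<inter> space M \<in> sets M" for z using X by (rule measurable_sets) simp
  have Y: "?Y -` {zs} \<inter> space ?N = (if length zs = n then {\<omega> \<in> space ?N. \<forall>i\<in>{..<n}. \<omega> i \<in> X -` {zs ! i} \<inter> space M} else {})" for zs
  proof (cases "length zs = n")
    case True
    then have "?Y \<omega> = zs \<longleftrightarrow> (\<forall>i<n. X (\<omega> i) = zs ! i)" for \<omega>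
      by (simp add: list_eq_iff_nth_eq)
    moreover have "\<omega> i \<in> space M" if "\<omega> \<in> space ?N" "i < n" for \<omega> i
      using that I by (auto simp: space_PiM)
    ultimately show ?thesis using True by auto
  next
    case False
    then have "?Y \<omega> \<noteq> zs" for \<omega> by auto
    then show ?thesis using False by auto
  qed
  have Ym: "?Y -` {zs} \<inter> space ?N \<in> sets ?N" for zs
  proof -
    have "{\<omega> \<in> space ?N. \<forall>i\<in>{..<n}. \<omega> i \<in> X -` {zs ! i} \<inter> space M} \<in> sets ?N"
    proof (rule sets.sets_Collect_finite_All)
      fix i assume "i \<in> {..<n}"
      then have "(\<lambda>\<omega>. \<omega> i) \<in> ?N \<rightarrow>\<^sub>M M" using I by (intro measurable_component_singleton) auto
      from measurable_sets[OF this XS] have "(\<lambda>\<omega>. \<omega> i) -` (X -` {zs ! i} \<inter> space M) \<inter> space ?N \<in> sets ?N" .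
      also have "(\<lambda>\<omega>. \<omega> i) -` (X -` {zs ! i} \<inter> space M) \<inter> space ?N = {\<omega> \<in> space ?N. \<omega> i \<in> X -` {zs ! i} \<inter> space M}" by auto
      finally show "{\<omega> \<in> space ?N. \<omega> i \<in> X -` {zs ! i} \<inter> space M} \<in> sets ?N" .
    qed simp
    then show ?thesis unfolding Y by auto
  qed
  show meas: "?Y \<in> ?N \<rightarrow>\<^sub>M count_space UNIV"
    by (rule measurable_count_space_eq2_countable[THEN iffD2]) (use Ym in auto)
  show "distr ?N (count_space UNIV) ?Y = measure_pmf (replicate_pmf n p)"
  proof (rule measure_eqI_countable[of _ UNIV])
    fix zs :: "'z list"
    have "emeasure (distr ?N (count_space UNIV) ?Y) {zs} = emeasure ?N (?Y -` {zs} \<inter> space ?N)"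
      using meas by (simp add: emeasure_distr)
    also have "\<dots> = emeasure (measure_pmf (replicate_pmf n p)) {zs}"
    proof (cases "length zs = n")
      case False
      then have "zs \<notin> set_pmf (replicate_pmf n p)" by (auto simp: set_replicate_pmf)
      then show ?thesis using False by (simp add: Y emeasure_pmf_single set_pmf_iff)
    next
      case True
      have "emeasure ?N (?Y -` {zs} \<inter> space ?N) = (\<Prod>i<n. emeasure M (X -` {zs ! i} \<inter> space M))"
        unfolding Y using I XS by (simp only: True if_True refl) (intro emeasure_PiM_Collect; simp)
      also have "\<dots> = (\<Prod>i<n. ennreal (pmf p (zs ! i)))"
        using emeasure_distr[OF X] p by (intro prod.cong refl) (metis UNIV_I emeasure_pmf_single sets_count_space Pow_UNIV)
      also have "\<dots> = emeasure (measure_pmf (replicate_pmf n p)) {zs}"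
        using True by (simp add: emeasure_pmf_single pmf_replicate_pmf prod_ennreal)
      finally show ?thesis .
    qed
    finally show "emeasure (distr ?N (count_space UNIV) ?Y) {zs} = emeasure (measure_pmf (replicate_pmf n p)) {zs}" .
  qed auto
qed

text \<open>The central limit theorem is applied to one infinite sequence on a single probability
  space; \<open>replicate_pmf n p\<close> is the law of its first \<open>n\<close> terms.\<close>

definition iid :: "'z pmf \<Rightarrow> (nat \<Rightarrow> 'z) measure" where
  "iid p = PiM UNIV (\<lambda>_. measure_pmf p)"

lemma prob_space_iid: "prob_space (iid p)"
  unfolding iid_def by (intro prob_space_PiM measure_pmf.prob_space_axioms)

lemma measure_replicate_pmf:
  fixes p :: "'z::countable pmf"
  shows "measure (replicate_pmf n p) S = measure (iid p) {\<omega> \<in> space (iid p). map \<omega> [0..<n] \<in> S}"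
proof -
  have "distr (measure_pmf p) (count_space UNIV) (\<lambda>x. x) = measure_pmf p"
    by (metis distr_id2 sets_measure_pmf sets_count_space Pow_UNIV)
  note * = distr_PiM_map[OF measure_pmf.prob_space_axioms _ this, of n UNIV, simplified, folded iid_def]
  show ?thesis
    unfolding *(2)[symmetric] using *(1) by (simp add: measure_distr vimage_def Int_def conj_commute)
qed

lemma measure_replicate_pmf_prod:
  fixes p :: "'z::countable pmf"
  shows "measure (replicate_pmf n p) {zs. \<forall>i<n. zs ! i \<in> A i} = (\<Prod>i<n. measure p (A i))"
proof -
  interpret product_prob_space "\<lambda>_::nat. measure_pmf p" UNIV by unfold_locales
  have "measure (replicate_pmf n p) {zs. \<forall>i<n. zs ! i \<in> A i} = measure (iid p) {\<omega> \<in> space (iid p). \<forall>i\<in>{..<n}. \<omega> i \<in> A i}"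
    unfolding measure_replicate_pmf by (intro arg_cong[where f = "measure _"]) auto
  also have "\<dots> = (\<Prod>i<n. measure p (A i))"
    unfolding iid_def measure_def by (subst emeasure_PiM_Collect) (auto simp: measure_pmf.emeasure_eq_measure prod_ennreal prod_nonneg)
  finally show ?thesis .
qed

lemma indep_vars_iid:
  fixes h :: "'z \<Rightarrow> real"
  shows "prob_space.indep_vars (iid p) (\<lambda>_. borel) (\<lambda>i \<omega>. h (\<omega> i)) UNIV"
proof -
  interpret prob_space "iid p" by (rule prob_space_iid)
  have comp: "distr (iid p) (measure_pmf p) (\<lambda>\<omega>. \<omega> i) = measure_pmf p" for i
    unfolding iid_def by (rule distr_PiM_component) (auto intro: measure_pmf.prob_space_axioms)
  have "indep_vars (\<lambda>_. measure_pmf p) (\<lambda>i \<omega>. \<omega> i) UNIV"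
  proof (subst indep_vars_iff_distr_eq_PiM)
    show "distr (iid p) (PiM UNIV (\<lambda>_. measure_pmf p)) (\<lambda>x. \<lambda>i\<in>UNIV. x i) = PiM UNIV (\<lambda>i. distr (iid p) (measure_pmf p) (\<lambda>\<omega>. \<omega> i))"
    proof -
      have "(\<lambda>x::nat \<Rightarrow> 'z. restrict x UNIV) = (\<lambda>x. x)" by (simp add: fun_eq_iff)
      then show ?thesis unfolding comp by (simp add: iid_def distr_id2)
    qed
  qed (auto simp: iid_def)
  then show ?thesis by (rule indep_vars_compose2) simp
qed

lemma distr_iid_component:
  fixes h :: "'z \<Rightarrow> real"
  shows "distr (iid p) borel (\<lambda>\<omega>. h (\<omega> i)) = distr (measure_pmf p) borel h"
proof -
  have comp: "distr (iid p) (measure_pmf p) (\<lambda>\<omega>. \<omega> i) = measure_pmf p"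
    unfolding iid_def by (rule distr_PiM_component) (auto intro: measure_pmf.prob_space_axioms)
  have "distr (measure_pmf p) borel h = distr (distr (iid p) (measure_pmf p) (\<lambda>\<omega>. \<omega> i)) borel h" by (simp add: comp)
  also have "\<dots> = distr (iid p) borel (h \<circ> (\<lambda>\<omega>. \<omega> i))"
    by (rule distr_distr) (auto simp: iid_def)
  finally show ?thesis by (simp add: comp_def)
qed

section \<open>The normal tail\<close>

interpretation std_normal: real_distribution std_normal_distribution
  by (rule real_dist_normal_dist)

lemma Q_tail_cdf: "Q_tail x = 1 - cdf std_normal_distribution x"
proof -
  have "{x<..} = UNIV - {..x}" by auto
  then show ?thesis
    using std_normal.prob_compl[of "{..x}"] by (simp add: Q_tail_def cdf_def)
qed

lemma std_normal_singleton: "measure std_normal_distribution {x} = 0"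
  by (simp add: measure_def emeasure_density nn_integral_null_set AE_iff_null_sets nn_integral_0_iff_AE null_sets_def)

lemma isCont_std_normal_cdf: "isCont (cdf std_normal_distribution) x"
  by (simp add: std_normal.isCont_cdf std_normal_singleton)

text \<open>The density is positive, so every interval has positive mass. Strictness turns a shift
  of the argument into a gap of probabilities on both sides of \<epsilon>.\<close>

lemma Q_tail_strict_antimono:
  assumes "x < y" shows "Q_tail y < Q_tail x"
proof -
  have "Q_tail x - Q_tail y = measure std_normal_distribution {x<..y}"
    using std_normal.cdf_diff_eq[OF assms] by (simp add: Q_tail_cdf)
  moreover have "measure std_normal_distribution {x<..y} \<noteq> 0"
  proof
    assume "measure std_normal_distribution {x<..y} = 0"
    then have "emeasure std_normal_distribution {x<..y} = 0" by (simp add: std_normal.emeasure_eq_measure)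
    moreover have "std_normal_density z \<noteq> 0" for z using normal_density_pos[of 1 0 z] by simp
    ultimately have "AE z in lborel. z \<notin> {x<..y}"
      by (subst (asm) emeasure_density) (auto simp: nn_integral_0_iff_AE indicator_def elim!: eventually_mono split: if_splits)
    then have "emeasure lborel {x<..y} = 0"
      by (subst (asm) AE_iff_measurable[OF _ refl]) (auto simp: greaterThanAtMost_def greaterThan_def atMost_def Int_def)
    then show False using assms by simp
  qed
  ultimately show ?thesis using measure_nonneg[of std_normal_distribution "{x<..y}"] by linarith
qed

lemma Q_tail_at_top: "(Q_tail \<longlongrightarrow> 0) at_top" and Q_tail_at_bot: "(Q_tail \<longlongrightarrow> 1) at_bot"
  unfolding Q_tail_cdf[abs_def]
  using tendsto_diff[OF tendsto_const[of 1] std_normal.cdf_lim_at_top_prob] tendsto_diff[OF tendsto_const[of 1] std_normal.cdf_lim_at_bot]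
  by simp_all

text \<open>\<open>inv\<close> returns a preimage if there is one; continuity and the two limits
  provide it.\<close>

lemma Q_tail_inv:
  assumes "0 < \<epsilon>" "\<epsilon> < 1" shows "Q_tail (inv Q_tail \<epsilon>) = \<epsilon>"
proof -
  obtain x1 where x1: "Q_tail x1 < \<epsilon>"
    using order_tendstoD(2)[OF Q_tail_at_top assms(1)] by (auto simp: eventually_at_top_linorder)
  obtain x2 where x2: "Q_tail x2 > \<epsilon>"
    using order_tendstoD(1)[OF Q_tail_at_bot assms(2)] by (auto simp: eventually_at_bot_linorder)
  have "x2 \<le> x1" using Q_tail_strict_antimono[of x1 x2] x1 x2 by (cases "x1 < x2") auto
  moreover have "\<forall>x. x2 \<le> x \<and> x \<le> x1 \<longrightarrow> isCont Q_tail x"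
    unfolding Q_tail_cdf[abs_def] using isCont_std_normal_cdf by (auto intro: continuous_intros)
  ultimately obtain x where "Q_tail x = \<epsilon>" using IVT2[of Q_tail x1 \<epsilon> x2] x1 x2 by (auto simp: less_imp_le)
  then show ?thesis by (intro f_inv_into_f) auto
qed

section \<open>Tails of sums\<close>

locale square_integrable =
  fixes p :: "'z::countable pmf" and h :: "'z \<Rightarrow> real" and m v :: real
  assumes integrable_square: "integrable p (\<lambda>z. (h z)\<^sup>2)"
    and m: "m = (\<integral>z. h z \<partial>p)" and v: "v = (\<integral>z. (h z - m)\<^sup>2 \<partial>p)"
begin

definition sum_of :: "'z list \<Rightarrow> real" where "sum_of zs = sum_list (map h zs)"

lemma integrable: "integrable p h"
  by (rule measure_pmf.square_integrable_imp_integrable[OF _ integrable_square]) simp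

text \<open>The normal distribution function is continuous, so weak convergence gives the limit at
  every \<open>a\<close>; the strict tail is the complement of the event in the distribution
  function.\<close>

lemma clt_tail:
  assumes "v > 0"
  shows "(\<lambda>n. measure (replicate_pmf n p) {zs. sum_of zs > real n * m + sqrt (real n * v) * a}) \<longlonglongrightarrow> Q_tail a"
proof -
  interpret P: prob_space "iid p" by (rule prob_space_iid)
  have hm: "h \<in> borel_measurable (measure_pmf p)" by simp
  have cm: "(\<lambda>\<omega>. h (\<omega> i)) \<in> borel_measurable (iid p)" for i
    using measurable_compose[OF measurable_component_singleton[of i UNIV "\<lambda>_. measure_pmf p"] hm] by (simp add: iid_def)
  have int: "(\<integral>\<omega>. f (h (\<omega> i)) \<partial>iid p) = (\<integral>z. f (h z) \<partial>p)" if "f \<in> borel_measurable borel" for f :: "real \<Rightarrow> real" and i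
    using integral_distr[OF cm[of i] that] integral_distr[OF hm that] by (simp add: distr_iid_component)
  have integ: "integrable (iid p) (\<lambda>\<omega>. (h (\<omega> i))\<^sup>2)" for i
    using integrable_distr_eq[OF cm[of i], of "\<lambda>x. x\<^sup>2"] integrable_distr_eq[OF hm, of "\<lambda>x. x\<^sup>2"] integrable_square
    by (simp add: distr_iid_component)
  have "weak_conv_m (\<lambda>n. distr (iid p) borel (\<lambda>\<omega>. (\<Sum>i<n. h (\<omega> i) - m) / sqrt (real n * (sqrt v)\<^sup>2))) std_normal_distribution"
  proof (rule P.central_limit_theorem[where X = "\<lambda>i \<omega>. h (\<omega> i)" and \<sigma> = "sqrt v" and \<mu> = "distr (measure_pmf p) borel h"])
    show "P.indep_vars (\<lambda>i. borel) (\<lambda>i \<omega>. h (\<omega> i)) UNIV" by (rule indep_vars_iid)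
    show "(\<integral>\<omega>. h (\<omega> n) \<partial>iid p) = m" for n using int[of "\<lambda>x. x"] by (simp add: m)
    then show "(\<integral>\<omega>. (h (\<omega> n) - (\<integral>\<omega>. h (\<omega> n) \<partial>iid p))\<^sup>2 \<partial>iid p) = (sqrt v)\<^sup>2" for n
      using int[of "\<lambda>x. (x - m)\<^sup>2"] assms by (simp add: v)
  qed (use assms integ distr_iid_component in auto)
  then have lim: "(\<lambda>n. cdf (distr (iid p) borel (\<lambda>\<omega>. (\<Sum>i<n. h (\<omega> i) - m) / sqrt (real n * v))) a) \<longlonglongrightarrow> cdf std_normal_distribution a"
    using assms isCont_std_normal_cdf[of a] by (simp add: weak_conv_m_def weak_conv_def)
  have "measure (replicate_pmf n p) {zs. sum_of zs > real n * m + sqrt (real n * v) * a} =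
     1 - cdf (distr (iid p) borel (\<lambda>\<omega>. (\<Sum>i<n. h (\<omega> i) - m) / sqrt (real n * v))) a" if n: "n > 0" for n
  proof -
    let ?Z = "\<lambda>\<omega>. (\<Sum>i<n. h (\<omega> i) - m) / sqrt (real n * v)"
    have Zm: "?Z \<in> borel_measurable (iid p)" using cm by simp
    have s: "sqrt (real n * v) > 0" using n assms by simp
    have "measure (replicate_pmf n p) {zs. sum_of zs > real n * m + sqrt (real n * v) * a} = measure (iid p) {\<omega> \<in> space (iid p). \<not> ?Z \<omega> \<le> a}"
      unfolding measure_replicate_pmf
    proof (intro arg_cong[where f = "measure _"] Collect_cong conj_cong refl)
      fix \<omega>
      have "sum_of (map \<omega> [0..<n]) = (\<Sum>i<n. h (\<omega> i))"
        by (simp add: sum_of_def comp_def interv_sum_list_conv_sum_set_nat atLeast0LessThan)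
      then show "(map \<omega> [0..<n] \<in> {zs. sum_of zs > real n * m + sqrt (real n * v) * a}) = (\<not> ?Z \<omega> \<le> a)"
        using s by (simp add: pos_divide_le_eq sum_subtractf not_le algebra_simps)
    qed
    also have "{\<omega> \<in> space (iid p). \<not> ?Z \<omega> \<le> a} = space (iid p) - {\<omega> \<in> space (iid p). ?Z \<omega> \<le> a}" by auto
    also have "measure (iid p) \<dots> = 1 - measure (iid p) {\<omega> \<in> space (iid p). ?Z \<omega> \<le> a}"
      using Zm by (intro P.prob_compl) simp
    also have "measure (iid p) {\<omega> \<in> space (iid p). ?Z \<omega> \<le> a} = cdf (distr (iid p) borel ?Z) a"
      unfolding cdf_def using Zm by (subst measure_distr) (auto simp: vimage_def Int_def conj_commute)
    finally show ?thesis .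
  qed
  then have ev: "\<forall>\<^sub>F n in sequentially. 1 - cdf (distr (iid p) borel (\<lambda>\<omega>. (\<Sum>i<n. h (\<omega> i) - m) / sqrt (real n * v))) a =
      measure (replicate_pmf n p) {zs. sum_of zs > real n * m + sqrt (real n * v) * a}"
    by (intro eventually_sequentiallyI[of 1]) auto
  have "(\<lambda>n. 1 - cdf (distr (iid p) borel (\<lambda>\<omega>. (\<Sum>i<n. h (\<omega> i) - m) / sqrt (real n * v))) a) \<longlonglongrightarrow> 1 - cdf std_normal_distribution a"
    by (intro tendsto_diff tendsto_const lim)
  then show ?thesis unfolding Q_tail_cdf using ev by (rule Lim_transform_eventually)
qed

text \<open>The exponent 5/8 exceeds 1/2, so the threshold eventually passes every fixed multiple of
  the standard deviation, and the limits \<open>Q_tail a\<close> are arbitrarily small.\<close>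

lemma upper_tail:
  "(\<lambda>n. measure (replicate_pmf n p) {zs. sum_of zs > real n * m + real n powr (5 / 8)}) \<longlonglongrightarrow> 0"
proof (cases "v > 0")
  case True
  show ?thesis
  proof (rule tendstoI)
    fix e :: real assume "0 < e"
    obtain a where a: "Q_tail a < e"
      using order_tendstoD(2)[OF Q_tail_at_top \<open>0 < e\<close>] by (auto simp: eventually_at_top_linorder)
    have "filterlim (\<lambda>n::nat. real n powr (1/8)) at_top sequentially" by real_asymp
    then have "\<forall>\<^sub>F n::nat in sequentially. sqrt v * a \<le> real n powr (1/8)" by (rule filterlim_at_top[THEN iffD1, rule_format])
    then have "\<forall>\<^sub>F n::nat in sequentially. sqrt (real n * v) * a \<le> real n powr (5/8)"
    proof eventually_elim
      case (elim n)
      have "sqrt (real n * v) * a = sqrt (real n) * (sqrt v * a)" by (simp add: real_sqrt_mult)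
      also have "\<dots> \<le> sqrt (real n) * real n powr (1/8)" using elim by (intro mult_left_mono) auto
      also have "\<dots> = real n powr (1/2) * real n powr (1/8)" by (simp add: powr_half_sqrt)
      also have "\<dots> = real n powr (5/8)" by (simp flip: powr_add)
      finally show ?case .
    qed
    moreover have "\<forall>\<^sub>F n::nat in sequentially. measure (replicate_pmf n p) {zs. sum_of zs > real n * m + sqrt (real n * v) * a} < e"
      using clt_tail[OF True, of a] a by (rule order_tendstoD)
    ultimately show "\<forall>\<^sub>F n in sequentially. dist (measure (replicate_pmf n p) {zs. sum_of zs > real n * m + real n powr (5 / 8)}) 0 < e"
    proof eventually_elim
      case (elim n)
      have "measure (replicate_pmf n p) {zs. sum_of zs > real n * m + real n powr (5 / 8)} \<le> measure (replicate_pmf n p) {zs. sum_of zs > real n * m + sqrt (real n * v) * a}"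
        using elim(1) by (intro measure_pmf.finite_measure_mono) auto
      then show ?case using elim(2) by (simp add: dist_real_def)
    qed
  qed
next
  \<comment> \<open>The density of a single round may have variance zero even if that of the whole
    transcript has not. The sum then equals its mean almost surely.\<close>
  case False
  have vint: "integrable p (\<lambda>z. (h z - m)\<^sup>2)"
    using integrable_square integrable by (simp add: power2_diff)
  moreover have "v \<ge> 0" by (simp add: v)
  ultimately have "(\<integral>z. (h z - m)\<^sup>2 \<partial>p) = 0" using False v by linarith
  then have "AE z in p. (h z - m)\<^sup>2 = 0"
    using integral_nonneg_eq_0_iff_AE[OF vint] by simp
  then have hm: "h z = m" if "z \<in> set_pmf p" for z using that by (simp add: AE_measure_pmf_iff)
  have "measure (replicate_pmf n p) {zs. sum_of zs > real n * m + real n powr (5 / 8)} = 0" for n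
  proof -
    have "sum_of zs = real n * m" if "zs \<in> set_pmf (replicate_pmf n p)" for zs
    proof -
      have 1: "map h zs = map (\<lambda>_. m) zs" and 2: "length zs = n" using that hm by (auto simp: set_replicate_pmf)
      show ?thesis unfolding sum_of_def 1 by (simp add: sum_list_triv 2)
    qed
    then show ?thesis by (subst measure_pmf_zero_iff) auto
  qed
  then show ?thesis by simp
qed

end

lemma lower_tail:
  assumes "square_integrable p h m v"
  shows "(\<lambda>n. measure (replicate_pmf n p) {zs. square_integrable.sum_of h zs < real n * m - real n powr (5 / 8)}) \<longlonglongrightarrow> 0"
proof -
  interpret square_integrable p h m v by (rule assms)
  interpret neg: square_integrable p "\<lambda>z. - h z" "- m" v
    using integrable_square by unfold_locales (simp_all add: m v power2_commute)
  have "neg.sum_of zs = - sum_of zs" for zs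
    by (simp add: sum_of_def neg.sum_of_def uminus_sum_list_map comp_def)
  then have "{zs. neg.sum_of zs > real n * - m + real n powr (5 / 8)} = {zs. sum_of zs < real n * m - real n powr (5 / 8)}" for n :: nat
    by auto
  then show ?thesis using neg.upper_tail by simp
qed

section \<open>Telescoping, lower tails and second moments of the log-likelihood ratios\<close>

section \<open>Densities of the rounds\<close>

context round_law
begin

definition round_density :: "nat \<Rightarrow> 't \<times> 'x \<times> 'y \<Rightarrow> real" where
  "round_density k = (\<lambda>(\<tau>, x, y). llr k (\<phi> (Suc k) \<tau>) x y)"

text \<open>Its increments are the densities of the rounds, and its increment over all rounds is the
  information density.\<close>

definition potential :: "nat \<Rightarrow> 't \<times> 'x \<times> 'y \<Rightarrow> real" where
  "potential k = (\<lambda>(\<tau>, x, y). 2 * log 2 (J k (\<phi> k \<tau>) x y) - log 2 (JX k (\<phi> k \<tau>) x) - log 2 (JY k (\<phi> k \<tau>) y))"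

lemma round_density_eq:
  assumes "z \<in> set_pmf L"
  shows "round_density k z = potential (Suc k) z - potential k z"
proof -
  obtain \<tau> x y where z: "z = (\<tau>, x, y)" by (metis prod.collapse)
  have L: "(\<tau>, x, y) \<in> set_pmf L" using assms z by simp
  show ?thesis
    unfolding round_density_def z case_prod_conv llr_def A1_def A2_def potential_def \<phi>_\<phi>
    using J_pos[OF L, of k] J_pos[OF L, of "Suc k"] by (simp add: log_divide log_mult power2_eq_square)
qed

lemma info_density_eq_sum:
  assumes "z \<in> set_pmf L"
  shows "info_density (measure_pmf L) z = (\<Sum>k<d. round_density k z)"
proof -
  obtain \<tau> x y where z: "z = (\<tau>, x, y)" by (metis prod.collapse)
  have L: "(\<tau>, x, y) \<in> set_pmf L" using assms z by simp
  note pos = J_pos[OF L]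
  have "(\<Sum>k<d. round_density k z) = potential d z - potential 0 z"
    using round_density_eq[OF assms] sum_lessThan_telescope[of "\<lambda>k. potential k z" d] by simp
  also have "\<dots> = info_density (measure_pmf L) z"
  proof -
    have c: "\<And>\<tau>'. \<phi> 0 \<tau>' = \<phi> 0 \<tau>" using \<phi>_0 by blast
    have \<phi>d: "\<phi> d \<tau> = \<tau>" using \<phi>_d[OF L] by simp
    have AEd: "AE z in measure_pmf L. \<phi> d (fst z) = fst z" using \<phi>_d by (simp add: AE_measure_pmf_iff)
    have "J d \<tau> x y = measure L {(\<tau>, x, y)}"
      unfolding J_def joint_mass_def by (intro measure_eq_AE) (use AEd in \<open>auto elim!: eventually_mono simp: prod_eq_iff\<close>)
    then have Jd: "J d \<tau> x y = pmf L (\<tau>, x, y)" by (simp add: measure_pmf_single)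
    have Md: "JX d \<tau> x = mass1 L id \<tau> x" "JY d \<tau> y = mass2 L id \<tau> y"
      unfolding JX_def JY_def mass1_def mass2_def by (intro measure_eq_AE; use AEd in \<open>auto elim!: eventually_mono\<close>)+
    note pd = pos[of d, unfolded \<phi>d Jd Md]
    show ?thesis
      unfolding z info_density_eq[where \<phi> = "\<phi> 0" and c = "\<phi> 0 \<tau>", OF L c] potential_def case_prod_conv \<phi>d Jd Md
      using pd pos[of 0] by (simp add: log_divide log_mult power2_eq_square J_def JX_def JY_def)
  qed
  finally show ?thesis ..
qed

lemma sum_JX_le:
  assumes "finite M" "finite X" shows "(\<Sum>t\<in>M. \<Sum>x\<in>X. JX k t x) \<le> 1"
proof -
  have "(\<Sum>t\<in>M. \<Sum>x\<in>X. JX k t x) = (\<Sum>w\<in>M \<times> X. measure L {z. \<phi> k (fst z) = fst w \<and> fst (snd z) = snd w})"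
    by (simp add: sum.cartesian_product JX_def mass1_def case_prod_beta)
  also have "\<dots> = measure L (\<Union>w\<in>M \<times> X. {z. \<phi> k (fst z) = fst w \<and> fst (snd z) = snd w})"
    using assms by (intro measure_pmf.finite_measure_finite_Union[symmetric]) (auto simp: disjoint_family_on_def)
  finally show ?thesis by simp
qed

lemma sum_JY_le:
  assumes "finite M" "finite Y" shows "(\<Sum>t\<in>M. \<Sum>y\<in>Y. JY k t y) \<le> 1"
proof -
  have "(\<Sum>t\<in>M. \<Sum>y\<in>Y. JY k t y) = (\<Sum>w\<in>M \<times> Y. measure L {z. \<phi> k (fst z) = fst w \<and> snd (snd z) = snd w})"
    by (simp add: sum.cartesian_product JY_def mass2_def case_prod_beta)
  also have "\<dots> = measure L (\<Union>w\<in>M \<times> Y. {z. \<phi> k (fst z) = fst w \<and> snd (snd z) = snd w})"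
    using assms by (intro measure_pmf.finite_measure_finite_Union[symmetric]) (auto simp: disjoint_family_on_def)
  finally show ?thesis by simp
qed

text \<open>The log-likelihood ratio of a round compares the law with the one in which the receiver of its message generates it.\<close>

lemma sum_powr_neg_density_le:
  assumes F: "finite F" "F \<subseteq> set_pmf L"
  shows "(\<Sum>z\<in>F. pmf L z * 2 powr (- round_density k z)) \<le> 1"
proof -
  define pr where "pr = (\<lambda>(\<tau>, x, y). (\<phi> (Suc k) \<tau>, x :: 'x, y :: 'y))"
  define h where "h = (\<lambda>(t, x, y). 2 powr (- llr k t x y))"
  define X where "X = fst ` snd ` set_pmf L"
  define Y where "Y = snd ` snd ` set_pmf L"
  define M where "M = fst ` pr ` F"
  have fin: "finite X" "finite Y" "finite M" using finite_inputs F by (auto simp: X_def Y_def M_def)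
  have "(\<Sum>z\<in>F. pmf L z * 2 powr (- round_density k z)) = (\<Sum>z\<in>F. pmf L z * h (pr z))"
    by (intro sum.cong) (auto simp: round_density_def pr_def h_def)
  also have "\<dots> = (\<Sum>w\<in>pr ` F. \<Sum>z\<in>{z \<in> F. pr z = w}. pmf L z * h (pr z))"
    using F(1) by (rule sum.image_gen)
  also have "\<dots> = (\<Sum>w\<in>pr ` F. (\<Sum>z\<in>{z \<in> F. pr z = w}. pmf L z) * h w)"
    by (simp add: sum_distrib_right)
  \<comment> \<open>The factor \<open>2 powr (- llr k t x y)\<close> exchanges the sender's kernel
    for the receiver's prediction.\<close>
  also have "\<dots> \<le> (\<Sum>w\<in>pr ` F. (case w of (t, x, y) \<Rightarrow> (if even k then A2 k t y else A1 k t x) * J k (\<phi> k t) x y))"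
  proof (rule sum_mono)
    fix w assume "w \<in> pr ` F"
    then obtain \<tau> x y where z: "(\<tau>, x, y) \<in> set_pmf L" and w: "w = (\<phi> (Suc k) \<tau>, x, y)"
      using F(2) by (auto simp: pr_def)
    let ?t = "\<phi> (Suc k) \<tau>"
    have "(\<Sum>z\<in>{z \<in> F. pr z = w}. pmf L z) = measure L {z \<in> F. pr z = w}"
      using F(1) by (simp add: measure_measure_pmf_finite)
    also have "\<dots> \<le> J (Suc k) ?t x y"
      unfolding J_def joint_mass_def by (intro measure_pmf.finite_measure_mono) (auto simp: pr_def w)
    finally have "(\<Sum>z\<in>{z \<in> F. pr z = w}. pmf L z) * h w \<le> J (Suc k) ?t x y * h w"
      by (rule mult_right_mono) (simp add: h_def case_prod_beta)
    also have "J (Suc k) ?t x y * h w = (if even k then A2 k ?t y else A1 k ?t x) * J k (\<phi> k ?t) x y"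
    proof (cases "even k")
      case True
      have "h w = A2 k ?t y / A1 k ?t x"
        using A_pos[OF z, of k] llr_even[OF True z] by (simp add: h_def w powr_minus)
      then show ?thesis using True A_pos[OF z, of k] by (simp add: J_Suc_even)
    next
      case False
      have "h w = A1 k ?t x / A2 k ?t y"
        using A_pos[OF z, of k] llr_odd[OF False z] by (simp add: h_def w powr_minus)
      then show ?thesis using False A_pos[OF z, of k] by (simp add: J_Suc_odd)
    qed
    finally show "(\<Sum>z\<in>{z \<in> F. pr z = w}. pmf L z) * h w \<le> (case w of (t, x, y) \<Rightarrow> (if even k then A2 k t y else A1 k t x) * J k (\<phi> k t) x y)"
      by (simp add: w)
  qed
  also have "\<dots> \<le> (\<Sum>(t, x, y)\<in>M \<times> X \<times> Y. (if even k then A2 k t y else A1 k t x) * J k (\<phi> k t) x y)"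
  proof (rule sum_mono2)
    show "pr ` F \<subseteq> M \<times> X \<times> Y" using F(2) unfolding M_def X_def Y_def by (force simp: pr_def)
  qed (use fin in auto)
  also have "\<dots> = (\<Sum>t\<in>M. \<Sum>x\<in>X. \<Sum>y\<in>Y. (if even k then A2 k t y else A1 k t x) * J k (\<phi> k t) x y)"
    by (simp add: sum.cartesian_product)
  also have "\<dots> \<le> 1"
  proof (cases "even k")
    case True
    \<comment> \<open>The prediction does not depend on \<open>x\<close>; summing out
      \<open>x\<close> leaves the marginal \<open>JY k\<close>, which the prediction carries to at
      most \<open>JY (Suc k)\<close>.\<close>
    have "(\<Sum>x\<in>X. \<Sum>y\<in>Y. A2 k t y * J k (\<phi> k t) x y) \<le> (\<Sum>y\<in>Y. JY (Suc k) t y)" for t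
    proof -
      have "(\<Sum>x\<in>X. \<Sum>y\<in>Y. A2 k t y * J k (\<phi> k t) x y) = (\<Sum>y\<in>Y. A2 k t y * JY k (\<phi> k t) y)"
        unfolding JY_sum X_def[symmetric] by (subst sum.swap) (simp add: sum_distrib_left)
      also have "\<dots> \<le> (\<Sum>y\<in>Y. JY (Suc k) t y)"
        by (intro sum_mono) (simp add: A2_def)
      finally show ?thesis .
    qed
    then have "(\<Sum>t\<in>M. \<Sum>x\<in>X. \<Sum>y\<in>Y. A2 k t y * J k (\<phi> k t) x y) \<le> (\<Sum>t\<in>M. \<Sum>y\<in>Y. JY (Suc k) t y)"
      by (rule sum_mono)
    also have "\<dots> \<le> 1" using fin by (intro sum_JY_le)
    finally show ?thesis using True by simp
  next
    case False
    have "(\<Sum>x\<in>X. \<Sum>y\<in>Y. A1 k t x * J k (\<phi> k t) x y) \<le> (\<Sum>x\<in>X. JX (Suc k) t x)" for t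
    proof -
      have "(\<Sum>x\<in>X. \<Sum>y\<in>Y. A1 k t x * J k (\<phi> k t) x y) = (\<Sum>x\<in>X. A1 k t x * JX k (\<phi> k t) x)"
        unfolding JX_sum Y_def[symmetric] by (simp add: sum_distrib_left)
      also have "\<dots> \<le> (\<Sum>x\<in>X. JX (Suc k) t x)"
        by (intro sum_mono) (simp add: A1_def)
      finally show ?thesis .
    qed
    then have "(\<Sum>t\<in>M. \<Sum>x\<in>X. \<Sum>y\<in>Y. A1 k t x * J k (\<phi> k t) x y) \<le> (\<Sum>t\<in>M. \<Sum>x\<in>X. JX (Suc k) t x)"
      by (rule sum_mono)
    also have "\<dots> \<le> 1" using fin by (intro sum_JX_le)
    finally show ?thesis using False by simp
  qed
  finally show ?thesis .
qed

text \<open>Markov's inequality for the exponential moment. The bound depends on neither the law nor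
  the round, so it also holds for \<open>n\<close> copies without loss.\<close>

lemma measure_density_less:
  "measure L {z \<in> set_pmf L. round_density k z < - s} \<le> 2 powr (- s)"
proof -
  let ?D = "{z \<in> set_pmf L. round_density k z < - s}"
  have "infsum (pmf L) ?D \<le> 2 powr (- s)"
  proof (rule infsum_le_finite_sums)
    show "pmf L summable_on ?D" using pmf_has_sum[of L ?D] by (auto simp: summable_on_def)
    fix F assume F: "finite F" "F \<subseteq> ?D"
    have "sum (pmf L) F \<le> (\<Sum>z\<in>F. 2 powr (- s) * (pmf L z * 2 powr (- round_density k z)))"
    proof (rule sum_mono)
      fix z assume "z \<in> F"
      then have "1 \<le> 2 powr (- s - round_density k z)" using F(2) by (intro ge_one_powr_ge_zero) auto
      then have "pmf L z * 1 \<le> pmf L z * 2 powr (- s - round_density k z)" by (rule mult_left_mono) simp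
      then show "pmf L z \<le> 2 powr (- s) * (pmf L z * 2 powr (- round_density k z))"
        by (simp add: powr_diff powr_minus field_simps)
    qed
    also have "\<dots> \<le> 2 powr (- s) * 1"
      unfolding sum_distrib_left[symmetric] using F by (intro mult_left_mono sum_powr_neg_density_le) auto
    finally show "sum (pmf L) F \<le> 2 powr (- s)" by simp
  qed
  then show ?thesis using pmf_has_sum[of L ?D] by (simp add: infsumI)
qed

lemma integrable_pmf_of_finite_sums:
  fixes p :: "'c pmf" and f :: "'c \<Rightarrow> real"
  assumes "\<And>z. 0 \<le> f z" "\<And>F. finite F \<Longrightarrow> F \<subseteq> set_pmf p \<Longrightarrow> (\<Sum>z\<in>F. pmf p z * f z) \<le> C"
  shows "integrable p f"
proof -
  have "(\<lambda>z. pmf p z * f z) summable_on UNIV"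
  proof (rule nonneg_bdd_above_summable_on)
    show "bdd_above (sum (\<lambda>z. pmf p z * f z) ` {F. F \<subseteq> UNIV \<and> finite F})"
    proof (rule bdd_aboveI2)
      fix F :: "'c set" assume "F \<in> {F. F \<subseteq> UNIV \<and> finite F}"
      then have "(\<Sum>z\<in>F. pmf p z * f z) = (\<Sum>z\<in>F \<inter> set_pmf p. pmf p z * f z)"
        by (intro sum.mono_neutral_right) (auto simp: set_pmf_iff)
      also have "\<dots> \<le> C" using \<open>F \<in> _\<close> by (intro assms(2)) auto
      finally show "(\<Sum>z\<in>F. pmf p z * f z) \<le> C" .
    qed
  qed (simp add: assms(1))
  then have "Infinite_Sum.abs_summable_on (\<lambda>z. pmf p z * f z) UNIV"
    by (rule summable_on_cong[THEN iffD1, rotated]) (simp add: assms(1))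
  then have "Infinite_Set_Sum.abs_summable_on (\<lambda>z. pmf p z * f z) UNIV"
    using abs_summable_equivalent by blast
  then have "integrable (count_space UNIV) (\<lambda>z. pmf p z * f z)" by (simp add: Infinite_Set_Sum.abs_summable_on_def)
  then have "integrable (density (count_space UNIV) (\<lambda>z. ennreal (pmf p z))) f"
    by (subst integrable_density) auto
  then show ?thesis by (simp flip: measure_pmf_eq_density)
qed

text \<open>The constant comes from \<open>exp (x / 2) \<ge> (x / 2)\<^sup>2 / 2\<close>, together
  with \<open>ln 2 \<ge> 1 / 2\<close>.\<close>

lemma square_le_powr: "0 \<le> x \<Longrightarrow> x\<^sup>2 \<le> 8 * 2 powr x" for x :: real
proof -
  assume x: "0 \<le> x"
  have "1 / 2 \<le> ln (2::real)" using ln2_ge_two_thirds by simp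
  then have "x / 2 \<le> x * ln 2" using x mult_left_mono[of "1/2" "ln 2" x] by simp
  then have "exp (x / 2) \<le> 2 powr x" by (simp add: powr_def mult.commute)
  moreover have "1 + x / 2 + (x / 2)\<^sup>2 / 2 \<le> exp (x / 2)" using x by (intro exp_lower_Taylor_quadratic) simp
  ultimately have "(x / 2)\<^sup>2 / 2 \<le> 2 powr x" using x by linarith
  then show ?thesis by (simp add: power2_eq_square)
qed

lemma integrable_neg_density: "integrable L (\<lambda>z. (max 0 (- round_density k z))\<^sup>2)"
proof -
  have i: "integrable L (\<lambda>z. 2 powr (- round_density k z))"
    by (rule integrable_pmf_of_finite_sums[OF _ sum_powr_neg_density_le]) auto
  show ?thesis
  proof (rule Bochner_Integration.integrable_bound[OF integrable_mult_right[OF i, of 8]])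
    have "(max 0 (- round_density k z))\<^sup>2 \<le> 8 * 2 powr (- round_density k z)" for z
      using square_le_powr[of "- round_density k z"] by (cases "round_density k z \<le> 0") (auto simp: max_def)
    then show "AE z in measure_pmf L. norm ((max 0 (- round_density k z))\<^sup>2) \<le> norm (8 * 2 powr (- round_density k z))"
      by simp
  qed simp
qed

text \<open>The positive part of one log-likelihood ratio is controlled by the sum of all and the negative parts.\<close>

lemma integrable_density_square:
  assumes "integrable L (\<lambda>z. (info_density (measure_pmf L) z)\<^sup>2)" "k < d"
  shows "integrable L (\<lambda>z. (round_density k z)\<^sup>2)"
proof -
  let ?N = "\<lambda>j z. max 0 (- round_density j z)"
  have "integrable L (\<lambda>z. (real d + 1) * ((info_density (measure_pmf L) z)\<^sup>2 + (\<Sum>j<d. (?N j z)\<^sup>2)))"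
    by (intro integrable_mult_right Bochner_Integration.integrable_add Bochner_Integration.integrable_sum integrable_neg_density assms(1))
  then show ?thesis
  proof (rule Bochner_Integration.integrable_bound)
    have "(round_density k z)\<^sup>2 \<le> (real d + 1) * ((info_density (measure_pmf L) z)\<^sup>2 + (\<Sum>j<d. (?N j z)\<^sup>2))" if z: "z \<in> set_pmf L" for z
    proof -
      let ?i = "info_density (measure_pmf L) z"
      \<comment> \<open>The information density is put in as term number \<open>d\<close>, so that
        the Cauchy-Schwarz inequality over \<open>d + 1\<close> terms covers it as well.\<close>
      have split: "(\<Sum>j<Suc d. if j = d then a else f j) = a + (\<Sum>j<d. f j)" for a :: real and f
      proof -
        have "(\<Sum>j<d. if j = d then a else f j) = (\<Sum>j<d. f j)" by (intro sum.cong) auto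
        then show ?thesis by simp
      qed
      have "\<bar>round_density k z\<bar> \<le> \<bar>?i\<bar> + (\<Sum>j<d. ?N j z)"
      proof (cases "0 \<le> round_density k z")
        case True
        have "?i = round_density k z + (\<Sum>j\<in>{..<d} - {k}. round_density j z)"
          unfolding info_density_eq_sum[OF z] using assms(2) by (intro sum.remove) auto
        moreover have "(\<Sum>j\<in>{..<d} - {k}. round_density j z) \<ge> - (\<Sum>j\<in>{..<d} - {k}. ?N j z)"
          unfolding sum_negf[symmetric] by (intro sum_mono) simp
        moreover have "(\<Sum>j\<in>{..<d} - {k}. ?N j z) \<le> (\<Sum>j<d. ?N j z)" by (intro sum_mono2) auto
        ultimately show ?thesis using True by linarith
      next
        case False
        have "?N k z \<le> (\<Sum>j<d. ?N j z)" using assms(2) by (intro member_le_sum) auto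
        then show ?thesis using False by linarith
      qed
      then have "(round_density k z)\<^sup>2 \<le> (\<bar>?i\<bar> + (\<Sum>j<d. ?N j z))\<^sup>2"
        by (metis abs_ge_zero power2_abs power_mono)
      also have "\<dots> = (\<Sum>j<Suc d. (if j = d then \<bar>?i\<bar> else ?N j z) * 1)\<^sup>2"
        using split[of "\<bar>?i\<bar>" "\<lambda>j. ?N j z"] by (simp add: add.commute)
      also have "\<dots> \<le> (\<Sum>j<Suc d. (if j = d then \<bar>?i\<bar> else ?N j z)\<^sup>2) * (\<Sum>j<Suc d. 1\<^sup>2)"
        by (rule Cauchy_Schwarz_ineq_sum)
      also have "(\<Sum>j<Suc d. (if j = d then \<bar>?i\<bar> else ?N j z)\<^sup>2) = ?i\<^sup>2 + (\<Sum>j<d. (?N j z)\<^sup>2)"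
        using split[of "\<bar>?i\<bar>\<^sup>2" "\<lambda>j. (?N j z)\<^sup>2"] by (simp add: if_distrib[of "\<lambda>x. x\<^sup>2"] cong: if_cong)
      finally show ?thesis by (simp add: mult.commute add.commute)
    qed
    then show "AE z in measure_pmf L. norm ((round_density k z)\<^sup>2) \<le> norm ((real d + 1) * ((info_density (measure_pmf L) z)\<^sup>2 + (\<Sum>j<d. (?N j z)\<^sup>2)))"
      by (auto simp: AE_measure_pmf_iff intro: order_trans[OF _ abs_ge_self])
  qed simp
qed

end

section \<open>The law of \<open>n\<close> copies as a law generated in rounds\<close>

section \<open>The law of a sequence\<close>

definition unzip :: "('t \<times> 'x \<times> 'y) list \<Rightarrow> 't list \<times> 'x list \<times> 'y list" where
  "unzip zs = (map fst zs, map (fst \<circ> snd) zs, map (snd \<circ> snd) zs)"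

definition seq_law :: "nat \<Rightarrow> ('t \<times> 'x \<times> 'y) pmf \<Rightarrow> ('t list \<times> 'x list \<times> 'y list) pmf" where
  "seq_law n L = map_pmf unzip (replicate_pmf n L)"

text \<open>\<open>round_law\<close> wants the truncation to zero rounds to be constant, also on
  lists of different lengths; hence the separate case.\<close>

definition seq_trunc :: "(nat \<Rightarrow> 't \<Rightarrow> 't) \<Rightarrow> nat \<Rightarrow> 't list \<Rightarrow> 't list" where
  "seq_trunc \<phi> k ts = (if k = 0 then [] else map (\<phi> k) ts)"

lemma replicate_map_pmf: "replicate_pmf n (map_pmf f p) = map_pmf (map f) (replicate_pmf n p)"
  by (induction n) (simp_all add: map_bind_pmf bind_map_pmf)

lemma inputs_seq_law: "map_pmf snd (seq_law n L) = iid_inputs n (map_pmf snd L)"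
  unfolding seq_law_def iid_inputs_def replicate_map_pmf pmf.map_comp by (simp add: unzip_def comp_def)

lemma joint_law_n_eq:
  fixes P :: "('x::countable \<times> 'y::countable) pmf"
  assumes \<pi>: "is_protocol P \<pi>" and L: "joint_law P \<pi> = measure_pmf L"
  shows "joint_law_n n P \<pi> = measure_pmf (seq_law n L)"
proof -
  interpret protocol_space P \<pi> by unfold_locales (rule \<pi>)
  let ?X = "\<lambda>\<omega>. (transcript \<pi> \<omega>, fst (fst \<omega>), snd (fst \<omega>))"
  have X: "?X \<in> \<Omega> \<rightarrow>\<^sub>M count_space UNIV"
    using measurable_Pair[OF transcript_measurable fst_measurable] by (simp add: pair_measure_countable)
  note * = distr_PiM_map[OF sample.prob_space_axioms X L[unfolded joint_law_def], of n "{..<n}", OF order_refl]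
  have "measure_pmf (seq_law n L) = distr (distr (PiM {..<n} (\<lambda>_. \<Omega>)) (count_space UNIV) (\<lambda>\<omega>. map (\<lambda>i. ?X (\<omega> i)) [0..<n])) (count_space UNIV) unzip"
    unfolding *(2) by (simp add: seq_law_def map_pmf_rep_eq)
  also have "\<dots> = distr (PiM {..<n} (\<lambda>_. \<Omega>)) (count_space UNIV) (unzip \<circ> (\<lambda>\<omega>. map (\<lambda>i. ?X (\<omega> i)) [0..<n]))"
    using *(1) by (intro distr_distr) auto
  finally show ?thesis by (simp add: joint_law_n_def comp_def unzip_def)
qed

lemma seq_event:
  fixes L :: "('t::countable \<times> 'x::countable \<times> 'y::countable) pmf"
  assumes "\<And>zs. length zs = n \<Longrightarrow> unzip zs \<in> E \<longleftrightarrow> (\<forall>i<n. zs ! i \<in> A i)"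
  shows "measure (seq_law n L) E = (\<Prod>i<n. measure L (A i))"
proof -
  have "measure (seq_law n L) E = measure (replicate_pmf n L) (unzip -` E)" by (simp add: seq_law_def)
  also have "\<dots> = measure (replicate_pmf n L) {zs. \<forall>i<n. zs ! i \<in> A i}"
    by (intro measure_eq_AE) (use assms in \<open>auto simp: AE_measure_pmf_iff set_replicate_pmf\<close>)
  finally show ?thesis by (simp only: measure_replicate_pmf_prod)
qed

lemma seq_event_empty:
  assumes "\<And>zs. length zs = n \<Longrightarrow> unzip zs \<notin> E"
  shows "measure (seq_law n L) E = 0"
  using assms by (subst measure_pmf_zero_iff) (auto simp: seq_law_def set_replicate_pmf)

lemma joint_mass_seq_Suc:
  fixes L :: "('t::countable \<times> 'x::countable \<times> 'y::countable) pmf"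
  shows "joint_mass (seq_law n L) (seq_trunc \<phi> (Suc k)) ts xs ys =
    (if length ts = n \<and> length xs = n \<and> length ys = n then \<Prod>i<n. joint_mass L (\<phi> (Suc k)) (ts ! i) (xs ! i) (ys ! i) else 0)"
proof (cases "length ts = n \<and> length xs = n \<and> length ys = n")
  case True
  then show ?thesis
    unfolding joint_mass_def
    by (subst seq_event[where A = "\<lambda>i. {z. \<phi> (Suc k) (fst z) = ts ! i \<and> snd z = (xs ! i, ys ! i)}"])
       (auto simp: unzip_def seq_trunc_def list_eq_iff_nth_eq prod_eq_iff)
next
  case False
  then show ?thesis
    unfolding joint_mass_def by (subst seq_event_empty) (auto simp: unzip_def seq_trunc_def)
qed

context round_law
begin

text \<open>The length of \<open>ts\<close> is assumed because the truncation to zero rounds forgets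
  it.\<close>

lemma joint_mass_seq:
  assumes "length ts = n"
  shows "joint_mass (seq_law n L) (seq_trunc \<phi> k) (seq_trunc \<phi> k ts) xs ys =
    (if length xs = n \<and> length ys = n then \<Prod>i<n. joint_mass L (\<phi> k) (\<phi> k (ts ! i)) (xs ! i) (ys ! i) else 0)"
proof (cases k)
  case (Suc k')
  then show ?thesis using assms by (simp add: joint_mass_seq_Suc) (simp add: seq_trunc_def)
next
  case 0
  show ?thesis
  proof (cases "length xs = n \<and> length ys = n")
    case True
    have c: "\<phi> 0 \<tau> = \<phi> 0 \<tau>' \<longleftrightarrow> True" for \<tau> \<tau>' using \<phi>_0[of \<tau> \<tau>'] by simp
    show ?thesis
      unfolding joint_mass_def 0 using True assms
      by (subst seq_event[where A = "\<lambda>i. {z. \<phi> 0 (fst z) = \<phi> 0 (ts ! i) \<and> snd z = (xs ! i, ys ! i)}"])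
         (auto simp: unzip_def seq_trunc_def list_eq_iff_nth_eq prod_eq_iff c)
  next
    case False
    then show ?thesis
      unfolding joint_mass_def by (subst seq_event_empty) (auto simp: unzip_def seq_trunc_def)
  qed
qed

lemma mass1_seq:
  assumes "length ts = n" "length xs = n"
  shows "mass1 (seq_law n L) (seq_trunc \<phi> k) (seq_trunc \<phi> k ts) xs = (\<Prod>i<n. mass1 L (\<phi> k) (\<phi> k (ts ! i)) (xs ! i))"
proof (cases k)
  case Suc
  then show ?thesis
    unfolding mass1_def using assms
    by (subst seq_event[where A = "\<lambda>i. {z. \<phi> k (fst z) = \<phi> k (ts ! i) \<and> fst (snd z) = xs ! i}"])
       (auto simp: unzip_def seq_trunc_def list_eq_iff_nth_eq)
next
  case 0
  have c: "\<phi> 0 \<tau> = \<phi> 0 \<tau>' \<longleftrightarrow> True" for \<tau> \<tau>' using \<phi>_0[of \<tau> \<tau>'] by simp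
  show ?thesis
    unfolding mass1_def 0 using assms
    by (subst seq_event[where A = "\<lambda>i. {z. \<phi> 0 (fst z) = \<phi> 0 (ts ! i) \<and> fst (snd z) = xs ! i}"])
       (auto simp: unzip_def seq_trunc_def list_eq_iff_nth_eq c)
qed

lemma mass2_seq:
  assumes "length ts = n" "length ys = n"
  shows "mass2 (seq_law n L) (seq_trunc \<phi> k) (seq_trunc \<phi> k ts) ys = (\<Prod>i<n. mass2 L (\<phi> k) (\<phi> k (ts ! i)) (ys ! i))"
proof (cases k)
  case Suc
  then show ?thesis
    unfolding mass2_def using assms
    by (subst seq_event[where A = "\<lambda>i. {z. \<phi> k (fst z) = \<phi> k (ts ! i) \<and> snd (snd z) = ys ! i}"])
       (auto simp: unzip_def seq_trunc_def list_eq_iff_nth_eq)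
next
  case 0
  have c: "\<phi> 0 \<tau> = \<phi> 0 \<tau>' \<longleftrightarrow> True" for \<tau> \<tau>' using \<phi>_0[of \<tau> \<tau>'] by simp
  show ?thesis
    unfolding mass2_def 0 using assms
    by (subst seq_event[where A = "\<lambda>i. {z. \<phi> 0 (fst z) = \<phi> 0 (ts ! i) \<and> snd (snd z) = ys ! i}"])
       (auto simp: unzip_def seq_trunc_def list_eq_iff_nth_eq c)
qed

text \<open>The kernels of independent copies are products of kernels. A positive \<open>d\<close>
  ensures that \<open>seq_trunc \<phi> d\<close> is not the truncation to the empty list.\<close>

lemma round_law_seq:
  assumes "0 < d"
  shows "round_law (seq_law n L) (seq_trunc \<phi>) d"
proof unfold_locales
  have "snd ` set_pmf (seq_law n L) \<subseteq> (\<lambda>ws. (map fst ws, map snd ws)) ` {ws. set ws \<subseteq> snd ` set_pmf L \<and> length ws = n}"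
  proof
    fix w assume "w \<in> snd ` set_pmf (seq_law n L)"
    then obtain zs where "zs \<in> set_pmf (replicate_pmf n L)" and w: "w = snd (unzip zs)"
      unfolding seq_law_def by auto
    then have zs: "set zs \<subseteq> set_pmf L" "length zs = n" "w = snd (unzip zs)"
      by (auto simp: set_replicate_pmf)
    then show "w \<in> (\<lambda>ws. (map fst ws, map snd ws)) ` {ws. set ws \<subseteq> snd ` set_pmf L \<and> length ws = n}"
      by (intro image_eqI[of _ _ "map snd zs"]) (auto simp: unzip_def)
  qed
  then show "finite (snd ` set_pmf (seq_law n L))"
    by (rule finite_subset) (intro finite_imageI finite_lists_length_eq finite_inputs)
  show "seq_trunc \<phi> k (seq_trunc \<phi> (Suc k) \<tau>) = seq_trunc \<phi> k \<tau>" for k \<tau>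
    by (simp add: seq_trunc_def \<phi>_\<phi>)
  show "seq_trunc \<phi> 0 \<tau> = seq_trunc \<phi> 0 \<tau>'" for \<tau> \<tau>'
    by (simp add: seq_trunc_def)
  show "seq_trunc \<phi> d (fst z) = fst z" if z_in: "z \<in> set_pmf (seq_law n L)" for z
  proof -
    obtain zs where "zs \<in> set_pmf (replicate_pmf n L)" and z: "z = unzip zs"
      using z_in unfolding seq_law_def by auto
    then have zs: "set zs \<subseteq> set_pmf L" "z = unzip zs" by (auto simp: set_replicate_pmf)
    then show ?thesis using assms \<phi>_d by (auto simp: seq_trunc_def unzip_def)
  qed
  show "\<exists>\<kappa>. \<forall>x y t. joint_mass (seq_law n L) (seq_trunc \<phi> (Suc k)) t x y =
       (if even k then \<kappa> (Inl x) t else \<kappa> (Inr y) t) * joint_mass (seq_law n L) (seq_trunc \<phi> k) (seq_trunc \<phi> k t) x y" for k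
  proof -
    obtain \<kappa> where \<kappa>: "\<And>x y t. joint_mass L (\<phi> (Suc k)) t x y =
       (if even k then \<kappa> (Inl x) t else \<kappa> (Inr y) t) * joint_mass L (\<phi> k) (\<phi> k t) x y"
      using markov[of k] by blast
    define \<kappa>' where "\<kappa>' z ts = (if length ts = n then (case z of Inl xs \<Rightarrow> \<Prod>i<n. \<kappa> (Inl (xs ! i)) (ts ! i)
       | Inr ys \<Rightarrow> \<Prod>i<n. \<kappa> (Inr (ys ! i)) (ts ! i)) else 0)" for z ts
    have "joint_mass (seq_law n L) (seq_trunc \<phi> (Suc k)) t x y =
       (if even k then \<kappa>' (Inl x) t else \<kappa>' (Inr y) t) * joint_mass (seq_law n L) (seq_trunc \<phi> k) (seq_trunc \<phi> k t) x y" for x y t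
      unfolding joint_mass_seq_Suc
      by (cases "length t = n") (simp_all add: joint_mass_seq \<kappa>'_def \<kappa> prod.distrib)
    then show ?thesis by blast
  qed
qed

lemma log_prod:
  fixes n :: nat
  assumes "\<And>i. i < n \<Longrightarrow> 0 < f i"
  shows "log 2 (\<Prod>i<n. f i :: real) = (\<Sum>i<n. log 2 (f i))"
proof -
  have "ln (\<Prod>i<n. f i) = (\<Sum>i<n. ln (f i))" using assms by (intro ln_prod) fastforce+
  then show ?thesis by (simp add: log_def sum_divide_distrib)
qed

lemma sum_list_eq: "length zs = n \<Longrightarrow> sum_list (map f zs) = (\<Sum>i<n. f (zs ! i) :: real)"
  by (simp add: sum_list_sum_nth atLeast0LessThan)

text \<open>All masses are products over the coordinates, so the potentials add up, and with them
  their increments.\<close>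

lemma seq_round_density:
  assumes d: "0 < d" and zs: "zs \<in> set_pmf (replicate_pmf n L)"
  shows "round_law.round_density (seq_law n L) (seq_trunc \<phi>) k (unzip zs) = sum_list (map (round_density k) zs)"
proof -
  interpret seq: round_law "seq_law n L" "seq_trunc \<phi>" d by (rule round_law_seq[OF d])
  have len: "length zs = n" and supp: "\<And>i. i < n \<Longrightarrow> zs ! i \<in> set_pmf L"
    using zs by (auto simp: set_replicate_pmf in_lists_conv_set)
  have u: "unzip zs \<in> set_pmf (seq_law n L)" using zs by (auto simp: seq_law_def)
  have pot: "seq.potential k (unzip zs) = (\<Sum>i<n. potential k (zs ! i))" for k
  proof -
    have z: "(fst (zs ! i), fst (snd (zs ! i)), snd (snd (zs ! i))) \<in> set_pmf L" if "i < n" for i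
      using supp[OF that] by simp
    show ?thesis
      unfolding seq.potential_def potential_def unzip_def case_prod_conv seq.J_def seq.JX_def seq.JY_def
      using len J_pos[OF z, of _ k]
      by (simp add: joint_mass_seq mass1_seq mass2_seq log_prod case_prod_beta J_def JX_def JY_def sum_subtractf sum_distrib_left)
  qed
  have "seq.round_density k (unzip zs) = (\<Sum>i<n. round_density k (zs ! i))"
    unfolding seq.round_density_eq[OF u] pot using supp by (simp add: round_density_eq sum_subtractf)
  then show ?thesis by (simp add: sum_list_eq[OF len])
qed

lemma seq_info_density:
  assumes d: "0 < d" and zs: "zs \<in> set_pmf (replicate_pmf n L)"
  shows "info_density (measure_pmf (seq_law n L)) (unzip zs) = sum_list (map (info_density (measure_pmf L)) zs)"
proof -
  interpret seq: round_law "seq_law n L" "seq_trunc \<phi>" d by (rule round_law_seq[OF d])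
  have len: "length zs = n" and supp: "\<And>i. i < n \<Longrightarrow> zs ! i \<in> set_pmf L"
    using zs by (auto simp: set_replicate_pmf in_lists_conv_set)
  have u: "unzip zs \<in> set_pmf (seq_law n L)" using zs by (auto simp: seq_law_def)
  have "info_density (measure_pmf (seq_law n L)) (unzip zs) = (\<Sum>k<d. \<Sum>i<n. round_density k (zs ! i))"
    unfolding seq.info_density_eq_sum[OF u] seq_round_density[OF d zs] sum_list_eq[OF len] ..
  also have "\<dots> = (\<Sum>i<n. info_density (measure_pmf L) (zs ! i))"
    by (subst sum.swap) (simp add: info_density_eq_sum supp)
  finally show ?thesis by (simp add: sum_list_eq[OF len])
qed

end

section \<open>From the one-shot bounds to the expansion\<close>

section \<open>Second-order asymptotics\<close>

lemma Inf_enat_attained: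
  fixes A :: "enat set"
  assumes "Inf A = enat l"
  shows "enat l \<in> A"
proof (cases "A = {}")
  case True
  then show ?thesis using assms by (simp add: Inf_enat_def)
next
  case False
  then obtain a where "a \<in> A" by blast
  then have "(LEAST a. a \<in> A) \<in> A" by (rule LeastI)
  then show ?thesis using assms False by (simp add: Inf_enat_def)
qed

text \<open>The error of the converse for \<open>S = 2 powr t\<close> and a threshold
  \<open>6 * t\<close> above the length: the second term has exponent
  \<open>2 * t - 3 * t\<close>.\<close>

lemma converse_error:
  fixes t l :: real
  shows "4 / 2 powr t + (2 powr t)\<^sup>2 * 2 powr ((l - (l + 6 * t)) / 2) = 5 * 2 powr (- t)"
proof -
  have "(2 powr t)\<^sup>2 * 2 powr ((l - (l + 6 * t)) / 2) = 2 powr (t + t + (l - (l + 6 * t)) / 2)"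
    by (simp only: power2_eq_square powr_add)
  also have "t + t + (l - (l + 6 * t)) / 2 = - t" by (simp add: field_simps)
  finally have 1: "(2 powr t)\<^sup>2 * 2 powr ((l - (l + 6 * t)) / 2) = 2 powr (- t)" .
  have 2: "4 / 2 powr t = 4 * 2 powr (- t)" unfolding powr_minus_divide by simp
  show ?thesis unfolding 1 2 by simp
qed

locale second_order = round_law L \<phi> d
  for L :: "('t::countable \<times> 'x::countable \<times> 'y::countable) pmf" and \<phi> d +
  fixes \<epsilon> :: real
  assumes d_pos: "0 < d" and \<epsilon>: "0 < \<epsilon>" "\<epsilon> < 1"
    and var_pos: "0 < (\<integral>z. (info_density (measure_pmf L) z - (\<integral>z. info_density (measure_pmf L) z \<partial>L))\<^sup>2 \<partial>L)"
begin

definition "IC = (\<integral>z. info_density (measure_pmf L) z \<partial>L)"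
definition "V = (\<integral>z. (info_density (measure_pmf L) z - IC)\<^sup>2 \<partial>L)"

definition sim_length :: "nat \<Rightarrow> enat" where
  "sim_length n = min_sim_length \<epsilon> (map_pmf snd (seq_law n L)) (measure_pmf (seq_law n L))"

lemma V_pos: "0 < V"
  using var_pos by (simp add: V_def IC_def)

text \<open>The Bochner integral of a function that is not integrable is 0, so a positive variance
  already contains square integrability.\<close>

lemma square_integrable_info: "square_integrable L (info_density (measure_pmf L)) IC V"
proof
  let ?h = "info_density (measure_pmf L)"
  have i: "integrable L (\<lambda>z. (?h z - IC)\<^sup>2)"
    using V_pos not_integrable_integral_eq unfolding V_def by force
  have "integrable L (\<lambda>z. 2 * (?h z - IC)\<^sup>2 + 2 * IC\<^sup>2)"
    by (intro Bochner_Integration.integrable_add integrable_mult_right i) simp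
  then show "integrable L (\<lambda>z. (?h z)\<^sup>2)"
  proof (rule Bochner_Integration.integrable_bound)
    have "(?h z)\<^sup>2 \<le> 2 * (?h z - IC)\<^sup>2 + 2 * IC\<^sup>2" for z
      using zero_le_power2[of "?h z - 2 * IC"] by (simp add: power2_eq_square algebra_simps)
    then show "AE z in measure_pmf L. norm ((?h z)\<^sup>2) \<le> norm (2 * (?h z - IC)\<^sup>2 + 2 * IC\<^sup>2)"
      by (intro AE_I2) (auto intro: order_trans[OF _ abs_ge_self])
  qed simp
qed (simp_all add: IC_def V_def)

sublocale ic: square_integrable L "info_density (measure_pmf L)" IC V
  by (rule square_integrable_info)

lemma square_integrable_round:
  "k < d \<Longrightarrow> square_integrable L (round_density k) (\<integral>z. round_density k z \<partial>L) (\<integral>z. (round_density k z - (\<integral>z. round_density k z \<partial>L))\<^sup>2 \<partial>L)"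
  using integrable_density_square[OF ic.integrable_square] by unfold_locales auto

lemma measure_seq_law: "measure (seq_law n L) E = measure (replicate_pmf n L) (unzip -` E)"
  by (simp add: seq_law_def)

lemma unzip_in_seq_law: "zs \<in> set_pmf (replicate_pmf n L) \<Longrightarrow> unzip zs \<in> set_pmf (seq_law n L)"
  by (simp add: seq_law_def)

lemma sqrt_shift: "sqrt (real n * V) * (a + e / sqrt V) = sqrt (real n * V) * a + e * sqrt (real n)"
  using V_pos by (simp add: real_sqrt_mult distrib_left)

lemma seq_info_tail:
  "measure (seq_law n L) {z \<in> set_pmf (seq_law n L). info_density (measure_pmf (seq_law n L)) z > \<nu>} =
   measure (replicate_pmf n L) {zs. ic.sum_of zs > \<nu>}"
  unfolding measure_seq_law
  by (intro measure_eq_AE) (auto simp: AE_measure_pmf_iff seq_info_density[OF d_pos] ic.sum_of_def unzip_in_seq_law)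

lemma tail_limit:
  "(\<lambda>n. measure (replicate_pmf n L) {zs. ic.sum_of zs > real n * IC + sqrt (real n * V) * a}) \<longlonglongrightarrow> Q_tail a"
  by (rule ic.clt_tail[OF V_pos])

text \<open>The remainder has to be real for every \<open>n\<close>, while the infimum of an empty
  set would be infinite. A finite set with all but \<epsilon>/2 of the mass has bounded densities;
  for \<open>s\<close> above the bound one further portion suffices, so \<open>R = 1\<close>, and
  \<open>6\<close> is \<open>2 * R + 4\<close>.\<close>

lemma sim_length_finite: "\<exists>l. sim_length n \<le> enat l"
proof -
  interpret seq: round_law "seq_law n L" "seq_trunc \<phi>" d by (rule round_law_seq[OF d_pos])
  obtain F0 where F0: "finite F0" "measure (seq_law n L) (- F0) < \<epsilon> / 2"
    using pmf_finite_approx[of "\<epsilon> / 2"] \<epsilon> by auto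
  define F where "F = F0 \<inter> set_pmf (seq_law n L)"
  have F: "finite F" "F \<subseteq> set_pmf (seq_law n L)" using F0 by (auto simp: F_def)
  have mF: "1 - \<epsilon> / 2 \<le> measure (seq_law n L) F"
    using F0(2) measure_pmf.prob_compl[of F0 "seq_law n L"] by (simp add: F_def measure_Int_set_pmf Compl_eq_Diff_UNIV)
  have "(\<lambda>s::nat. (1 - 6 / 2 ^ s :: real) ^ d) \<longlonglongrightarrow> (1 - 0) ^ d"
    by (intro tendsto_intros) real_asymp
  then have "\<forall>\<^sub>F s::nat in sequentially. 1 - \<epsilon> / 2 < (1 - 6 / 2 ^ s) ^ d"
    by (rule order_tendstoD) (use \<epsilon> in auto)
  moreover have "\<forall>\<^sub>F s::nat in sequentially. 6 / 2 ^ s \<le> (1::real)" by real_asymp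
  moreover obtain S :: nat where S: "\<And>k z. k < d \<Longrightarrow> z \<in> F \<Longrightarrow> \<bar>seq.round_density k z\<bar> \<le> S"
  proof -
    let ?m = "Max (insert 0 ((\<lambda>(k, z). \<bar>seq.round_density k z\<bar>) ` ({..<d} \<times> F)))"
    obtain S :: nat where "?m \<le> S" using real_arch_simple by blast
    moreover have "\<bar>seq.round_density k z\<bar> \<le> ?m" if "k < d" "z \<in> F" for k z
      using that F(1) by (intro Max_ge) (auto intro!: imageI image_eqI[of _ _ "(k, z)"])
    ultimately show ?thesis using that order_trans by blast
  qed
  moreover have "\<forall>\<^sub>F s::nat in sequentially. S < s" by (rule eventually_gt_at_top)
  ultimately have "\<forall>\<^sub>F s::nat in sequentially. 1 - \<epsilon> / 2 < (1 - 6 / 2 ^ s) ^ d \<and> 6 / 2 ^ s \<le> (1::real) \<and> S < s"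
    by (intro eventually_conj) auto
  then obtain s where s: "1 - \<epsilon> / 2 < (1 - 6 / 2 ^ s) ^ d" "6 / 2 ^ s \<le> (1::real)" "S < s"
    by (auto dest: eventually_happens)
  interpret sim: round_simulation "seq_law n L" "seq_trunc \<phi>" d "\<lambda>_. 0" s s 1 "fst ` F"
    using s F(1) by unfold_locales auto
  define l where "l = d * s + d * (4 * s + s + 1 + 1)"
  have "min_sim_length \<epsilon> (map_pmf snd (seq_law n L)) (measure_pmf (seq_law n L)) \<le> enat l"
  proof (rule sim.min_sim_length_le[where G = F])
    fix \<tau> x y assume z: "(\<tau>, x, y) \<in> F"
    have b: "\<bar>seq.llr k (seq_trunc \<phi> (Suc k) \<tau>) x y\<bar> \<le> real s" if "k < d" for k
      using S[OF that z] s(3) by (simp add: seq.round_density_def)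
    have "(\<Sum>k<d. seq.llr k (seq_trunc \<phi> (Suc k) \<tau>) x y) \<le> (\<Sum>k<d. real s)"
      using b by (intro sum_mono) (auto simp: abs_le_iff)
    then have "(\<Sum>k<d. seq.llr k (seq_trunc \<phi> (Suc k) \<tau>) x y) + real d * real (4 * s + s + 1 + 1) \<le> real l"
      by (simp add: l_def algebra_simps)
    then show "(\<tau>, x, y) \<in> set_pmf (seq_law n L) \<and> \<tau> \<in> fst ` F \<and>
       (\<forall>k<d. real 0 - real s \<le> seq.llr k (seq_trunc \<phi> (Suc k) \<tau>) x y \<and>
              seq.llr k (seq_trunc \<phi> (Suc k) \<tau>) x y \<le> real (0 + 1 * s)) \<and>
       (\<Sum>k<d. seq.llr k (seq_trunc \<phi> (Suc k) \<tau>) x y) + real d * real (4 * s + s + 1 + 1) \<le> real l"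
      using z F(2) b by (force simp: abs_le_iff)
  next
    have "1 - \<epsilon> \<le> (1 - \<epsilon> / 2) * (1 - \<epsilon> / 2)" by (simp add: algebra_simps)
    also have "\<dots> \<le> (1 - 6 / 2 ^ s) ^ d * measure (seq_law n L) F"
      using s(1,2) mF \<epsilon> by (intro mult_mono) auto
    finally show "1 - \<epsilon> \<le> (1 - (2 * real 1 + 4) / 2 ^ s) ^ d * measure (seq_law n L) F" by simp
  qed
  then show ?thesis unfolding sim_length_def by blast
qed

text \<open>By contradiction from a protocol that attains the minimum. The margin
  \<open>c * sqrt n\<close> is halved: one half absorbs the \<open>6 * n powr (1/4)\<close> by which
  the threshold exceeds the length, the other shifts the argument of \<open>Q_tail\<close> by
  \<open>c'\<close> and lifts the tail above \<epsilon>, which the vanishing error cannot make up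
  for.\<close>

lemma sim_length_lower:
  assumes "0 < c"
  shows "\<forall>\<^sub>F n in sequentially. \<forall>l. sim_length n = enat l \<longrightarrow>
    real n * IC + sqrt (real n * V) * inv Q_tail \<epsilon> - c * sqrt (real n) \<le> real l"
proof -
  let ?z = "inv Q_tail \<epsilon>"
  define c' where "c' = (c / 2) / sqrt V"
  have c': "0 < c'" using assms V_pos by (simp add: c'_def)
  let ?t = "\<lambda>n. measure (replicate_pmf n L) {zs. ic.sum_of zs > real n * IC + sqrt (real n * V) * (?z - c')}"
  let ?s = "\<lambda>n::nat. real n powr (1/4)"
  have gap: "\<epsilon> < Q_tail (?z - c')"
    using Q_tail_strict_antimono[of "?z - c'" ?z] c' Q_tail_inv[OF \<epsilon>] by simp
  have "(\<lambda>n::nat. 5 * 2 powr (- ?s n)) \<longlonglongrightarrow> 0" by real_asymp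
  then have "(\<lambda>n. ?t n - 5 * 2 powr (- ?s n)) \<longlonglongrightarrow> Q_tail (?z - c') - 0"
    by (intro tendsto_diff tail_limit)
  then have "\<forall>\<^sub>F n in sequentially. \<epsilon> < ?t n - 5 * 2 powr (- ?s n)"
    by (rule order_tendstoD) (use gap in simp)
  moreover have "\<forall>\<^sub>F n::nat in sequentially. 6 * ?s n \<le> c / 2 * sqrt (real n)"
    using assms by real_asymp
  ultimately show ?thesis
  proof eventually_elim
    case (elim n)
    show ?case
    proof (intro allI impI, rule ccontr)
      fix l assume l: "sim_length n = enat l"
        and less: "\<not> real n * IC + sqrt (real n * V) * ?z - c * sqrt (real n) \<le> real l"
      let ?Ln = "seq_law n L" and ?Pn = "map_pmf snd (seq_law n L)"
      let ?S = "{\<sigma> :: ('x list, 'y list, real, real, real) protocol.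
               sets (pub \<sigma>) = sets borel \<and> sets (coin1 \<sigma>) = sets borel \<and>
               sets (coin2 \<sigma>) = sets borel \<and>
               is_protocol ?Pn \<sigma> \<and> self_delimiting ?Pn \<sigma> \<and> is_simulation \<epsilon> ?Pn (measure_pmf ?Ln) \<sigma>}"
      have Inf: "Inf (protocol_length ?Pn ` ?S) = enat l"
        using l by (simp add: sim_length_def min_sim_length_def)
      then have "enat l \<in> protocol_length ?Pn ` ?S" by (rule Inf_enat_attained)
      then obtain \<sigma> where \<sigma>: "\<sigma> \<in> ?S" "protocol_length ?Pn \<sigma> = enat l" by (elim imageE) simp
      interpret protocol_space ?Pn \<sigma> using \<sigma>(1) by unfold_locales simp
      interpret seq: round_law ?Ln "seq_trunc \<phi>" d by (rule round_law_seq[OF d_pos])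
      define \<nu> where "\<nu> = real l + 6 * ?s n"
      have "finite (set_pmf ?Pn)" using seq.finite_inputs by simp
      then have conv: "measure ?Ln {z \<in> set_pmf ?Ln. info_density (measure_pmf ?Ln) z > \<nu>} \<le>
          \<epsilon> + (4 / 2 powr ?s n + (2 powr ?s n)\<^sup>2 * 2 powr ((real l - \<nu>) / 2))"
        using \<sigma> by (intro simulation_converse) auto
      have "measure (replicate_pmf n L) {zs. ic.sum_of zs > \<nu>} \<le> \<epsilon> + 5 * 2 powr (- ?s n)"
        using conv unfolding seq_info_tail \<nu>_def converse_error .
      moreover have "?t n \<le> measure (replicate_pmf n L) {zs. ic.sum_of zs > \<nu>}"
      proof (rule measure_pmf.finite_measure_mono)
        have "sqrt (real n * V) * (?z - c') = sqrt (real n * V) * ?z - c / 2 * sqrt (real n)"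
          using sqrt_shift[of n ?z "- (c / 2)"] by (simp add: c'_def)
        then have "\<nu> \<le> real n * IC + sqrt (real n * V) * (?z - c')"
          using less elim(2) unfolding \<nu>_def by linarith
        then show "{zs. ic.sum_of zs > real n * IC + sqrt (real n * V) * (?z - c')} \<subseteq> {zs. ic.sum_of zs > \<nu>}" by auto
      qed simp
      ultimately show False using elim(1) by linarith
    qed
  qed
qed

lemma round_bad_le:
  fixes n :: nat
  assumes "k < d"
  defines "m \<equiv> \<integral>z. round_density k z \<partial>L" and "r \<equiv> round_law.round_density (seq_law n L) (seq_trunc \<phi>) k"
  shows "measure (seq_law n L) {z \<in> set_pmf (seq_law n L). \<not> (- s \<le> r z \<and> real n * m - real n powr (5/8) \<le> r z \<and> r z \<le> real n * m + real n powr (5/8))} \<le>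
    2 powr (- s) + (measure (replicate_pmf n L) {zs. sum_list (map (round_density k) zs) < real n * m - real n powr (5/8)}
      + measure (replicate_pmf n L) {zs. sum_list (map (round_density k) zs) > real n * m + real n powr (5/8)})"
    (is "measure ?M ?B \<le> _ + (measure ?R ?l + measure ?R ?u)")
proof -
  interpret seq: round_law "seq_law n L" "seq_trunc \<phi>" d by (rule round_law_seq[OF d_pos])
  let ?W = "real n powr (5/8)"
  have "measure ?M ?B \<le> measure ?M ({z \<in> set_pmf (seq_law n L). r z < - s} \<union> ({z \<in> set_pmf (seq_law n L). r z < real n * m - ?W} \<union> {z \<in> set_pmf (seq_law n L). r z > real n * m + ?W}))"
    by (intro measure_pmf.finite_measure_mono) auto
  also have "\<dots> \<le> measure ?M {z \<in> set_pmf (seq_law n L). r z < - s} + (measure ?M {z \<in> set_pmf (seq_law n L). r z < real n * m - ?W} + measure ?M {z \<in> set_pmf (seq_law n L). r z > real n * m + ?W})"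
    by (intro order_trans[OF measure_Un_le] add_mono measure_Un_le order_refl) auto
  also have "measure ?M {z \<in> set_pmf (seq_law n L). r z < - s} \<le> 2 powr (- s)"
    unfolding r_def by (rule seq.measure_density_less)
  also have "measure ?M {z \<in> set_pmf (seq_law n L). r z < real n * m - ?W} = measure ?R ?l"
    unfolding measure_seq_law r_def
    by (intro measure_eq_AE) (auto simp: AE_measure_pmf_iff seq_round_density[OF d_pos] unzip_in_seq_law)
  also have "measure ?M {z \<in> set_pmf (seq_law n L). r z > real n * m + ?W} = measure ?R ?u"
    unfolding measure_seq_law r_def
    by (intro measure_eq_AE) (auto simp: AE_measure_pmf_iff seq_round_density[OF d_pos] unzip_in_seq_law)
  finally show ?thesis by simp
qed

lemma round_bad_limit:
  assumes "k < d"
  shows "(\<lambda>n. measure (replicate_pmf n L) {zs. sum_list (map (round_density k) zs) < real n * (\<integral>z. round_density k z \<partial>L) - real n powr (5/8)}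
      + measure (replicate_pmf n L) {zs. sum_list (map (round_density k) zs) > real n * (\<integral>z. round_density k z \<partial>L) + real n powr (5/8)}) \<longlonglongrightarrow> 0"
proof -
  note si = square_integrable_round[OF assms]
  interpret square_integrable L "round_density k" "\<integral>z. round_density k z \<partial>L" "\<integral>z. (round_density k z - (\<integral>z. round_density k z \<partial>L))\<^sup>2 \<partial>L"
    by (rule si)
  show ?thesis
    using tendsto_add[OF lower_tail[OF si] upper_tail] by (simp add: sum_of_def)
qed

text \<open>Rounding the target to a natural number must not raise it. If it were negative, the
  information density, which is at least \<open>- d * n powr (1/4)\<close> outside a vanishing mass,
  would exceed the lower threshold of the tail with probability close to one, whereas the limit of
  that tail is below \<epsilon>.\<close>

lemma target_nonneg:
  assumes "0 < c"
  shows "\<forall>\<^sub>F n in sequentially. 0 \<le> real n * IC + sqrt (real n * V) * inv Q_tail \<epsilon> + c * sqrt (real n)"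
proof -
  let ?z = "inv Q_tail \<epsilon>"
  define c' where "c' = (c / 2) / sqrt V"
  have c': "0 < c'" using assms V_pos by (simp add: c'_def)
  let ?t = "\<lambda>n. measure (replicate_pmf n L) {zs. ic.sum_of zs > real n * IC + sqrt (real n * V) * (?z + c')}"
  let ?s = "\<lambda>n::nat. real n powr (1/4)"
  have gap: "Q_tail (?z + c') < \<epsilon>"
    using Q_tail_strict_antimono[of ?z "?z + c'"] c' Q_tail_inv[OF \<epsilon>] by simp
  have "(\<lambda>n::nat. real d * 2 powr (- ?s n)) \<longlonglongrightarrow> 0" by real_asymp
  then have "(\<lambda>n. ?t n + real d * 2 powr (- ?s n)) \<longlonglongrightarrow> Q_tail (?z + c') + 0"
    by (intro tendsto_add tail_limit)
  then have "\<forall>\<^sub>F n in sequentially. ?t n + real d * 2 powr (- ?s n) < 1"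
    by (rule order_tendstoD) (use gap \<epsilon> in simp)
  moreover have "\<forall>\<^sub>F n::nat in sequentially. real d * ?s n < c / 2 * sqrt (real n)"
    using assms by real_asymp
  ultimately show ?thesis
  proof eventually_elim
    case (elim n)
    interpret seq: round_law "seq_law n L" "seq_trunc \<phi>" d by (rule round_law_seq[OF d_pos])
    let ?M = "seq_law n L"
    show ?case
    proof (rule ccontr)
      assume neg: "\<not> 0 \<le> real n * IC + sqrt (real n * V) * ?z + c * sqrt (real n)"
      let ?B = "\<Union>k<d. {z \<in> set_pmf (seq_law n L). seq.round_density k z < - ?s n}"
      let ?U = "{z \<in> set_pmf (seq_law n L). info_density (measure_pmf ?M) z > real n * IC + sqrt (real n * V) * (?z + c')}"
      have "measure ?M ?B \<le> (\<Sum>k<d. measure ?M {z \<in> set_pmf (seq_law n L). seq.round_density k z < - ?s n})"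
        by (intro measure_pmf.finite_measure_subadditive_finite) auto
      also have "\<dots> \<le> (\<Sum>k<d. 2 powr (- ?s n))"
        by (intro sum_mono seq.measure_density_less)
      finally have B: "measure ?M ?B \<le> real d * 2 powr (- ?s n)" by simp
      have "set_pmf (seq_law n L) \<subseteq> ?B \<union> ?U"
      proof
        fix z assume z: "z \<in> set_pmf (seq_law n L)"
        show "z \<in> ?B \<union> ?U"
        proof (cases "z \<in> ?B")
          case False
          then have "(\<Sum>k<d. - ?s n) \<le> (\<Sum>k<d. seq.round_density k z)"
            using z by (intro sum_mono) (auto simp: not_less)
          then have "- (real d * ?s n) \<le> info_density (measure_pmf ?M) z"
            using seq.info_density_eq_sum[OF z] by simp
          moreover have "sqrt (real n * V) * (?z + c') = sqrt (real n * V) * ?z + c / 2 * sqrt (real n)"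
            using sqrt_shift[of n ?z "c / 2"] by (simp add: c'_def)
          ultimately have "info_density (measure_pmf ?M) z > real n * IC + sqrt (real n * V) * (?z + c')"
            using neg elim(2) by linarith
          then show ?thesis using z by simp
        qed simp
      qed
      then have "1 \<le> measure ?M (?B \<union> ?U)"
        using measure_pmf.finite_measure_mono[of "set_pmf (seq_law n L)" "?B \<union> ?U" ?M] by (simp add: measure_pmf.prob_eq_1[THEN iffD2] AE_measure_pmf)
      also have "\<dots> \<le> measure ?M ?B + measure ?M ?U"
        by (intro measure_Un_le) auto
      also have "\<dots> \<le> real d * 2 powr (- ?s n) + ?t n"
        using B seq_info_tail by (intro add_mono) auto
      finally show False using elim(1) by linarith
    qed
  qed
qed

text \<open>The one-shot bound at a single \<open>n\<close>. Each round density is confined to a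
  window of half-width \<open>W\<close> around its mean; \<open>R\<close> portions of
  \<open>s\<close> bits cover the width \<open>2 * W\<close>, and the added 1 makes up for rounding
  the lower edge.\<close>

lemma sim_length_upper_step:
  fixes n :: nat
  defines "s \<equiv> nat \<lceil>real n powr (1/4)\<rceil>" and "W \<equiv> real n powr (5/8)"
  defines "R \<equiv> nat \<lceil>(2 * W + 1) / s\<rceil>"
  defines "m \<equiv> \<lambda>k. \<integral>z. round_density k z \<partial>L"
  defines "bad \<equiv> \<lambda>k. 2 powr (- real s) + (measure (replicate_pmf n L) {zs. sum_list (map (round_density k) zs) < real n * m k - W}
      + measure (replicate_pmf n L) {zs. sum_list (map (round_density k) zs) > real n * m k + W})"
  assumes n: "0 < n" and \<delta>: "(2 * real R + 4) / 2 ^ s \<le> 1"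
    and l: "\<nu> + real d * real (4 * s + s + R + 1) \<le> real l"
    and e: "measure (replicate_pmf n L) {zs. ic.sum_of zs > \<nu>} + ((\<Sum>k<d. bad k) + 1 / real n) \<le> e"
    and \<epsilon>_le: "1 - \<epsilon> \<le> (1 - (2 * real R + 4) / 2 ^ s) ^ d * (1 - e)"
  shows "sim_length n \<le> enat l"
proof -
  let ?M = "seq_law n L"
  interpret seq: round_law ?M "seq_trunc \<phi>" d by (rule round_law_seq[OF d_pos])
  obtain B where B: "finite B" "measure (map_pmf fst ?M) (- B) < 1 / real n"
    using pmf_finite_approx[of "1 / real n" "map_pmf fst ?M"] n by auto
  have s: "0 < s" using n by (simp add: s_def)
  \<comment> \<open>The first portion ends at the lower edge of the window. If that edge is
    negative, \<open>nat\<close> gives 0, and the lower bound \<open>- real s\<close> in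
    \<open>good\<close> takes the place of the edge.\<close>
  define \<kappa> where "\<kappa> k = nat \<lfloor>real n * m k - W\<rfloor>" for k
  interpret sim: round_simulation "seq_law n L" "seq_trunc \<phi>" d \<kappa> s s R B
    using s B(1) \<delta> by unfold_locales auto
  define good where "good k z \<longleftrightarrow> - real s \<le> seq.round_density k z \<and> real n * m k - W \<le> seq.round_density k z \<and>
      seq.round_density k z \<le> real n * m k + W" for k z
  define G where "G = {z \<in> set_pmf (seq_law n L). fst z \<in> B \<and> (\<forall>k<d. good k z) \<and> info_density (measure_pmf (seq_law n L)) z \<le> \<nu>}"
  have "measure ?M (- G) \<le> e"
  proof -
    let ?U = "{z \<in> set_pmf (seq_law n L). info_density (measure_pmf (seq_law n L)) z > \<nu>}"
    let ?B = "\<lambda>k. {z \<in> set_pmf (seq_law n L). \<not> good k z}"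
    have "measure ?M (- G) \<le> measure ?M (?U \<union> ((\<Union>k<d. ?B k) \<union> fst -` (- B)))"
    proof -
      have "measure ?M (- G) = measure ?M (- G \<inter> set_pmf (seq_law n L))" by (simp add: measure_Int_set_pmf)
      also have "\<dots> \<le> measure ?M (?U \<union> ((\<Union>k<d. ?B k) \<union> fst -` (- B)))"
        by (intro measure_pmf.finite_measure_mono) (auto simp: G_def not_le)
      finally show ?thesis .
    qed
    also have "\<dots> \<le> measure ?M ?U + (measure ?M (\<Union>k<d. ?B k) + measure ?M (fst -` (- B)))"
      by (intro order_trans[OF measure_Un_le] add_mono measure_Un_le order_refl) auto
    also have "measure ?M (\<Union>k<d. ?B k) \<le> (\<Sum>k<d. measure ?M (?B k))"
      by (intro measure_pmf.finite_measure_subadditive_finite) auto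
    also have "(\<Sum>k<d. measure ?M (?B k)) \<le> (\<Sum>k<d. bad k)"
      unfolding good_def bad_def m_def W_def by (intro sum_mono round_bad_le) auto
    also have "measure ?M (fst -` (- B)) \<le> 1 / real n" using B(2) by simp
    finally show ?thesis using e unfolding seq_info_tail by simp
  qed
  then have G: "1 - e \<le> measure ?M G"
    using measure_pmf.prob_compl[of G ?M] by (simp add: Compl_eq_Diff_UNIV)
  have W: "0 \<le> W" by (simp add: W_def)
  have Rs: "2 * W + 1 \<le> real (R * s)"
  proof -
    have "(2 * W + 1) / s \<le> R" unfolding R_def by linarith
    then show ?thesis using s by (simp add: pos_divide_le_eq)
  qed
  show ?thesis
    unfolding sim_length_def
  proof (rule sim.min_sim_length_le[where G = G])
    fix \<tau> x y assume z: "(\<tau>, x, y) \<in> G"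
    then have zL: "(\<tau>, x, y) \<in> set_pmf ?M" and \<tau>: "\<tau> \<in> B" and good: "\<And>k. k < d \<Longrightarrow> good k (\<tau>, x, y)"
      and i: "info_density (measure_pmf ?M) (\<tau>, x, y) \<le> \<nu>" by (auto simp: G_def)
    have "real (\<kappa> k) - real s \<le> seq.llr k (seq_trunc \<phi> (Suc k) \<tau>) x y \<and>
              seq.llr k (seq_trunc \<phi> (Suc k) \<tau>) x y \<le> real (\<kappa> k + R * s)" if k: "k < d" for k
    proof -
      have r: "seq.llr k (seq_trunc \<phi> (Suc k) \<tau>) x y = seq.round_density k (\<tau>, x, y)" by (simp add: seq.round_density_def)
      have \<kappa>1: "real n * m k - W - 1 \<le> real (\<kappa> k)" unfolding \<kappa>_def by linarith
      have \<kappa>2: "real (\<kappa> k) \<le> max 0 (real n * m k - W)" unfolding \<kappa>_def by linarith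
      show ?thesis
        unfolding r using good[OF k] \<kappa>1 \<kappa>2 Rs unfolding good_def by (auto simp: max_def split: if_splits)
    qed
    moreover have "(\<Sum>k<d. seq.llr k (seq_trunc \<phi> (Suc k) \<tau>) x y) = info_density (measure_pmf ?M) (\<tau>, x, y)"
      unfolding seq.info_density_eq_sum[OF zL] by (simp add: seq.round_density_def)
    ultimately show "(\<tau>, x, y) \<in> set_pmf ?M \<and> \<tau> \<in> B \<and>
       (\<forall>k<d. real (\<kappa> k) - real s \<le> seq.llr k (seq_trunc \<phi> (Suc k) \<tau>) x y \<and>
              seq.llr k (seq_trunc \<phi> (Suc k) \<tau>) x y \<le> real (\<kappa> k + R * s)) \<and>
       (\<Sum>k<d. seq.llr k (seq_trunc \<phi> (Suc k) \<tau>) x y) + real d * real (4 * s + s + R + 1) \<le> real l"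
      using zL \<tau> i l by auto
  next
    have "1 - \<epsilon> \<le> (1 - (2 * real R + 4) / 2 ^ s) ^ d * (1 - e)" by (rule \<epsilon>_le)
    also have "\<dots> \<le> (1 - (2 * real R + 4) / 2 ^ s) ^ d * measure ?M G"
      using G \<delta> by (intro mult_left_mono) auto
    finally show "1 - \<epsilon> \<le> (1 - (2 * real R + 4) / 2 ^ s) ^ d * measure ?M G" .
  qed
qed

text \<open>With \<open>s\<close> about \<open>n powr (1/4)\<close>, \<open>R\<close> is at most
  \<open>2 * n powr (3/8) + 2\<close>. Hence \<open>s\<close> and \<open>R\<close> are
  o(\<open>sqrt n\<close>), while \<open>\<delta> n\<close> tends to 0 because \<open>2 ^ s\<close>
  beats \<open>R\<close>. Half of \<open>c * sqrt n\<close> moves the tail strictly below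
  \<epsilon>, leaving room for \<open>\<delta>\<close> and the bad events; the other half pays the
  overhead.\<close>

lemma sim_length_upper:
  assumes "0 < c"
  shows "\<forall>\<^sub>F n in sequentially. \<exists>l. sim_length n \<le> enat l \<and>
    real l \<le> real n * IC + sqrt (real n * V) * inv Q_tail \<epsilon> + c * sqrt (real n)"
proof -
  let ?z = "inv Q_tail \<epsilon>"
  define c' where "c' = (c / 2) / sqrt V"
  have c': "0 < c'" using assms V_pos by (simp add: c'_def)
  define s where "s n = nat \<lceil>real n powr (1/4)\<rceil>" for n :: nat
  define W where "W n = real n powr (5/8)" for n :: nat
  define R where "R n = nat \<lceil>(2 * W n + 1) / s n\<rceil>" for n
  define m where "m k = (\<integral>z. round_density k z \<partial>L)" for k
  define bad where "bad n k = 2 powr (- real (s n)) + (measure (replicate_pmf n L) {zs. sum_list (map (round_density k) zs) < real n * m k - W n}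
      + measure (replicate_pmf n L) {zs. sum_list (map (round_density k) zs) > real n * m k + W n})" for n k
  define \<delta> where "\<delta> n = (2 * real (R n) + 4) / 2 ^ s n" for n
  define \<nu> where "\<nu> n = real n * IC + sqrt (real n * V) * (?z + c')" for n :: nat
  define e where "e n = measure (replicate_pmf n L) {zs. ic.sum_of zs > \<nu> n} + ((\<Sum>k<d. bad n k) + 1 / real n)" for n
  define l where "l n = nat \<lfloor>real n * IC + sqrt (real n * V) * ?z + c * sqrt (real n)\<rfloor>" for n :: nat
  have gap: "Q_tail (?z + c') < \<epsilon>"
    using Q_tail_strict_antimono[of ?z "?z + c'"] c' Q_tail_inv[OF \<epsilon>] by simp
  have s_ge: "real n powr (1/4) \<le> real (s n)" and s_le: "real (s n) \<le> real n powr (1/4) + 1" for n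
    unfolding s_def using powr_ge_zero[of "real n" "1/4"] by linarith+
  have R_le: "real (R n) \<le> 2 * real n powr (3/8) + 2" if n: "n > 0" for n
  proof -
    have p: "1 \<le> real n powr (1/4)" using n by (simp add: ge_one_powr_ge_zero)
    then have sp: "0 < real (s n)" using s_ge[of n] by linarith
    have "(2 * W n + 1) / s n \<le> (2 * W n + 1) / real n powr (1/4)"
      using s_ge[of n] p sp n by (intro divide_left_mono mult_pos_pos) (auto simp: W_def)
    also have "\<dots> = 2 * real n powr (3/8) + 1 / real n powr (1/4)"
    proof -
      have "real n powr (3/8) = real n powr (5/8) / real n powr (1/4)"
        using powr_diff[of "real n" "5/8" "1/4"] by simp
      then show ?thesis by (simp add: W_def add_divide_distrib)
    qed
    also have "\<dots> \<le> 2 * real n powr (3/8) + 1"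
      using p divide_le_eq_1_pos[of "real n powr (1/4)" 1] by linarith
    finally have "(2 * W n + 1) / s n \<le> 2 * real n powr (3/8) + 1" .
    moreover have "0 \<le> (2 * W n + 1) / s n" by (simp add: W_def)
    ultimately show ?thesis unfolding R_def by linarith
  qed
  have s0: "(\<lambda>n. 2 powr (- real (s n))) \<longlonglongrightarrow> 0"
  proof (rule tendsto_sandwich[of "\<lambda>_. 0" _ _ "\<lambda>n. 2 powr (- (real n powr (1/4)))"])
    show "(\<lambda>n::nat. 2 powr (- (real n powr (1/4)))) \<longlonglongrightarrow> (0::real)" by real_asymp
  qed (use s_ge in auto)
  have "(\<lambda>n. bad n k) \<longlonglongrightarrow> 0 + 0" if "k < d" for k
    unfolding bad_def W_def m_def by (intro tendsto_add s0 round_bad_limit that)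
  then have "(\<lambda>n. \<Sum>k<d. bad n k) \<longlonglongrightarrow> (\<Sum>k<d. 0)" by (intro tendsto_sum) auto
  moreover have "(\<lambda>n. 1 / real n) \<longlonglongrightarrow> 0" by real_asymp
  ultimately have e_lim: "e \<longlonglongrightarrow> Q_tail (?z + c') + ((\<Sum>k<d. 0) + 0)"
    unfolding e_def[abs_def] \<nu>_def by (intro tendsto_add tail_limit)
  have \<delta>_lim: "\<delta> \<longlonglongrightarrow> 0"
  proof (rule tendsto_sandwich[of "\<lambda>_. 0" _ _ "\<lambda>n. (4 * real n powr (3/8) + 8) * 2 powr (- (real n powr (1/4)))"])
    show "\<forall>\<^sub>F n in sequentially. \<delta> n \<le> (4 * real n powr (3/8) + 8) * 2 powr (- (real n powr (1/4)))"
      using eventually_gt_at_top[of 0]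
    proof eventually_elim
      case (elim n)
      have "\<delta> n = (2 * real (R n) + 4) * 2 powr (- real (s n))"
        by (simp add: \<delta>_def powr_minus powr_realpow divide_inverse)
      also have "\<dots> \<le> (4 * real n powr (3/8) + 8) * 2 powr (- (real n powr (1/4)))"
        using R_le[OF elim] s_ge[of n] by (intro mult_mono) auto
      finally show ?case .
    qed
    show "(\<lambda>n::nat. (4 * real n powr (3/8) + 8) * 2 powr (- (real n powr (1/4)))) \<longlonglongrightarrow> (0::real)" by real_asymp
  qed (auto simp: \<delta>_def)
  have "(\<lambda>n. (1 - \<delta> n) ^ d * (1 - e n)) \<longlonglongrightarrow> (1 - 0) ^ d * (1 - (Q_tail (?z + c') + ((\<Sum>k<d. 0) + 0)))"
    by (intro tendsto_intros \<delta>_lim e_lim)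
  then have "\<forall>\<^sub>F n in sequentially. 1 - \<epsilon> < (1 - \<delta> n) ^ d * (1 - e n)"
    by (rule order_tendstoD) (use gap in simp)
  moreover have "\<forall>\<^sub>F n in sequentially. \<delta> n < 1" using \<delta>_lim by (rule order_tendstoD) simp
  moreover have "\<forall>\<^sub>F n::nat in sequentially. real d * (5 * (real n powr (1/4) + 1) + (2 * real n powr (3/8) + 2) + 1) + 1 \<le> c / 2 * sqrt (real n)"
    using assms by real_asymp
  ultimately show ?thesis
    using target_nonneg[OF assms] eventually_gt_at_top[of 0]
  proof eventually_elim
    case (elim n)
    have "sqrt (real n * V) * (?z + c') = sqrt (real n * V) * ?z + c / 2 * sqrt (real n)"
      using sqrt_shift[of n ?z "c / 2"] by (simp add: c'_def)
    moreover have "real d * real (4 * s n + s n + R n + 1) \<le> real d * (5 * (real n powr (1/4) + 1) + (2 * real n powr (3/8) + 2) + 1)"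
      using s_le[of n] R_le[OF elim(5)] by (intro mult_left_mono) auto
    moreover have "real n * IC + sqrt (real n * V) * ?z + c * sqrt (real n) - 1 \<le> real (l n)"
      unfolding l_def by linarith
    ultimately have "\<nu> n + real d * real (4 * s n + s n + R n + 1) \<le> real (l n)"
      using elim(3) unfolding \<nu>_def by linarith
    then have "sim_length n \<le> enat (l n)"
      using elim(1,2,5)
      by (intro sim_length_upper_step[of n "\<nu> n" "l n" "e n"])
         (simp_all add: e_def bad_def m_def W_def R_def s_def \<delta>_def)
    moreover have "real (l n) \<le> real n * IC + sqrt (real n * V) * ?z + c * sqrt (real n)"
      unfolding l_def using elim(4) by linarith
    ultimately show ?case by blast
  qed
qed

theorem sim_length_asymptotics:
  "\<exists>r :: nat \<Rightarrow> real. r \<in> o(\<lambda>n. sqrt (real n)) \<and>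
    (\<forall>n. ereal_of_enat (sim_length n) = ereal (real n * IC + sqrt (real n * V) * inv Q_tail \<epsilon> + r n))"
proof -
  have "\<exists>l. sim_length n = enat l" for n
    using sim_length_finite[of n] by (cases "sim_length n") auto
  then obtain l where l: "\<And>n. sim_length n = enat (l n)" by metis
  define r where "r n = real (l n) - (real n * IC + sqrt (real n * V) * inv Q_tail \<epsilon>)" for n
  have "r \<in> o(\<lambda>n. sqrt (real n))"
  proof (rule landau_o.smallI)
    fix c :: real assume c: "0 < c"
    show "\<forall>\<^sub>F n in sequentially. norm (r n) \<le> c * norm (sqrt (real n))"
      using sim_length_lower[OF c] sim_length_upper[OF c]
    proof eventually_elim
      case (elim n)
      have "real n * IC + sqrt (real n * V) * inv Q_tail \<epsilon> - c * sqrt (real n) \<le> real (l n)" using elim(1) l by blast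
      moreover obtain l' where "enat (l n) \<le> enat l'" "real l' \<le> real n * IC + sqrt (real n * V) * inv Q_tail \<epsilon> + c * sqrt (real n)"
        using elim(2) l by metis
      ultimately show ?case by (simp add: r_def abs_le_iff)
    qed
  qed
  moreover have "ereal_of_enat (sim_length n) = ereal (real n * IC + sqrt (real n * V) * inv Q_tail \<epsilon> + r n)" for n
    by (simp add: l r_def)
  ultimately show ?thesis by blast
qed

end

theorem theorem3:
  fixes P :: "('x::finite \<times> 'y::finite) pmf"
    and \<pi> :: "('x, 'y, 'u, 'a, 'b) protocol"
    and \<epsilon> :: real
  assumes "0 < \<epsilon>" and "\<epsilon> < 1"
    and "is_protocol P \<pi>" and "private_coin \<pi>" and "bounded_rounds P \<pi>"
    and "info_var P \<pi> > 0"
  shows "\<exists>r :: nat \<Rightarrow> real. r \<in> o(\<lambda>n. sqrt (real n)) \<and>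
    (\<forall>n\<ge>1. ereal_of_enat (min_sim_length \<epsilon> (iid_inputs n P) (joint_law_n n P \<pi>)) =
       ereal (real n * info_complexity P \<pi> + sqrt (real n * info_var P \<pi>) * inv Q_tail \<epsilon> + r n))"
proof -
  obtain L d where L: "joint_law P \<pi> = measure_pmf L" "map_pmf snd L = P"
    and d: "\<forall>z\<in>set_pmf L. length (fst z) \<le> d"
    and markov: "\<And>k. \<exists>\<kappa>. \<forall>x y t. joint_mass L (take (Suc k)) t x y =
       (if even k then \<kappa> (Inl x) t else \<kappa> (Inr y) t) * joint_mass L (take k) (take k t) x y"
    by (rule protocol_law[OF assms(3,4,5)]) blast
  \<comment> \<open>\<open>Suc d\<close> makes the number of rounds positive, and cutting at
    \<open>Suc d\<close> still leaves transcripts of length at most \<open>d\<close>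
    unchanged.\<close>
  interpret second_order L take "Suc d" \<epsilon>
  proof unfold_locales
    show "finite (snd ` set_pmf L)" by (rule finite_subset[OF subset_UNIV]) simp
    show "0 < (\<integral>z. (info_density (measure_pmf L) z - (\<integral>z. info_density (measure_pmf L) z \<partial>L))\<^sup>2 \<partial>L)"
      using assms(6) by (simp add: info_var_def info_complexity_def L)
  qed (use markov d assms in auto)
  have "IC = info_complexity P \<pi>" "V = info_var P \<pi>"
    by (simp_all add: IC_def V_def info_var_def info_complexity_def L)
  moreover have "sim_length n = min_sim_length \<epsilon> (iid_inputs n P) (joint_law_n n P \<pi>)" for n
    by (simp add: sim_length_def inputs_seq_law L joint_law_n_eq[OF assms(3) L(1)])
  ultimately show ?thesis using sim_length_asymptotics by auto
qed

end
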